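(* Let $\Omega\subset\mathbb{R}$ be a compact interval, and suppose that both the carrier density $g_0:\Omega\to\mathbb{R}_+$ and the kernel $K:\Omega^2\to\mathbb{R}_+$ are continuous and bounded away from $0$, and that the linear operator $P_{g_0}$ is a compact operator over the space $L_2(\Omega)$ of square-integrable functions on $\Omega$. Then: (1) $P_{g_0}$ admits a spectral decomposition with eigenfunctions $\zeta_1,\zeta_2,\ldots$ (ordered by decreasing eigenvalue, counted with multiplicity), where the first eigenfunction $\zeta_1(\mu)=\sqrt{g_0(\mu)}$ has eigenvalue $1$. (2) The $p$-dimensional exponential family $g_\eta(\mu)=g_0(\mu)\exp[\eta\cdot T(\mu)-\psi(\eta)]$ with statistics $$T_j(\mu)=\frac{1}{\sqrt{g_0(\mu)}}\,\zeta_{j+1}(\mu),\qquad j=1,\ldots,p,$$ is a most favorable $p$-dimensional family, i.e. $T=(T_1,\ldots,T_p)$ belongs to $\Gamma_p(g_0)=\operatorname{argmax}_{T:\Omega\to\mathbb{R}^p}\rho_0(T)$, and its relative efficiency coefficient $\rho_0(T)$ equals the $(p+1)$-st eigenvalue of $P_{g_0}$. (3) If the spectrum of $P_{g_0}$ does not have repeated eigenvalues, the most favorable family $\Gamma_p(g_0)$ is unique up to scaling and rotation.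
   Context: Setting: $\mu_i$ are i.i.d. from a density on the compact interval $\Omega$, and $X_i\in\Omega$ is a noisy version of $\mu_i$: given $\mu$, $X$ has density $x\mapsto K(\mu,x)$ on $\Omega$ (a generic convolution kernel, so $\int_\Omega K(\mu,x)\,dx=1$). For a density $g$ of $\mu$, the marginal density of $X$ is $f(x)=\int_\Omega K(\mu,x)g(\mu)\,d\mu$. The operator $P_g$ is the integral operator on $L_2(\Omega)$ with kernel $$P_g(\mu_1,\mu_2)=\int_\Omega \sqrt{g(\mu_1)}\,K(\mu_1,x)\,f^{-1}(x)\,K(\mu_2,x)\,\sqrt{g(\mu_2)}\,dx.$$ For a statistic $T:\Omega\to\mathbb{R}^p$, consider the family $g_\eta(\mu)=g_0(\mu)\exp[\eta\cdot T(\mu)-\psi(\eta)]$, $\eta\in\mathbb{R}^p$, with $\psi$ the log-partition function, and let $f_\eta$ be the corresponding marginal density of $X$. Define the Fisher information matrices $$\mathcal{I}_\mu(\eta)=-\mathbb{E}_\eta\Big[\tfrac{\partial^2}{\partial\eta^2}\log g_\eta(\mu)\Big],\qquad \mathcal{I}_X(\eta)=-\mathbb{E}_\eta\Big[\tfrac{\partial^2}{\partial\eta^2}\log f_\eta(X)\Big],$$ and the relative efficiency coefficient $$\rho_\eta(T)=\inf_{a\in\mathbb{R}^p,\,a\ne0}\frac{a^\top\mathcal{I}_X(\eta)a}{a^\top\mathcal{I}_\mu(\eta)a}$$ (statistics considered are such that these quantities are well defined, in particular $\mathcal{I}_\mu$ is nonsingular).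
   Formalization: Part (3) as stated fails for p ≥ 2 (ζ_2 can be tilted towards ζ_{p+2}); uniqueness, up to invertible affine maps (orthogonal after standardizing), is proved for families in Γ_p that contain a k-dimensional most favorable subfamily for every k < p. *)

theory Defs
  imports "HOL-Analysis.Analysis"
begin

section \<open>Square-integrable functions on a set of reals\<close>

text \<open>
  Elements of $L_2$ are represented by Borel functions; equality in $L_2$ is therefore
  equality almost everywhere, and only the values on \<open>\<Omega>\<close> matter.
\<close>

abbreviation lborel_on :: "real set \<Rightarrow> real measure" where
  "lborel_on \<Omega> \<equiv> restrict_space lborel \<Omega>"

definition L2_space :: "real set \<Rightarrow> (real \<Rightarrow> real) set" where
  "L2_space \<Omega> =
     {u \<in> borel_measurable (lborel_on \<Omega>). integrable (lborel_on \<Omega>) (\<lambda>x. (u x)\<^sup>2)}"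

definition L2_inner :: "real set \<Rightarrow> (real \<Rightarrow> real) \<Rightarrow> (real \<Rightarrow> real) \<Rightarrow> real" where
  "L2_inner \<Omega> u v = (LINT x|lborel_on \<Omega>. u x * v x)"

definition L2_nrm :: "real set \<Rightarrow> (real \<Rightarrow> real) \<Rightarrow> real" where
  "L2_nrm \<Omega> u = sqrt (L2_inner \<Omega> u u)"

definition compact_operator_L2 ::
  "real set \<Rightarrow> ((real \<Rightarrow> real) \<Rightarrow> (real \<Rightarrow> real)) \<Rightarrow> bool" where
  "compact_operator_L2 \<Omega> A \<longleftrightarrow>
     (\<forall>u\<in>L2_space \<Omega>. A u \<in> L2_space \<Omega>) \<and>
     (\<forall>u\<in>L2_space \<Omega>. \<forall>v\<in>L2_space \<Omega>. \<forall>r s.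
        AE x in lborel_on \<Omega>. A (\<lambda>y. r * u y + s * v y) x = r * A u x + s * A v x) \<and>
     (\<forall>u C. (\<forall>n. u n \<in> L2_space \<Omega> \<and> L2_nrm \<Omega> (u n) \<le> C) \<longrightarrow>
        (\<exists>(r :: nat \<Rightarrow> nat) v. strict_mono r \<and> v \<in> L2_space \<Omega> \<and>
           (\<lambda>n. L2_nrm \<Omega> (\<lambda>x. A (u (r n)) x - v x)) \<longlonglongrightarrow> 0))"

text \<open>
  \<open>A = \<Sum>k. ev k * (\<zeta> k \<otimes> \<zeta> k)\<close> with orthonormal eigenfunctions and decreasing eigenvalues.
  The expansion of \<open>A u\<close> forces every nonzero eigenvalue to be listed with its multiplicity,
  and \<open>u\<close> minus its projection on the \<open>\<zeta> k\<close> to lie in the kernel of \<open>A\<close>.  Indices start at \<open>0\<close>.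
  If \<open>A\<close> is positive of finite rank the list ends with zeros; if it is of infinite rank, only
  the positive eigenvalues fit in a decreasing sequence, and the kernel is the orthogonal
  complement of the \<open>\<zeta> k\<close>.
\<close>

definition spectral_decomposition ::
  "real set \<Rightarrow> ((real \<Rightarrow> real) \<Rightarrow> (real \<Rightarrow> real)) \<Rightarrow> (nat \<Rightarrow> real) \<Rightarrow> (nat \<Rightarrow> real \<Rightarrow> real) \<Rightarrow> bool"
where
  "spectral_decomposition \<Omega> A ev \<zeta> \<longleftrightarrow>
     decseq ev \<and>
     (\<forall>k. \<zeta> k \<in> L2_space \<Omega>) \<and>
     (\<forall>j k. L2_inner \<Omega> (\<zeta> j) (\<zeta> k) = (if j = k then 1 else 0)) \<and>
     (\<forall>k. AE x in lborel_on \<Omega>. A (\<zeta> k) x = ev k * \<zeta> k x) \<and>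
     (\<forall>u\<in>L2_space \<Omega>.
        (\<lambda>n. L2_nrm \<Omega> (\<lambda>x. A u x - (\<Sum>k<n. ev k * L2_inner \<Omega> (\<zeta> k) u * \<zeta> k x))) \<longlonglongrightarrow> 0)"

section \<open>Marginal density and the integral operator\<close>

definition marginal ::
  "real set \<Rightarrow> (real \<Rightarrow> real \<Rightarrow> real) \<Rightarrow> (real \<Rightarrow> real) \<Rightarrow> real \<Rightarrow> real" where
  "marginal \<Omega> K g x = (LINT \<mu>|lborel_on \<Omega>. K \<mu> x * g \<mu>)"

definition P_kernel ::
  "real set \<Rightarrow> (real \<Rightarrow> real \<Rightarrow> real) \<Rightarrow> (real \<Rightarrow> real) \<Rightarrow> real \<Rightarrow> real \<Rightarrow> real" where
  "P_kernel \<Omega> K g \<mu>1 \<mu>2 =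
     (LINT x|lborel_on \<Omega>.
        sqrt (g \<mu>1) * K \<mu>1 x * inverse (marginal \<Omega> K g x) * K \<mu>2 x * sqrt (g \<mu>2))"

definition P_op ::
  "real set \<Rightarrow> (real \<Rightarrow> real \<Rightarrow> real) \<Rightarrow> (real \<Rightarrow> real) \<Rightarrow> (real \<Rightarrow> real) \<Rightarrow> real \<Rightarrow> real" where
  "P_op \<Omega> K g u \<mu> = (LINT \<nu>|lborel_on \<Omega>. P_kernel \<Omega> K g \<mu> \<nu> * u \<nu>)"

section \<open>Exponential families and Fisher information\<close>

text \<open>
  Since statistics of several dimensions are related to one another below, a vector of
  $\mathbb{R}^p$ is a function on \<open>nat\<close> of which only the values at \<open>i < p\<close> are used; likewise for
  matrices, and for a statistic \<open>T\<close>, with components \<open>T i\<close>.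
\<close>

definition natural_parameters ::
  "real set \<Rightarrow> (real \<Rightarrow> real) \<Rightarrow> nat \<Rightarrow> (nat \<Rightarrow> real \<Rightarrow> real) \<Rightarrow> (nat \<Rightarrow> real) set" where
  "natural_parameters \<Omega> g0 p T =
     {\<eta>. integrable (lborel_on \<Omega>) (\<lambda>\<mu>. g0 \<mu> * exp (\<Sum>j<p. \<eta> j * T j \<mu>))}"

definition log_partition ::
  "real set \<Rightarrow> (real \<Rightarrow> real) \<Rightarrow> nat \<Rightarrow> (nat \<Rightarrow> real \<Rightarrow> real) \<Rightarrow> (nat \<Rightarrow> real) \<Rightarrow> real" where
  "log_partition \<Omega> g0 p T \<eta> =
     ln (LINT \<mu>|lborel_on \<Omega>. g0 \<mu> * exp (\<Sum>j<p. \<eta> j * T j \<mu>))"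

definition exp_family ::
  "real set \<Rightarrow> (real \<Rightarrow> real) \<Rightarrow> nat \<Rightarrow> (nat \<Rightarrow> real \<Rightarrow> real) \<Rightarrow> (nat \<Rightarrow> real) \<Rightarrow> real \<Rightarrow> real" where
  "exp_family \<Omega> g0 p T \<eta> \<mu> =
     g0 \<mu> * exp ((\<Sum>j<p. \<eta> j * T j \<mu>) - log_partition \<Omega> g0 p T \<eta>)"

definition partial_deriv ::
  "nat \<Rightarrow> ((nat \<Rightarrow> real) \<Rightarrow> real) \<Rightarrow> (nat \<Rightarrow> real) \<Rightarrow> real" where
  "partial_deriv i F \<eta> = deriv (\<lambda>s. F (\<eta>(i := s))) (\<eta> i)"

definition hessian ::
  "((nat \<Rightarrow> real) \<Rightarrow> real) \<Rightarrow> (nat \<Rightarrow> real) \<Rightarrow> nat \<Rightarrow> nat \<Rightarrow> real" where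
  "hessian F \<eta> i j = partial_deriv i (partial_deriv j F) \<eta>"

definition fisher_mu ::
  "real set \<Rightarrow> (real \<Rightarrow> real) \<Rightarrow> nat \<Rightarrow> (nat \<Rightarrow> real \<Rightarrow> real) \<Rightarrow> (nat \<Rightarrow> real) \<Rightarrow> nat \<Rightarrow> nat \<Rightarrow> real"
where
  "fisher_mu \<Omega> g0 p T \<eta> i j =
     - (LINT \<mu>|lborel_on \<Omega>.
          hessian (\<lambda>\<theta>. ln (exp_family \<Omega> g0 p T \<theta> \<mu>)) \<eta> i j * exp_family \<Omega> g0 p T \<eta> \<mu>)"

definition fisher_X ::
  "real set \<Rightarrow> (real \<Rightarrow> real \<Rightarrow> real) \<Rightarrow> (real \<Rightarrow> real) \<Rightarrow> nat \<Rightarrow> (nat \<Rightarrow> real \<Rightarrow> real) \<Rightarrow>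
     (nat \<Rightarrow> real) \<Rightarrow> nat \<Rightarrow> nat \<Rightarrow> real"
where
  "fisher_X \<Omega> K g0 p T \<eta> i j =
     - (LINT x|lborel_on \<Omega>.
          hessian (\<lambda>\<theta>. ln (marginal \<Omega> K (exp_family \<Omega> g0 p T \<theta>) x)) \<eta> i j *
          marginal \<Omega> K (exp_family \<Omega> g0 p T \<eta>) x)"

definition quad_form :: "nat \<Rightarrow> (nat \<Rightarrow> nat \<Rightarrow> real) \<Rightarrow> (nat \<Rightarrow> real) \<Rightarrow> real" where
  "quad_form p M a = (\<Sum>i<p. \<Sum>j<p. a i * M i j * a j)"

definition invertible_on :: "nat \<Rightarrow> (nat \<Rightarrow> nat \<Rightarrow> real) \<Rightarrow> bool" where
  "invertible_on p A \<longleftrightarrow>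
     (\<exists>B. \<forall>i<p. \<forall>j<p. (\<Sum>k<p. A i k * B k j) = (if i = j then 1 else 0) \<and>
                      (\<Sum>k<p. B i k * A k j) = (if i = j then 1 else 0))"

definition orthogonal_on :: "nat \<Rightarrow> (nat \<Rightarrow> nat \<Rightarrow> real) \<Rightarrow> bool" where
  "orthogonal_on p A \<longleftrightarrow> (\<forall>i<p. \<forall>j<p. (\<Sum>k<p. A i k * A j k) = (if i = j then 1 else 0))"

definition rho ::
  "real set \<Rightarrow> (real \<Rightarrow> real \<Rightarrow> real) \<Rightarrow> (real \<Rightarrow> real) \<Rightarrow> nat \<Rightarrow> (nat \<Rightarrow> real \<Rightarrow> real) \<Rightarrow>
     (nat \<Rightarrow> real) \<Rightarrow> real"
where
  "rho \<Omega> K g0 p T \<eta> =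
     Inf {quad_form p (fisher_X \<Omega> K g0 p T \<eta>) a / quad_form p (fisher_mu \<Omega> g0 p T \<eta>) a
          | a. \<exists>i<p. a i \<noteq> 0}"

section \<open>Most favorable families\<close>

text \<open>
  The statistics for which the coefficient at \<open>\<eta> = 0\<close> is well defined.  The family is only
  required to exist near \<open>0\<close>, so that the maximum below is over the largest class; since the
  kernel is bounded this already makes both Fisher informations at \<open>0\<close> exist.
\<close>

definition admissible ::
  "real set \<Rightarrow> (real \<Rightarrow> real) \<Rightarrow> nat \<Rightarrow> (nat \<Rightarrow> real \<Rightarrow> real) \<Rightarrow> bool" where
  "admissible \<Omega> g0 p T \<longleftrightarrow>
     (\<forall>j<p. T j \<in> borel_measurable (lborel_on \<Omega>)) \<and>
     (\<exists>e>0. \<forall>\<eta>. (\<forall>j<p. \<bar>\<eta> j\<bar> < e) \<longrightarrow> \<eta> \<in> natural_parameters \<Omega> g0 p T) \<and>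
     invertible_on p (fisher_mu \<Omega> g0 p T (\<lambda>_. 0))"

definition most_favorable ::
  "real set \<Rightarrow> (real \<Rightarrow> real \<Rightarrow> real) \<Rightarrow> (real \<Rightarrow> real) \<Rightarrow> nat \<Rightarrow> (nat \<Rightarrow> real \<Rightarrow> real) set" where
  "most_favorable \<Omega> K g0 p =
     {T. is_arg_max (\<lambda>S. rho \<Omega> K g0 p S (\<lambda>_. 0)) (admissible \<Omega> g0 p) T}"

text \<open>
  For \<open>p \<ge> 2\<close> an element of \<open>most_favorable \<Omega> K g0 p\<close> is not determined up to an invertible affine
  map, even if all eigenvalues are simple.  The coefficient is the least value of the Rayleigh
  quotient of the operator on a \<open>p\<close>-dimensional space, and in dimension \<open>2\<close>, for orthonormal
  eigenfunctions with eigenvalues \<open>1 > l1 > l2 > l3\<close>, the space spanned by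
  \<open>cos t * \<zeta> 1 + sin t * \<zeta> 3\<close> and \<open>\<zeta> 2\<close> has least value \<open>l2\<close> for all small \<open>t\<close>.
  Uniqueness holds when the family also contains, for every smaller dimension \<open>k\<close>, a
  \<open>k\<close>-dimensional most favorable subfamily.  For \<open>p = 1\<close> this is no restriction.
\<close>

definition hereditarily_most_favorable ::
  "real set \<Rightarrow> (real \<Rightarrow> real \<Rightarrow> real) \<Rightarrow> (real \<Rightarrow> real) \<Rightarrow> nat \<Rightarrow> (nat \<Rightarrow> real \<Rightarrow> real) set" where
  "hereditarily_most_favorable \<Omega> K g0 p =
     {T \<in> most_favorable \<Omega> K g0 p.
        \<forall>k\<in>{1..<p}. \<exists>B. (\<lambda>i \<mu>. \<Sum>j<p. B i j * T j \<mu>) \<in> most_favorable \<Omega> K g0 k}"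

definition standardized ::
  "real set \<Rightarrow> (real \<Rightarrow> real) \<Rightarrow> nat \<Rightarrow> (nat \<Rightarrow> real \<Rightarrow> real) \<Rightarrow> bool" where
  "standardized \<Omega> g0 p T \<longleftrightarrow>
     (\<forall>i<p. \<forall>j<p. fisher_mu \<Omega> g0 p T (\<lambda>_. 0) i j = (if i = j then 1 else 0))"

text \<open>
  The coefficient is invariant under every invertible linear change of the statistic (scalings
  composed with rotations), and additive constants do not change the family since
  \<open>log_partition\<close> absorbs them.  Once both statistics are scaled to have identity Fisher
  information, only an orthogonal map is left.
\<close>

definition scaling_rotation_equiv ::
  "real set \<Rightarrow> (real \<Rightarrow> real) \<Rightarrow> nat \<Rightarrow> (nat \<Rightarrow> real \<Rightarrow> real) \<Rightarrow> (nat \<Rightarrow> real \<Rightarrow> real) \<Rightarrow> bool" where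
  "scaling_rotation_equiv \<Omega> g0 p S T \<longleftrightarrow>
     (\<exists>A c. invertible_on p A \<and>
        (\<forall>i<p. AE \<mu> in lborel_on \<Omega>. S i \<mu> = (\<Sum>j<p. A i j * T j \<mu>) + c i) \<and>
        (standardized \<Omega> g0 p S \<and> standardized \<Omega> g0 p T \<longrightarrow> orthogonal_on p A))"

definition eigen_statistic ::
  "(real \<Rightarrow> real) \<Rightarrow> (nat \<Rightarrow> real \<Rightarrow> real) \<Rightarrow> nat \<Rightarrow> real \<Rightarrow> real" where
  "eigen_statistic g0 \<zeta> j \<mu> = 1 / sqrt (g0 \<mu>) * \<zeta> (Suc j) \<mu>"

end

theory Submission
  imports Defs
begin

text \<open>
  Everything reduces to Rayleigh quotients of the operator $P$.  Attach to a statistic \<open>t\<close> its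
  score \<open>sqrt g0 * (t - E t)\<close>, an element of $L_2$ orthogonal to \<open>sqrt g0\<close>.  Differentiating twice
  under the integral sign shows that the Hessian of the log-partition function at \<open>0\<close> is the
  covariance of the statistics under \<open>g0\<close>, while the Hessian of \<open>ln (f_eta x)\<close> is their conditional
  covariance given \<open>X = x\<close> minus that covariance.  Hence the information about \<open>\<mu>\<close> is the Gram
  matrix of the scores, the information in \<open>X\<close> is the covariance of the posterior means, and by
  Fubini the latter is the matrix of the form \<open>u, v \<mapsto> \<langle>P u, v\<rangle>\<close> on the scores
  (\<open>fisher_mu_eq_inner\<close>, \<open>fisher_X_eq_form\<close>).  So \<open>rho\<close> at \<open>0\<close> is the least Rayleigh quotient of
  $P$ on the $p$-dimensional span of the scores, a subspace of the orthogonal complement of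
  \<open>sqrt g0\<close>.

  The operator is symmetric and positive because
  \<open>\<langle>P u, v\<rangle> = \<integral> (\<integral> K \<mu> x * sqrt (g0 \<mu>) * u \<mu> d\<mu>) * (\<integral> K \<mu> x * sqrt (g0 \<mu>) * v \<mu> d\<mu>) / f x dx\<close>
  (\<open>P_form\<close>), a contraction by the inequality of Cauchy and Schwarz with weight \<open>K \<mu> x\<close>
  (\<open>push_Cauchy_Schwarz\<close>), and it fixes \<open>sqrt g0\<close>.  Its eigenfunctions are found greedily: on the
  orthogonal complement of those already chosen, a maximizing sequence of the Rayleigh quotient has a
  subsequence whose image under $P$ converges by compactness, and if the maximum is positive this
  forces the subsequence itself to converge to an eigenfunction (\<open>perp_top_eigenvector\<close>).  Since $P$
  maps $L_2$ into continuous functions, eigenfunctions with positive eigenvalue can be taken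
  continuous; if the list has to be continued in the kernel, polynomials orthogonal to the preceding
  eigenfunctions serve (\<open>spectral_decomposition_exists\<close>, \<open>exists_continuous_perp\<close>).

  Optimality is the argument of Courant and Fischer.  A $p$-dimensional space orthogonal to the first
  eigenfunction contains a nonzero vector orthogonal to the first \<open>p\<close> ones, \<open>\<zeta> 0\<close> to \<open>\<zeta> (p - 1)\<close>, and
  its Rayleigh quotient is at most \<open>ev p\<close> (\<open>rho_le_eigenvalue\<close>); the span of \<open>\<zeta> 1\<close> to \<open>\<zeta> p\<close> attains
  the bound (\<open>rho_eigen_statistic\<close>).  If the bound is attained and \<open>ev p\<close> is simple, that vector is a
  multiple of \<open>\<zeta> p\<close> (\<open>form_eq_on_perp\<close>).  Applied to the most favorable subfamilies of all
  dimensions \<open>k \<le> p\<close>, this puts \<open>\<zeta> 1\<close> to \<open>\<zeta> p\<close> into the span of the scores.  The span is therefore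
  determined, and two statistics whose scores span the same space are affine images of each other
  (\<open>scaling_rotation_equiv_of_same_span\<close>).
\<close>

section \<open>Positive semidefinite forms on function spaces\<close>

text \<open>
  Two symmetric forms on the same functions are used side by side: the inner product of $L_2$ and
  \<open>u, v \<mapsto> \<langle>P u, v\<rangle>\<close>.  Neither is definite, the first because functions are identified only almost
  everywhere, the second because the operator may have a kernel.
\<close>

locale psd_form =
  fixes V :: "('a \<Rightarrow> real) set" and B :: "('a \<Rightarrow> real) \<Rightarrow> ('a \<Rightarrow> real) \<Rightarrow> real"
  assumes zero_mem: "(\<lambda>x. 0) \<in> V"
    and lin_mem: "\<And>u v r s. u \<in> V \<Longrightarrow> v \<in> V \<Longrightarrow> (\<lambda>x. r * u x + s * v x) \<in> V"
    and lin_left: "\<And>u v w r s. u \<in> V \<Longrightarrow> v \<in> V \<Longrightarrow> w \<in> V \<Longrightarrow>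
          B (\<lambda>x. r * u x + s * v x) w = r * B u w + s * B v w"
    and sym: "\<And>u v. u \<in> V \<Longrightarrow> v \<in> V \<Longrightarrow> B u v = B v u"
    and psd: "\<And>u. u \<in> V \<Longrightarrow> 0 \<le> B u u"
begin

lemma scale_mem: "u \<in> V \<Longrightarrow> (\<lambda>x. r * u x) \<in> V"
  using lin_mem[of u u r 0] by simp

lemma add_mem: "u \<in> V \<Longrightarrow> v \<in> V \<Longrightarrow> (\<lambda>x. u x + v x) \<in> V"
  using lin_mem[of u v 1 1] by simp

lemma diff_mem: "u \<in> V \<Longrightarrow> v \<in> V \<Longrightarrow> (\<lambda>x. u x - v x) \<in> V"
  using lin_mem[of u v 1 "-1"] by simp

lemma scale_left: "u \<in> V \<Longrightarrow> w \<in> V \<Longrightarrow> B (\<lambda>x. r * u x) w = r * B u w"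
  using lin_left[of u u w r 0] by simp

lemma add_left: "u \<in> V \<Longrightarrow> v \<in> V \<Longrightarrow> w \<in> V \<Longrightarrow> B (\<lambda>x. u x + v x) w = B u w + B v w"
  using lin_left[of u v w 1 1] by simp

lemma diff_left: "u \<in> V \<Longrightarrow> v \<in> V \<Longrightarrow> w \<in> V \<Longrightarrow> B (\<lambda>x. u x - v x) w = B u w - B v w"
  using lin_left[of u v w 1 "-1"] by simp

lemma zero_left: "w \<in> V \<Longrightarrow> B (\<lambda>x. 0) w = 0"
  using scale_left[OF zero_mem, of w 0] by simp

lemma scale_right: "u \<in> V \<Longrightarrow> w \<in> V \<Longrightarrow> B w (\<lambda>x. r * u x) = r * B w u"
  using scale_left[of u w r] by (simp add: sym[of w "\<lambda>x. r * u x"] sym[of w u] scale_mem)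

lemma add_right: "u \<in> V \<Longrightarrow> v \<in> V \<Longrightarrow> w \<in> V \<Longrightarrow> B w (\<lambda>x. u x + v x) = B w u + B w v"
  using add_left[of u v w]
  by (simp add: sym[of w "\<lambda>x. u x + v x"] sym[of w u] sym[of w v] add_mem)

lemma diff_right: "u \<in> V \<Longrightarrow> v \<in> V \<Longrightarrow> w \<in> V \<Longrightarrow> B w (\<lambda>x. u x - v x) = B w u - B w v"
  using diff_left[of u v w]
  by (simp add: sym[of w "\<lambda>x. u x - v x"] sym[of w u] sym[of w v] diff_mem)

lemma sum_mem: "finite I \<Longrightarrow> (\<And>i. i \<in> I \<Longrightarrow> u i \<in> V) \<Longrightarrow> (\<lambda>x. \<Sum>i\<in>I. c i * u i x) \<in> V"
proof (induction I rule: finite_induct)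
  case (insert i I)
  then show ?case using lin_mem[of "u i" "\<lambda>x. \<Sum>i\<in>I. c i * u i x" "c i" 1] by simp
qed (simp add: zero_mem)

lemma sum_left:
  "finite I \<Longrightarrow> (\<And>i. i \<in> I \<Longrightarrow> u i \<in> V) \<Longrightarrow> w \<in> V \<Longrightarrow>
     B (\<lambda>x. \<Sum>i\<in>I. c i * u i x) w = (\<Sum>i\<in>I. c i * B (u i) w)"
proof (induction I rule: finite_induct)
  case (insert i I)
  then show ?case
    using lin_left[of "u i" "\<lambda>x. \<Sum>i\<in>I. c i * u i x" w "c i" 1] sum_mem[of I u c] by simp
qed (simp add: zero_left)

lemma sum_right:
  "finite I \<Longrightarrow> (\<And>i. i \<in> I \<Longrightarrow> u i \<in> V) \<Longrightarrow> w \<in> V \<Longrightarrow>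
     B w (\<lambda>x. \<Sum>i\<in>I. c i * u i x) = (\<Sum>i\<in>I. c i * B w (u i))"
  by (subst sym[OF _ sum_mem]) (auto simp: sum_left intro!: sum.cong sym)

lemma sum_sum:
  assumes "finite I" "\<And>i. i \<in> I \<Longrightarrow> u i \<in> V"
  shows "B (\<lambda>x. \<Sum>i\<in>I. c i * u i x) (\<lambda>x. \<Sum>i\<in>I. d i * u i x) =
           (\<Sum>i\<in>I. \<Sum>j\<in>I. c i * B (u i) (u j) * d j)"
proof -
  have "B (\<lambda>x. \<Sum>i\<in>I. c i * u i x) (\<lambda>x. \<Sum>i\<in>I. d i * u i x) =
          (\<Sum>i\<in>I. c i * (\<Sum>j\<in>I. d j * B (u i) (u j)))"
    by (subst sum_left[OF assms sum_mem[OF assms]])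
       (auto intro!: sum.cong simp: sum_right assms)
  then show ?thesis by (simp add: sum_distrib_left mult_ac)
qed

lemma diff_square:
  "u \<in> V \<Longrightarrow> v \<in> V \<Longrightarrow> B (\<lambda>x. u x - v x) (\<lambda>x. u x - v x) = B u u - 2 * B u v + B v v"
  by (simp add: diff_left diff_right diff_mem sym[of v u])

lemma Cauchy_Schwarz:
  assumes u: "u \<in> V" and v: "v \<in> V"
  shows "(B u v)\<^sup>2 \<le> B u u * B v v"
proof -
  have quad: "0 \<le> B u u + 2 * t * B u v + t\<^sup>2 * B v v" for t
    using psd[OF lin_mem[OF u v, of 1 t]] u v
      lin_left[OF u v, of "\<lambda>x. 1 * u x + t * v x" 1 t] lin_mem[OF u v, of 1 t]
    by (simp add: add_right scale_right scale_mem sym[of v u] power2_eq_square algebra_simps)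
  show ?thesis
  proof (cases "B v v = 0")
    case True
    \<comment> \<open>a nonconstant affine function of \<open>t\<close> is not bounded below\<close>
    have "B u v = 0"
    proof (rule ccontr)
      assume "B u v \<noteq> 0"
      then show False
        using quad[of "- (B u u + 1) / (2 * B u v)"] True by (simp add: field_simps)
    qed
    then show ?thesis by (simp add: True)
  next
    case False
    with psd[OF v] have "B v v > 0" by simp
    then show ?thesis
      \<comment> \<open>the minimizer of the quadratic polynomial in \<open>t\<close>\<close>
      using quad[of "- B u v / B v v"] by (simp add: field_simps power2_eq_square)
  qed
qed

lemma Cauchy_Schwarz_abs:
  assumes u: "u \<in> V" and v: "v \<in> V"
  shows "\<bar>B u v\<bar> \<le> sqrt (B u u) * sqrt (B v v)"
  using real_sqrt_le_mono[OF Cauchy_Schwarz[OF u v]] by (simp add: real_sqrt_mult)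

lemma null_left:
  assumes u: "u \<in> V" and v: "v \<in> V" and "B u u = 0"
  shows "B u v = 0"
  using Cauchy_Schwarz[OF u v] assms(3) by simp

lemma triangle:
  assumes u: "u \<in> V" and v: "v \<in> V"
  shows "sqrt (B (\<lambda>x. u x + v x) (\<lambda>x. u x + v x)) \<le> sqrt (B u u) + sqrt (B v v)"
proof (rule real_le_lsqrt)
  have "B (\<lambda>x. u x + v x) (\<lambda>x. u x + v x) = B u u + 2 * B u v + B v v"
    using u v by (simp add: add_left add_right add_mem sym[of v u])
  also have "\<dots> \<le> B u u + 2 * (sqrt (B u u) * sqrt (B v v)) + B v v"
    using Cauchy_Schwarz_abs[OF u v] by simp
  also have "\<dots> = (sqrt (B u u) + sqrt (B v v))\<^sup>2"
    using psd[OF u] psd[OF v] by (simp add: power2_eq_square algebra_simps)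
  finally show "B (\<lambda>x. u x + v x) (\<lambda>x. u x + v x) \<le> (sqrt (B u u) + sqrt (B v v))\<^sup>2" .
qed (use psd[OF u] psd[OF v] in simp)

lemma tendsto_left:
  assumes "\<And>n. u n \<in> V" "w \<in> V" "z \<in> V"
    and "(\<lambda>n. sqrt (B (\<lambda>x. u n x - w x) (\<lambda>x. u n x - w x))) \<longlonglongrightarrow> 0"
  shows "(\<lambda>n. B (u n) z) \<longlonglongrightarrow> B w z"
proof -
  have "(\<lambda>n. sqrt (B (\<lambda>x. u n x - w x) (\<lambda>x. u n x - w x)) * sqrt (B z z)) \<longlonglongrightarrow> 0"
    using tendsto_mult_right[OF assms(4), of "sqrt (B z z)"] by simp
  then have "(\<lambda>n. B (\<lambda>x. u n x - w x) z) \<longlonglongrightarrow> 0"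
    by (rule Lim_null_comparison[rotated])
      (use Cauchy_Schwarz_abs[OF diff_mem, OF assms(1,2,3)] in \<open>auto intro!: always_eventually\<close>)
  then have "(\<lambda>n. B (u n) z - B w z) \<longlonglongrightarrow> 0"
    using assms by (simp add: diff_left)
  then show ?thesis by (simp add: LIM_zero_iff)
qed

end

text \<open>
  The residual of \<open>v\<close> after projection on finitely many orthonormal vectors has nonnegative square;
  this is Bessel's inequality, which makes the squared coefficients summable.
\<close>

lemma psd_form_orthogonal_projection:
  assumes "psd_form V ip"
    and ze: "\<And>k::nat. \<zeta> k \<in> V"
    and on: "\<And>j k. ip (\<zeta> j) (\<zeta> k) = (if j = k then 1 else (0::real))"
    and v: "v \<in> V"
  defines "r n \<equiv> \<lambda>x. v x - (\<Sum>k<n. ip (\<zeta> k) v * \<zeta> k x)"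
  shows "r n \<in> V"
    and "k < n \<Longrightarrow> ip (\<zeta> k) (r n) = 0"
    and "ip (r n) (r n) = ip v v - (\<Sum>k<n. (ip (\<zeta> k) v)\<^sup>2)"
    and "(\<Sum>k<n. (ip (\<zeta> k) v)\<^sup>2) \<le> ip v v"
    and "(\<lambda>k. ip (\<zeta> k) v) \<longlonglongrightarrow> 0"
proof -
  interpret psd_form V ip by fact
  have S: "(\<lambda>x. \<Sum>k<n. ip (\<zeta> k) v * \<zeta> k x) \<in> V" for n
    by (intro sum_mem) (auto simp: ze)
  show r: "r n \<in> V" for n unfolding r_def by (intro diff_mem v S)
  show orth: "ip (\<zeta> k) (r n) = 0" if "k < n" for k n
    using that unfolding r_def
    by (subst diff_right) (auto simp: v S ze sum_right on if_distrib sum.delta cong: if_cong)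
  show sq: "ip (r n) (r n) = ip v v - (\<Sum>k<n. (ip (\<zeta> k) v)\<^sup>2)" for n
    unfolding r_def
    by (subst diff_square)
       (auto simp: v S ze sum_right sum_left on if_distrib sum.delta power2_eq_square sym[OF v ze] cong: if_cong)
  show bes: "(\<Sum>k<n. (ip (\<zeta> k) v)\<^sup>2) \<le> ip v v" for n
    using psd[OF r[of n]] sq[of n] by simp
  have "summable (\<lambda>k. (ip (\<zeta> k) v)\<^sup>2)"
    by (rule summableI_nonneg_bounded[where x="ip v v"]) (auto simp: bes)
  then have "(\<lambda>k. (ip (\<zeta> k) v)\<^sup>2) \<longlonglongrightarrow> 0" by (rule summable_LIMSEQ_zero)
  then show "(\<lambda>k. ip (\<zeta> k) v) \<longlonglongrightarrow> 0" by simp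
qed

section \<open>The form of square-integrable functions\<close>

lemma L2_spaceI:
  "u \<in> borel_measurable (lborel_on \<Omega>) \<Longrightarrow> integrable (lborel_on \<Omega>) (\<lambda>x. (u x)\<^sup>2) \<Longrightarrow> u \<in> L2_space \<Omega>"
  by (simp add: L2_space_def)

lemma L2_measurable: "u \<in> L2_space \<Omega> \<Longrightarrow> u \<in> borel_measurable (lborel_on \<Omega>)"
  by (simp add: L2_space_def)

lemma L2_product_integrable:
  assumes "u \<in> L2_space \<Omega>" "v \<in> L2_space \<Omega>"
  shows "integrable (lborel_on \<Omega>) (\<lambda>x. u x * v x)"
proof (rule Bochner_Integration.integrable_bound)
  show "integrable (lborel_on \<Omega>) (\<lambda>x. (u x)\<^sup>2 + (v x)\<^sup>2)"
    using assms by (auto simp: L2_space_def)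
  show "(\<lambda>x. u x * v x) \<in> borel_measurable (lborel_on \<Omega>)"
    using assms by (auto simp: L2_space_def intro!: borel_measurable_times)
  have "\<bar>s * t\<bar> \<le> s\<^sup>2 + t\<^sup>2" for s t :: real
    using zero_le_power2[of "s - t"] zero_le_power2[of "s + t"] zero_le_power2[of s] zero_le_power2[of t]
    unfolding power2_diff power2_sum by linarith
  then show "AE x in lborel_on \<Omega>. norm (u x * v x) \<le> norm ((u x)\<^sup>2 + (v x)\<^sup>2)"
    by simp
qed

interpretation L2: psd_form "L2_space \<Omega>" "L2_inner \<Omega>" for \<Omega>
proof
  show lin: "(\<lambda>x. r * u x + s * v x) \<in> L2_space \<Omega>"
    if uv: "u \<in> L2_space \<Omega>" "v \<in> L2_space \<Omega>" for u v r s
  proof (rule L2_spaceI)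
    show "(\<lambda>x. r * u x + s * v x) \<in> borel_measurable (lborel_on \<Omega>)"
      using uv by (auto simp: L2_space_def intro!: borel_measurable_add borel_measurable_times)
    have "integrable (lborel_on \<Omega>) (\<lambda>x. r\<^sup>2 * (u x)\<^sup>2 + (2 * r * s * (u x * v x) + s\<^sup>2 * (v x)\<^sup>2))"
      using uv L2_product_integrable[OF uv] unfolding L2_space_def
      by (intro Bochner_Integration.integrable_add integrable_mult_right) auto
    then show "integrable (lborel_on \<Omega>) (\<lambda>x. (r * u x + s * v x)\<^sup>2)"
      by (simp add: power2_eq_square algebra_simps)
  qed
  show "L2_inner \<Omega> (\<lambda>x. r * u x + s * v x) w = r * L2_inner \<Omega> u w + s * L2_inner \<Omega> v w"
    if "u \<in> L2_space \<Omega>" "v \<in> L2_space \<Omega>" "w \<in> L2_space \<Omega>" for u v w r s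
  proof -
    have "L2_inner \<Omega> (\<lambda>x. r * u x + s * v x) w
        = (LINT x|lborel_on \<Omega>. r * (u x * w x) + s * (v x * w x))"
      unfolding L2_inner_def by (simp add: algebra_simps)
    also have "\<dots> = r * L2_inner \<Omega> u w + s * L2_inner \<Omega> v w"
      unfolding L2_inner_def
      using L2_product_integrable[OF that(1,3)] L2_product_integrable[OF that(2,3)] by simp
    finally show ?thesis .
  qed
qed (auto simp: L2_space_def L2_inner_def mult.commute)

lemma L2_inner_null_AE:
  assumes "u \<in> L2_space \<Omega>" and "L2_inner \<Omega> u u = 0"
  shows "AE x in lborel_on \<Omega>. u x = 0"
proof -
  have "(AE x in lborel_on \<Omega>. u x * u x = 0)"
    using integral_nonneg_eq_0_iff_AE[OF L2_product_integrable[OF assms(1,1)]] assms(2)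
    by (simp add: L2_inner_def)
  then show ?thesis by simp
qed

lemma L2_inner_cong_AE:
  assumes "u \<in> L2_space \<Omega>" "u' \<in> L2_space \<Omega>" "v \<in> L2_space \<Omega>" "v' \<in> L2_space \<Omega>"
    and "AE x in lborel_on \<Omega>. u x = u' x" "AE x in lborel_on \<Omega>. v x = v' x"
  shows "L2_inner \<Omega> u v = L2_inner \<Omega> u' v'"
  unfolding L2_inner_def
proof (rule integral_cong_AE)
  show "AE x in lborel_on \<Omega>. u x * v x = u' x * v' x"
    using assms(5,6) by eventually_elim simp
qed (use assms in \<open>auto simp: L2_space_def intro!: borel_measurable_times\<close>)

section \<open>Spectral decomposition of compact positive contractions\<close>

text \<open>
  Only the \<open>z k\<close> with \<open>k < n\<close> enter, so that the orthogonal complement of the vectors chosen so far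
  can be formed while a sequence is being defined recursively.
\<close>

definition perp :: "real set \<Rightarrow> (nat \<Rightarrow> real \<Rightarrow> real) \<Rightarrow> nat \<Rightarrow> (real \<Rightarrow> real) set" where
  "perp \<Omega> z n = {v \<in> L2_space \<Omega>. \<forall>k<n. L2_inner \<Omega> (z k) v = 0}"

text \<open>
  Linearity is required up to null sets only, because a compact operator on $L_2$ acts here on
  functions and not on their classes.
\<close>

locale psd_operator =
  fixes \<Omega> :: "real set" and A :: "(real \<Rightarrow> real) \<Rightarrow> real \<Rightarrow> real"
  assumes mem: "\<And>u. u \<in> L2_space \<Omega> \<Longrightarrow> A u \<in> L2_space \<Omega>"
    and lin: "\<And>u v r s. u \<in> L2_space \<Omega> \<Longrightarrow> v \<in> L2_space \<Omega> \<Longrightarrow>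
          AE x in lborel_on \<Omega>. A (\<lambda>y. r * u y + s * v y) x = r * A u x + s * A v x"
    and self_adjoint: "\<And>u v. u \<in> L2_space \<Omega> \<Longrightarrow> v \<in> L2_space \<Omega> \<Longrightarrow>
          L2_inner \<Omega> (A u) v = L2_inner \<Omega> u (A v)"
    and nonneg: "\<And>u. u \<in> L2_space \<Omega> \<Longrightarrow> 0 \<le> L2_inner \<Omega> (A u) u"
    and contraction: "\<And>u. u \<in> L2_space \<Omega> \<Longrightarrow> L2_inner \<Omega> (A u) u \<le> L2_inner \<Omega> u u"
begin

abbreviation ip where "ip \<equiv> L2_inner \<Omega>"
abbreviation B where "B u v \<equiv> L2_inner \<Omega> (A u) v"

sublocale form: psd_form "L2_space \<Omega>" "\<lambda>u v. L2_inner \<Omega> (A u) v"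
proof
  fix u v w r s assume "u \<in> L2_space \<Omega>" "v \<in> L2_space \<Omega>" "w \<in> L2_space \<Omega>"
  then show "B (\<lambda>x. r * u x + s * v x) w = r * B u w + s * B v w"
    by (subst L2_inner_cong_AE[OF mem[OF L2.lin_mem] L2.lin_mem[OF mem mem] _ _ lin, of u v w w])
       (simp_all add: L2.lin_left mem)
next
  fix u v assume "u \<in> L2_space \<Omega>" "v \<in> L2_space \<Omega>"
  then show "B u v = B v u"
    using self_adjoint[of u v] L2.sym[of "A v" \<Omega> u] by (simp add: mem)
qed (auto simp: L2.zero_mem L2.lin_mem nonneg)

text \<open>
  A self-adjoint operator annihilates null functions \<open>d\<close>, since \<open>\<langle>A d, A d\<rangle> = \<langle>d, A (A d)\<rangle>\<close>.
\<close>

lemma cong_AE: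
  assumes u: "u \<in> L2_space \<Omega>" and u': "u' \<in> L2_space \<Omega>"
    and eq: "AE x in lborel_on \<Omega>. u x = u' x"
  shows "AE x in lborel_on \<Omega>. A u x = A u' x"
proof -
  let ?d = "\<lambda>x. 1 * u x + (-1) * u' x"
  have d: "?d \<in> L2_space \<Omega>" by (intro L2.lin_mem u u')
  have "ip (A ?d) (A ?d) = ip ?d (A (A ?d))" by (intro self_adjoint d mem)
  also have "\<dots> = ip (\<lambda>x. 0) (A (A ?d))"
    by (rule L2_inner_cong_AE) (use eq in \<open>auto simp: mem[OF mem[OF d], simplified] d[simplified] L2.zero_mem\<close>)
  finally have "AE x in lborel_on \<Omega>. A ?d x = 0"
    by (intro L2_inner_null_AE mem d) (simp add: L2.zero_left mem[OF mem[OF d], simplified])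
  with lin[OF u u', of 1 "-1"] show ?thesis by eventually_elim simp
qed

lemma eigen_perp:
  assumes z: "\<And>k. k < n \<Longrightarrow> z k \<in> L2_space \<Omega>"
    and e: "\<And>k. k < n \<Longrightarrow> AE x in lborel_on \<Omega>. A (z k) x = e k * z k x"
    and v: "v \<in> perp \<Omega> z n"
  shows "A v \<in> perp \<Omega> z n"
proof -
  have v2: "v \<in> L2_space \<Omega>" using v by (simp add: perp_def)
  have "ip (z k) (A v) = 0" if "k < n" for k
  proof -
    have "ip (z k) (A v) = ip (A (z k)) v" using self_adjoint z that v2 by simp
    also have "\<dots> = ip (\<lambda>x. e k * z k x) v"
      by (rule L2_inner_cong_AE) (use that in \<open>auto simp: z mem v2 L2.scale_mem e\<close>)
    also have "\<dots> = 0" using v that by (simp add: L2.scale_left z v2 perp_def)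
    finally show ?thesis .
  qed
  then show ?thesis by (simp add: perp_def mem v2)
qed

text \<open>
  The inequality of Cauchy and Schwarz for the form of \<open>A\<close>, applied to \<open>v\<close> and \<open>A v\<close>, bounds
  \<open>\<langle>A v, A v\<rangle>\<close> squared by \<open>\<langle>A v, v\<rangle> * \<langle>A (A v), A v\<rangle>\<close>.  A bound on the form thus yields the same bound on
  the operator norm.
\<close>

lemma norm_le_of_form_le:
  assumes v: "v \<in> L2_space \<Omega>" and M: "0 \<le> M"
    and "B v v \<le> M * ip v v" and "B (A v) (A v) \<le> M * ip (A v) (A v)"
  shows "ip (A v) (A v) \<le> M\<^sup>2 * ip v v"
proof (cases "ip (A v) (A v) = 0")
  case True then show ?thesis using L2.psd[OF v] by simp
next
  case False
  then have pos: "ip (A v) (A v) > 0" using L2.psd[OF mem[OF v]] by simp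
  have "(ip (A v) (A v))\<^sup>2 \<le> B v v * B (A v) (A v)"
    by (rule form.Cauchy_Schwarz[OF v mem[OF v]])
  also have "\<dots> \<le> (M * ip v v) * (M * ip (A v) (A v))"
    by (intro mult_mono assms nonneg mem mult_nonneg_nonneg M L2.psd v)
  finally have "ip (A v) (A v) * ip (A v) (A v) \<le> (M\<^sup>2 * ip v v) * ip (A v) (A v)"
    by (simp add: power2_eq_square mult_ac)
  then show ?thesis using pos by simp
qed

text \<open>
  Let \<open>M\<close> be the supremum of \<open>\<langle>A u, u\<rangle>\<close> over unit vectors of the subspace and \<open>u m\<close> a maximizing
  sequence.  Then \<open>M * u m - A (u m)\<close> tends to \<open>0\<close> because its square is at most
  \<open>2 * M * (M - \<langle>A (u m), u m\<rangle>)\<close>.  By compactness a subsequence of \<open>A (u m)\<close> converges, so if \<open>M > 0\<close>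
  the same subsequence of \<open>u m\<close> converges, and its limit is an eigenvector.
\<close>

lemma perp_top_eigenvector:
  assumes cpt: "compact_operator_L2 \<Omega> A"
    and z: "\<And>k. k < n \<Longrightarrow> z k \<in> L2_space \<Omega>"
    and e: "\<And>k. k < n \<Longrightarrow> AE x in lborel_on \<Omega>. A (z k) x = e k * z k x"
    and v0: "v0 \<in> perp \<Omega> z n" "ip v0 v0 = 1"
  obtains M where "M \<ge> 0" "\<And>v. v \<in> perp \<Omega> z n \<Longrightarrow> B v v \<le> M * ip v v"
    "M > 0 \<Longrightarrow> \<exists>w\<in>perp \<Omega> z n. ip w w = 1 \<and> (AE x in lborel_on \<Omega>. A w x = M * w x)"
proof -
  let ?V = "perp \<Omega> z n"
  have V: "v \<in> L2_space \<Omega>" if "v \<in> ?V" for v using that by (simp add: perp_def)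
  define S where "S = {B v v | v. v \<in> ?V \<and> ip v v = 1}"
  define M where "M = Sup S"
  have bdd: "bdd_above S"
    unfolding S_def by (rule bdd_aboveI[of _ 1]) (use contraction V in fastforce)
  have ne: "S \<noteq> {}" using v0 by (auto simp: S_def)
  have Mub: "B v v \<le> M" if "v \<in> ?V" "ip v v = 1" for v
    unfolding M_def using that by (intro cSup_upper bdd) (auto simp: S_def)
  have M0: "0 \<le> M" using Mub[OF v0] nonneg[OF V[OF v0(1)]] by simp
  have Mle: "B v v \<le> M * ip v v" if v: "v \<in> ?V" for v
  proof (cases "ip v v = 0")
    case True
    then have "B v v = 0"
      using L2.null_left[OF V[OF v] mem[OF V[OF v]]] L2.sym[OF V[OF v] mem[OF V[OF v]]] by simp
    then show ?thesis by (simp add: True)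
  next
    case False
    then have pos: "ip v v > 0" using L2.psd[OF V[OF v]] by simp
    define t where "t = 1 / sqrt (ip v v)"
    have t2: "t * t = 1 / ip v v" unfolding t_def using pos by simp
    have "(\<lambda>x. t * v x) \<in> ?V"
      using v z by (auto simp: perp_def L2.scale_mem L2.scale_right)
    then have "B (\<lambda>x. t * v x) (\<lambda>x. t * v x) \<le> M"
      by (rule Mub)
         (use V[OF v] pos t2 in \<open>simp add: L2.scale_left L2.scale_right L2.scale_mem mult.assoc[symmetric]\<close>)
    then have "t * t * B v v \<le> M"
      using V[OF v] by (simp add: form.scale_left L2.scale_right L2.scale_mem mem mult.assoc)
    then show ?thesis using pos unfolding t2 by (simp add: field_simps)
  qed
  show thesis
  proof (rule that[OF M0 Mle])
    assume Mpos: "M > 0"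
    have "\<exists>u. u \<in> ?V \<and> ip u u = 1 \<and> B u u > M - 1 / real (Suc m)" for m
    proof -
      have "M - 1 / real (Suc m) < Sup S" unfolding M_def[symmetric] by simp
      then obtain y where "y \<in> S" "M - 1 / real (Suc m) < y" using less_cSup_iff[OF ne bdd] by auto
      then show ?thesis by (auto simp: S_def)
    qed
    then obtain u where u: "\<And>m. u m \<in> ?V" "\<And>m. ip (u m) (u m) = 1"
      "\<And>m. B (u m) (u m) > M - 1 / real (Suc m)" by metis
    note u2 = V[OF u(1)]
    have "\<forall>m. u m \<in> L2_space \<Omega> \<and> L2_nrm \<Omega> (u m) \<le> 1"
      by (auto simp: u2 L2_nrm_def u(2))
    then obtain r v where r: "strict_mono r" and v: "v \<in> L2_space \<Omega>"
      and lim: "(\<lambda>m. L2_nrm \<Omega> (\<lambda>x. A (u (r m)) x - v x)) \<longlonglongrightarrow> 0"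
      using cpt unfolding compact_operator_L2_def by meson
    \<comment> \<open>the limit of \<open>u (r m)\<close>, since \<open>A (u (r m))\<close> tends to \<open>v\<close> and \<open>M * u (r m) - A (u (r m))\<close> to \<open>0\<close>\<close>
    define w where "w = (\<lambda>x. (1 / M) * v x)"
    have w: "w \<in> L2_space \<Omega>" unfolding w_def by (intro L2.scale_mem v)
    have v_w: "v = (\<lambda>x. M * w x)" unfolding w_def using Mpos by auto
    let ?E = "\<lambda>m x. M * u m x - A (u m) x"
    let ?D = "\<lambda>m x. A (u (r m)) x - v x"
    have E2: "?E m \<in> L2_space \<Omega>" for m by (intro L2.diff_mem L2.scale_mem u2 mem)
    have D2: "?D m \<in> L2_space \<Omega>" for m by (intro L2.diff_mem v u2 mem)
    have E: "ip (?E m) (?E m) \<le> 2 * M / real (Suc m)" for m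
    proof -
      have "ip (?E m) (?E m) = M\<^sup>2 - 2 * (M * B (u m) (u m)) + ip (A (u m)) (A (u m))"
        by (subst L2.diff_square)
           (simp_all add: L2.scale_mem u2 mem L2.scale_left L2.scale_right u(2) power2_eq_square
              L2.sym[OF u2 mem[OF u2]])
      moreover have "ip (A (u m)) (A (u m)) \<le> M\<^sup>2 * ip (u m) (u m)"
        by (intro norm_le_of_form_le u2 M0 Mle u(1) eigen_perp[OF z e])
      moreover have "M * (M - 1 / real (Suc m)) \<le> M * B (u m) (u m)"
        using u(3)[of m] Mpos by simp
      moreover have "M * (M - 1 / real (Suc m)) = M\<^sup>2 - M / real (Suc m)"
        by (simp add: right_diff_distrib power2_eq_square)
      moreover have "2 * M / real (Suc m) = 2 * (M / real (Suc m))" by simp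
      ultimately show ?thesis
        unfolding u(2) by linarith
    qed
    have quot: "(\<lambda>m. 2 * M / real (Suc m)) \<longlonglongrightarrow> 0"
      by (rule LIMSEQ_Suc[OF lim_const_over_n])
    have "(\<lambda>m. ip (?E m) (?E m)) \<longlonglongrightarrow> 0"
      by (rule real_tendsto_sandwich[OF always_eventually always_eventually tendsto_const quot])
         (use L2.psd[OF E2] E in blast)+
    from tendsto_real_sqrt[OF this]
    have "(\<lambda>m. sqrt (ip (?E m) (?E m))) \<longlonglongrightarrow> 0" unfolding real_sqrt_zero .
    from LIMSEQ_subseq_LIMSEQ[OF this r]
    have Elim: "(\<lambda>m. sqrt (ip (?E (r m)) (?E (r m)))) \<longlonglongrightarrow> 0" by (simp add: o_def)
    let ?b = "\<lambda>m. (1 / M) * (sqrt (ip (?E (r m)) (?E (r m))) + L2_nrm \<Omega> (?D m))"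
    have blim: "?b \<longlonglongrightarrow> 0"
      using tendsto_mult_left[OF tendsto_add[OF Elim lim], of "1 / M"] by simp
    have "norm (sqrt (ip (\<lambda>x. u (r m) x - w x) (\<lambda>x. u (r m) x - w x))) \<le> ?b m" for m
    proof -
      let ?f = "\<lambda>x. u (r m) x - w x"
      let ?g = "\<lambda>x. ?E (r m) x + ?D m x"
      have g: "?g \<in> L2_space \<Omega>" by (intro L2.add_mem E2 D2)
      have "?f = (\<lambda>x. (1 / M) * ?g x)" unfolding w_def using Mpos by (auto simp: field_simps)
      then have "ip ?f ?f = (1 / M) * ((1 / M) * ip ?g ?g)"
        using g by (simp only: L2.scale_left L2.scale_right L2.scale_mem)
      then have "sqrt (ip ?f ?f) = (1 / M) * sqrt (ip ?g ?g)"
        using Mpos by (simp add: real_sqrt_divide real_sqrt_mult)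
      also have "\<dots> \<le> (1 / M) * (sqrt (ip (?E (r m)) (?E (r m))) + sqrt (ip (?D m) (?D m)))"
        using Mpos by (intro mult_left_mono L2.triangle E2 D2) auto
      finally show ?thesis
        using L2.psd[OF L2.diff_mem[OF u2 w], of "r m"] by (simp add: L2_nrm_def)
    qed
    then have ulim: "(\<lambda>m. sqrt (ip (\<lambda>x. u (r m) x - w x) (\<lambda>x. u (r m) x - w x))) \<longlonglongrightarrow> 0"
      by (intro Lim_null_comparison[OF always_eventually blim] allI)
    have weak: "(\<lambda>m. ip (u (r m)) y) \<longlonglongrightarrow> ip w y" if "y \<in> L2_space \<Omega>" for y
      by (rule L2.tendsto_left[OF u2 w that ulim])
    have "ip (z k) w = 0" if k: "k < n" for k
    proof -
      have "ip (u (r m)) (z k) = 0" for m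
        using u(1)[of "r m"] k L2.sym[OF u2 z[OF k]] by (simp add: perp_def)
      then have "ip w (z k) = 0"
        using weak[OF z[OF k]] by (simp add: LIMSEQ_const_iff)
      then show ?thesis using L2.sym[OF w z[OF k]] by simp
    qed
    then have wV: "w \<in> ?V" by (simp add: perp_def w)
    have "(\<lambda>m. ip (\<lambda>x. u (r m) x - w x) (\<lambda>x. u (r m) x - w x)) \<longlonglongrightarrow> 0"
      using tendsto_power[OF ulim, of 2]
      by (simp only: real_sqrt_pow2[OF L2.psd[OF L2.diff_mem[OF u2 w]]] zero_power2)
    then have "(\<lambda>m. 1 - 2 * ip (u (r m)) w + ip w w) \<longlonglongrightarrow> 0"
      by (simp add: L2.diff_square u2 w u(2))
    moreover have "(\<lambda>m. 1 - 2 * ip (u (r m)) w + ip w w) \<longlonglongrightarrow> 1 - 2 * ip w w + ip w w"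
      by (intro tendsto_intros weak w)
    ultimately have "0 = 1 - 2 * ip w w + ip w w" by (rule LIMSEQ_unique)
    then have w1: "ip w w = 1" by simp
    have Aw: "ip (A w) y = M * ip w y" if y: "y \<in> L2_space \<Omega>" for y
    proof -
      have "(\<lambda>m. ip (A (u (r m))) y) \<longlonglongrightarrow> ip w (A y)"
        using weak[OF mem[OF y]] by (simp add: self_adjoint u2 y)
      moreover have "(\<lambda>m. ip (A (u (r m))) y) \<longlonglongrightarrow> ip v y"
        by (intro L2.tendsto_left mem u2 v y) (use lim in \<open>simp add: L2_nrm_def\<close>)
      ultimately have "ip w (A y) = ip v y" by (rule LIMSEQ_unique)
      also have "ip v y = M * ip w y" unfolding v_w by (rule L2.scale_left[OF w y])
      finally show ?thesis by (simp add: self_adjoint w y)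
    qed
    let ?g = "\<lambda>x. A w x - M * w x"
    have g: "?g \<in> L2_space \<Omega>" by (intro L2.diff_mem mem w L2.scale_mem)
    have "ip ?g ?g = 0"
      by (subst L2.diff_left) (simp_all add: mem w L2.scale_mem g L2.scale_left Aw)
    from L2_inner_null_AE[OF g this] have "AE x in lborel_on \<Omega>. A w x = M * w x" by simp
    with wV w1 show "\<exists>w\<in>?V. ip w w = 1 \<and> (AE x in lborel_on \<Omega>. A w x = M * w x)" by blast
  qed
qed

text \<open>
  If the supremum \<open>M\<close> is positive, an eigenvector \<open>w\<close> may be replaced by \<open>A w / M\<close>, which is
  continuous.  If it is \<open>0\<close>, the operator vanishes on the subspace and any continuous unit vector \<open>h\<close>
  of the subspace will do.
\<close>

lemma spectral_step:
  assumes cpt: "compact_operator_L2 \<Omega> A"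
    and smooth: "\<And>u. u \<in> L2_space \<Omega> \<Longrightarrow> continuous_on \<Omega> (A u)"
    and z: "\<And>k. k < n \<Longrightarrow> z k \<in> L2_space \<Omega>"
    and e: "\<And>k. k < n \<Longrightarrow> AE x in lborel_on \<Omega>. A (z k) x = e k * z k x"
    and h: "h \<in> perp \<Omega> z n" "continuous_on \<Omega> h" "ip h h = 1"
  obtains r where "r \<in> perp \<Omega> z n" "continuous_on \<Omega> r" "ip r r = 1"
    "AE x in lborel_on \<Omega>. A r x = B r r * r x"
    "\<And>v. v \<in> perp \<Omega> z n \<Longrightarrow> B v v \<le> B r r * ip v v"
proof -
  obtain M where M: "M \<ge> 0" "\<And>v. v \<in> perp \<Omega> z n \<Longrightarrow> B v v \<le> M * ip v v"
    and ex: "M > 0 \<Longrightarrow> \<exists>w\<in>perp \<Omega> z n. ip w w = 1 \<and> (AE x in lborel_on \<Omega>. A w x = M * w x)"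
    using perp_top_eigenvector[OF cpt z e h(1,3)] by blast
  have h2: "h \<in> L2_space \<Omega>" using h(1) by (simp add: perp_def)
  show thesis
  proof (cases "M > 0")
    case True
    then obtain w where w: "w \<in> perp \<Omega> z n" "ip w w = 1"
      and Aw: "AE x in lborel_on \<Omega>. A w x = M * w x" using ex by blast
    have w2: "w \<in> L2_space \<Omega>" using w(1) by (simp add: perp_def)
    define r where "r = (\<lambda>x. (1 / M) * A w x)"
    have r2: "r \<in> L2_space \<Omega>" unfolding r_def by (intro L2.scale_mem mem w2)
    have rw: "AE x in lborel_on \<Omega>. r x = w x"
      using Aw unfolding r_def by eventually_elim (use True in simp)
    have Ar: "AE x in lborel_on \<Omega>. A r x = M * r x"
      using cong_AE[OF r2 w2 rw] Aw rw by eventually_elim simp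
    have r1: "ip r r = 1" using L2_inner_cong_AE[OF r2 w2 r2 w2 rw rw] w(2) by simp
    have "ip (z k) r = ip (z k) w" if "k < n" for k
      by (rule L2_inner_cong_AE) (use z[OF that] r2 w2 rw in auto)
    then have rV: "r \<in> perp \<Omega> z n" using w(1) r2 by (simp add: perp_def)
    have Br: "B r r = M"
      using L2_inner_cong_AE[OF mem[OF r2] L2.scale_mem[OF r2] r2 r2 Ar]
      by (simp add: L2.scale_left r2 r1)
    have "continuous_on \<Omega> r" unfolding r_def by (intro continuous_intros smooth w2)
    then show thesis
      by (rule that[OF rV _ r1]) (use Ar M Br in auto)
  next
    case False
    with M have M0: "M = 0" by simp
    have "B h h = 0" using M(2)[OF h(1)] nonneg[OF h2] by (simp add: M0)
    moreover have "ip (A h) (A h) \<le> 0\<^sup>2 * ip h h"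
      using M(2)[OF h(1)] M(2)[OF eigen_perp[OF z e h(1)]]
      by (intro norm_le_of_form_le) (simp_all add: M0 h2)
    then have "AE x in lborel_on \<Omega>. A h x = 0"
      using L2.psd[OF mem[OF h2]] by (intro L2_inner_null_AE mem h2) simp
    ultimately show thesis
      by (intro that[OF h]) (use M(2) in \<open>simp_all add: M0\<close>)
  qed
qed

lemma linear_combination_AE:
  fixes n :: nat
  assumes u: "u \<in> L2_space \<Omega>" and z: "\<And>k. z k \<in> L2_space \<Omega>"
  shows "AE x in lborel_on \<Omega>. A (\<lambda>y. u y - (\<Sum>k<n. c k * z k y)) x
           = A u x - (\<Sum>k<n. c k * A (z k) x)"
proof (induction n)
  case (Suc n)
  have r: "(\<lambda>y. u y - (\<Sum>k<n. c k * z k y)) \<in> L2_space \<Omega>"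
    by (intro L2.diff_mem u L2.sum_mem z) simp
  have "(\<lambda>y. u y - (\<Sum>k<Suc n. c k * z k y))
      = (\<lambda>y. 1 * (u y - (\<Sum>k<n. c k * z k y)) + (- c n) * z n y)" by auto
  with lin[OF r z, of 1 "- c n" n] Suc show ?case
    by (auto elim!: eventually_rev_mp)
qed simp

text \<open>
  The eigenvectors are chosen greedily, each maximizing the form on the orthogonal complement of its
  predecessors.  The eigenvalues tend to \<open>0\<close>: along a subsequence \<open>A (z k) = ev k * z k\<close> converges in
  norm, while orthonormal vectors tend weakly to \<open>0\<close>.  The error of the expansion of \<open>A u\<close> is \<open>A\<close>
  applied to the residual of \<open>u\<close>, hence has norm at most \<open>ev n\<close> times that of \<open>u\<close>.
\<close>

lemma spectral_decomposition_exists: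
  assumes cpt: "compact_operator_L2 \<Omega> A"
    and smooth: "\<And>u. u \<in> L2_space \<Omega> \<Longrightarrow> continuous_on \<Omega> (A u)"
    and fresh: "\<And>n z. (\<And>k. k < n \<Longrightarrow> z k \<in> L2_space \<Omega>) \<Longrightarrow>
          \<exists>h\<in>perp \<Omega> z n. continuous_on \<Omega> h \<and> ip h h = 1"
    and e0: "e0 \<in> L2_space \<Omega>" "continuous_on \<Omega> e0" "ip e0 e0 = 1"
      "AE x in lborel_on \<Omega>. A e0 x = e0 x"
  shows "\<exists>ev z. spectral_decomposition \<Omega> A ev z \<and> ev 0 = 1 \<and> z 0 = e0 \<and>
           (\<forall>k. continuous_on \<Omega> (z k))"
proof -
  define P where "P z n r \<longleftrightarrow> r \<in> perp \<Omega> z n \<and> continuous_on \<Omega> r \<and> ip r r = 1 \<and>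
      (AE x in lborel_on \<Omega>. A r x = B r r * r x) \<and>
      (\<forall>v\<in>perp \<Omega> z n. B v v \<le> B r r * ip v v) \<and> (n = 0 \<longrightarrow> r = e0)" for z n r
  have Be0: "B e0 e0 = 1"
    using L2_inner_cong_AE[OF mem[OF e0(1)] e0(1) e0(1) e0(1) e0(4)] e0(3) by simp
  have "\<exists>z. \<forall>n. P z n (z n)"
  proof (rule dependent_wellorder_choice)
    fix r and f g :: "nat \<Rightarrow> real \<Rightarrow> real" and n :: nat assume "\<And>k. k < n \<Longrightarrow> f k = g k"
    then have "perp \<Omega> f n = perp \<Omega> g n" by (auto simp: perp_def)
    then show "P f n r = P g n r" by (simp add: P_def)
  next
    fix n :: nat and z assume P: "\<And>k. k < n \<Longrightarrow> P z k (z k)"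
    show "\<exists>r. P z n r"
    proof (cases "n = 0")
      case True
      show ?thesis
        by (rule exI[of _ e0])
           (use True e0 in \<open>auto simp: P_def Be0 contraction perp_def\<close>)
    next
      case False
      have z: "\<And>k. k < n \<Longrightarrow> z k \<in> L2_space \<Omega>" using P by (simp add: P_def perp_def)
      have e: "\<And>k. k < n \<Longrightarrow> AE x in lborel_on \<Omega>. A (z k) x = B (z k) (z k) * z k x"
        using P by (simp add: P_def)
      obtain h where h: "h \<in> perp \<Omega> z n" "continuous_on \<Omega> h" "ip h h = 1"
        using fresh[of n z, OF z] by blast
      show ?thesis
        by (rule spectral_step[OF cpt smooth z e h]) (use False in \<open>auto simp: P_def\<close>)
    qed
  qed
  then obtain z where P: "\<And>n. P z n (z n)" by blast
  have z: "\<And>n. z n \<in> L2_space \<Omega>" using P by (simp add: P_def perp_def)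
  define ev where "ev n = B (z n) (z n)" for n
  have eig: "\<And>n. AE x in lborel_on \<Omega>. A (z n) x = ev n * z n x"
    using P by (simp add: P_def ev_def)
  have top: "\<And>n v. v \<in> perp \<Omega> z n \<Longrightarrow> B v v \<le> ev n * ip v v"
    using P by (simp add: P_def ev_def)
  have unit: "\<And>n. ip (z n) (z n) = 1" using P by (simp add: P_def)
  have less: "ip (z j) (z k) = 0" if "j < k" for j k
    using P[of k] that by (simp add: P_def perp_def)
  have on: "ip (z j) (z k) = (if j = k then 1 else 0)" for j k
    using less[of j k] less[of k j] unit[of j] L2.sym[OF z z, of j k]
    by (cases j k rule: linorder_cases) auto
  have ev0: "\<And>n. ev n \<ge> 0" unfolding ev_def by (intro nonneg z)
  have dec: "decseq ev"
  proof (rule decseq_SucI)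
    fix n
    have "z (Suc n) \<in> perp \<Omega> z n" using P[of "Suc n"] by (simp add: P_def perp_def)
    from top[OF this] show "ev (Suc n) \<le> ev n" by (simp add: ev_def unit)
  qed
  have lim: "ev \<longlonglongrightarrow> 0"
  proof -
    obtain L where L: "ev \<longlonglongrightarrow> L"
      using decseq_convergent[OF dec, of 0] ev0 by blast
    have "\<forall>n. z n \<in> L2_space \<Omega> \<and> L2_nrm \<Omega> (z n) \<le> 1"
      by (auto simp: z L2_nrm_def unit)
    then obtain r v where r: "strict_mono r" and v: "v \<in> L2_space \<Omega>"
      and conv: "(\<lambda>m. L2_nrm \<Omega> (\<lambda>x. A (z (r m)) x - v x)) \<longlonglongrightarrow> 0"
      using cpt unfolding compact_operator_L2_def by meson
    have "\<bar>ev (r m) - ip v (z (r m))\<bar> \<le> L2_nrm \<Omega> (\<lambda>x. A (z (r m)) x - v x)" for m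
      using L2.Cauchy_Schwarz_abs[OF L2.diff_mem[OF mem[OF z] v] z, of "r m" "r m"]
      by (simp add: L2.diff_left mem z v ev_def unit L2_nrm_def)
    then have "(\<lambda>m. ev (r m) - ip v (z (r m))) \<longlonglongrightarrow> 0"
      by (intro Lim_null_comparison[OF always_eventually conv]) simp
    moreover have "(\<lambda>m. ip v (z (r m))) \<longlonglongrightarrow> 0"
      using LIMSEQ_subseq_LIMSEQ[OF psd_form_orthogonal_projection(5)[where \<zeta> = z and ip = ip, OF L2.psd_form_axioms z on v] r]
      by (simp add: o_def L2.sym[OF v z])
    ultimately have "(\<lambda>m. ev (r m) - ip v (z (r m)) + ip v (z (r m))) \<longlonglongrightarrow> 0 + 0"
      by (rule tendsto_add)
    then have "(\<lambda>m. ev (r m)) \<longlonglongrightarrow> 0" by simp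
    then show ?thesis
      using LIMSEQ_unique LIMSEQ_subseq_LIMSEQ[OF L r] L by (auto simp: o_def)
  qed
  have exp: "(\<lambda>n. L2_nrm \<Omega> (\<lambda>x. A u x - (\<Sum>k<n. ev k * ip (z k) u * z k x))) \<longlonglongrightarrow> 0"
    if u: "u \<in> L2_space \<Omega>" for u
  proof -
    define r where "r n = (\<lambda>x. u x - (\<Sum>k<n. ip (z k) u * z k x))" for n
    note proj = psd_form_orthogonal_projection[where \<zeta> = z and ip = ip, OF L2.psd_form_axioms z on u]
    have r: "r n \<in> perp \<Omega> z n" for n using proj(1,2) by (simp add: r_def perp_def)
    have r2: "r n \<in> L2_space \<Omega>" for n using r by (simp add: perp_def)
    have rn: "ip (r n) (r n) \<le> ip u u" for n
      using proj(3)[of n] by (simp add: r_def sum_nonneg)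
    let ?R = "\<lambda>n x. A u x - (\<Sum>k<n. ev k * ip (z k) u * z k x)"
    have R2: "?R n \<in> L2_space \<Omega>" for n
      by (intro L2.diff_mem L2.sum_mem mem u z) simp
    have eq: "AE x in lborel_on \<Omega>. ?R n x = A (r n) x" for n
    proof -
      have "AE x in lborel_on \<Omega>. \<forall>k. A (z k) x = ev k * z k x"
        using eig by (simp add: AE_all_countable)
      with linear_combination_AE[where z = z and n = n and c = "\<lambda>k. ip (z k) u", OF u z] show ?thesis
        unfolding r_def by eventually_elim (simp add: mult_ac)
    qed
    have "norm (L2_nrm \<Omega> (?R n)) \<le> ev n * sqrt (ip u u)" for n
    proof -
      have "ip (?R n) (?R n) = ip (A (r n)) (A (r n))"
        by (rule L2_inner_cong_AE[OF R2 mem[OF r2] R2 mem[OF r2] eq eq])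
      also have "\<dots> \<le> (ev n)\<^sup>2 * ip (r n) (r n)"
        by (intro norm_le_of_form_le r2 ev0 top r eigen_perp[where e = ev] z eig)
      also have "\<dots> \<le> (ev n)\<^sup>2 * ip u u" by (intro mult_left_mono rn) simp
      finally have "sqrt (ip (?R n) (?R n)) \<le> sqrt ((ev n)\<^sup>2 * ip u u)" by simp
      then show ?thesis using ev0[of n] L2.psd[OF R2, of n] by (simp add: L2_nrm_def real_sqrt_mult)
    qed
    moreover have bound: "(\<lambda>n. ev n * sqrt (ip u u)) \<longlonglongrightarrow> 0"
      using tendsto_mult_right[OF lim, of "sqrt (ip u u)"] by simp
    ultimately show ?thesis by (intro Lim_null_comparison[OF always_eventually bound] allI)
  qed
  have "z 0 = e0" using P[of 0] by (simp add: P_def)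
  moreover have "spectral_decomposition \<Omega> A ev z"
    unfolding spectral_decomposition_def using dec z on eig exp by blast
  ultimately show ?thesis
    using P Be0 by (intro exI[of _ ev] exI[of _ z]) (auto simp: P_def ev_def)
qed

context
  fixes ev z assumes sd: "spectral_decomposition \<Omega> A ev z"
begin

lemma eigenfunction_mem: "z k \<in> L2_space \<Omega>"
  using sd by (simp add: spectral_decomposition_def)

lemma eigenfunctions_orthonormal: "ip (z j) (z k) = (if j = k then 1 else 0)"
  using sd by (simp add: spectral_decomposition_def)

lemma eigenfunction_AE: "AE x in lborel_on \<Omega>. A (z k) x = ev k * z k x"
  using sd by (simp add: spectral_decomposition_def)

lemma form_eigenfunction: "v \<in> L2_space \<Omega> \<Longrightarrow> B (z k) v = ev k * ip (z k) v"
  using L2_inner_cong_AE[OF mem[OF eigenfunction_mem] L2.scale_mem[OF eigenfunction_mem] _ _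
      eigenfunction_AE, of v v k]
  by (simp add: L2.scale_left eigenfunction_mem)

lemma eigenvalue_nonneg: "0 \<le> ev k"
  using nonneg[OF eigenfunction_mem, of k] form_eigenfunction[OF eigenfunction_mem, of k k]
  by (simp add: eigenfunctions_orthonormal)

lemma eigenvalue_le_1: "ev k \<le> 1"
  using contraction[OF eigenfunction_mem, of k] form_eigenfunction[OF eigenfunction_mem, of k k]
  by (simp add: eigenfunctions_orthonormal)

text \<open>
  Expand \<open>\<langle>A v, v\<rangle> = (\<Sum>k. ev k * \<langle>z k, v\<rangle>\<^sup>2)\<close>; the terms with \<open>k < n\<close> vanish, in the others
  \<open>ev k \<le> ev n\<close>, and Bessel's inequality bounds the remaining sum of squares.
\<close>

lemma form_le_on_perp:
  assumes v: "v \<in> perp \<Omega> z n"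
  shows "B v v \<le> ev n * ip v v"
proof -
  have v2: "v \<in> L2_space \<Omega>" using v by (simp add: perp_def)
  note z = eigenfunction_mem and on = eigenfunctions_orthonormal
  let ?S = "\<lambda>N x. \<Sum>k<N. ev k * ip (z k) v * z k x"
  have S: "?S N \<in> L2_space \<Omega>" for N by (intro L2.sum_mem z) simp
  have "(\<lambda>N. sqrt (ip (\<lambda>x. A v x - ?S N x) (\<lambda>x. A v x - ?S N x))) \<longlonglongrightarrow> 0"
    using sd v2 by (simp add: spectral_decomposition_def L2_nrm_def)
  then have "(\<lambda>N. ip (\<lambda>x. A v x - ?S N x) v) \<longlonglongrightarrow> ip (\<lambda>x. 0) v"
    by (intro L2.tendsto_left L2.diff_mem mem v2 S L2.zero_mem) simp
  moreover have "ip (\<lambda>x. A v x - ?S N x) v = B v v - (\<Sum>k<N. ev k * (ip (z k) v)\<^sup>2)" for N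
  proof -
    have "ip (?S N) v = (\<Sum>k<N. (ev k * ip (z k) v) * ip (z k) v)"
      by (rule L2.sum_left) (simp_all add: z v2)
    then show ?thesis
      by (subst L2.diff_left[OF mem[OF v2] S v2]) (simp add: power2_eq_square mult.assoc)
  qed
  ultimately have "(\<lambda>N. B v v - (\<Sum>k<N. ev k * (ip (z k) v)\<^sup>2)) \<longlonglongrightarrow> 0"
    by (simp add: L2.zero_left v2)
  then have "(\<lambda>N. B v v - (B v v - (\<Sum>k<N. ev k * (ip (z k) v)\<^sup>2))) \<longlonglongrightarrow> B v v - 0"
    by (intro tendsto_diff tendsto_const)
  then have "(\<lambda>N. \<Sum>k<N. ev k * (ip (z k) v)\<^sup>2) \<longlonglongrightarrow> B v v" by simp
  moreover have "(\<Sum>k<N. ev k * (ip (z k) v)\<^sup>2) \<le> ev n * ip v v" for N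
  proof -
    have "ev k * (ip (z k) v)\<^sup>2 \<le> ev n * (ip (z k) v)\<^sup>2" for k
    proof (cases "k < n")
      case True then show ?thesis using v by (simp add: perp_def)
    next
      case False
      then have "ev k \<le> ev n" using sd by (auto simp: spectral_decomposition_def decseq_def)
      then show ?thesis by (rule mult_right_mono) simp
    qed
    then have "(\<Sum>k<N. ev k * (ip (z k) v)\<^sup>2) \<le> ev n * (\<Sum>k<N. (ip (z k) v)\<^sup>2)"
      by (simp add: sum_distrib_left sum_mono)
    also have "\<dots> \<le> ev n * ip v v"
      by (rule mult_left_mono[OF psd_form_orthogonal_projection(4)[where \<zeta> = z and ip = ip,
            OF L2.psd_form_axioms z on v2] eigenvalue_nonneg])
    finally show ?thesis .
  qed
  ultimately show ?thesis by (intro LIMSEQ_le_const2) auto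
qed

text \<open>
  Remove from \<open>v\<close> its component along \<open>z n\<close>.  The rest \<open>w\<close> has Rayleigh quotient at most
  \<open>ev (Suc n)\<close>, whereas the hypothesis forces \<open>\<langle>A w, w\<rangle> \<ge> ev n * \<langle>w, w\<rangle>\<close>; with a gap between the two
  eigenvalues \<open>w\<close> is null.
\<close>

lemma form_eq_on_perp:
  assumes v: "v \<in> perp \<Omega> z n" and gap: "ev (Suc n) < ev n"
    and ge: "ev n * ip v v \<le> B v v"
  shows "AE x in lborel_on \<Omega>. v x = ip (z n) v * z n x"
proof -
  note z = eigenfunction_mem and on = eigenfunctions_orthonormal
  have v2: "v \<in> L2_space \<Omega>" using v by (simp add: perp_def)
  define c where "c = ip (z n) v"
  define w where "w = (\<lambda>x. v x - c * z n x)"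
  have w2: "w \<in> L2_space \<Omega>" unfolding w_def by (intro L2.diff_mem v2 L2.scale_mem z)
  have "ip (z k) w = 0" if "k < Suc n" for k
    using v that unfolding w_def c_def
    by (subst L2.diff_right)
       (auto simp: v2 z L2.scale_mem L2.scale_right on perp_def less_Suc_eq)
  then have "w \<in> perp \<Omega> z (Suc n)" by (simp add: perp_def w2)
  then have "B w w \<le> ev (Suc n) * ip w w" by (rule form_le_on_perp)
  moreover have "ip w w = ip v v - c\<^sup>2"
    unfolding w_def
    by (subst L2.diff_square)
       (auto simp: v2 z L2.scale_mem L2.scale_right L2.scale_left on c_def L2.sym[OF v2 z]
          power2_eq_square)
  moreover have "B w w = B v v - ev n * c\<^sup>2"
    unfolding w_def
    by (subst form.diff_square)
       (auto simp: v2 z mem L2.scale_mem L2.scale_right form.scale_left on c_def form.sym[OF v2 z]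
          form_eigenfunction power2_eq_square)
  ultimately have "ev n * ip w w \<le> ev (Suc n) * ip w w"
    using ge by (simp add: right_diff_distrib)
  then have "(ev n - ev (Suc n)) * ip w w \<le> 0"
    by (simp add: left_diff_distrib)
  then have "ip w w = 0"
    using gap L2.psd[OF w2] by (simp add: mult_le_0_iff)
  from L2_inner_null_AE[OF w2 this] show ?thesis by (simp add: w_def c_def)
qed

end
end

section \<open>Second derivatives of logarithms of Laplace transforms\<close>

lemma abs_exp_minus_1_le: "\<bar>exp y - 1\<bar> \<le> \<bar>y\<bar> * exp \<bar>y\<bar>" for y :: real
proof (cases "y \<ge> 0")
  case True
  have "exp y * (1 - y) \<le> exp y * exp (- y)"
    using exp_ge_add_one_self[of "- y"] by (intro mult_left_mono) auto
  then show ?thesis using True by (simp add: exp_minus algebra_simps)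
next
  case False
  have "1 + y \<le> exp y" by (rule exp_ge_add_one_self)
  moreover have "exp y \<le> 1" using False by simp
  ultimately have "\<bar>exp y - 1\<bar> \<le> \<bar>y\<bar> * 1" by linarith
  also have "\<dots> \<le> \<bar>y\<bar> * exp \<bar>y\<bar>" by (intro mult_left_mono) auto
  finally show ?thesis .
qed

lemma abs_le_exp_div:
  fixes d y :: real
  assumes "0 < d"
  shows "\<bar>y\<bar> \<le> exp (d * \<bar>y\<bar>) / d"
proof -
  have "1 + d * \<bar>y\<bar> \<le> exp (d * \<bar>y\<bar>)" by (rule exp_ge_add_one_self)
  then have "d * \<bar>y\<bar> \<le> exp (d * \<bar>y\<bar>)" by linarith
  then show ?thesis using assms by (simp add: pos_le_divide_eq mult.commute)
qed

lemma exp_difference_quotient_bound: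
  fixes d t y :: real
  assumes "0 < d" "\<bar>t\<bar> \<le> d / 2" "t \<noteq> 0"
  shows "\<bar>(exp (t * y) - 1) / t\<bar> \<le> 2 / d * exp (d * \<bar>y\<bar>)"
proof -
  have "\<bar>(exp (t * y) - 1) / t\<bar> \<le> (\<bar>t * y\<bar> * exp \<bar>t * y\<bar>) / \<bar>t\<bar>"
    using divide_right_mono[OF abs_exp_minus_1_le[of "t * y"], of "\<bar>t\<bar>"] by simp
  also have "\<dots> = \<bar>y\<bar> * exp (\<bar>t\<bar> * \<bar>y\<bar>)" using assms(3) by (simp add: abs_mult)
  also have "\<dots> \<le> exp (d / 2 * \<bar>y\<bar>) / (d / 2) * exp (d / 2 * \<bar>y\<bar>)"
    using assms mult_right_mono[OF assms(2), of "\<bar>y\<bar>"] by (intro mult_mono abs_le_exp_div) auto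
  also have "\<dots> = 2 / d * exp (d * \<bar>y\<bar>)"
    by (simp add: exp_add[symmetric])
  finally show ?thesis .
qed

text \<open>
  The difference quotients of \<open>exp (t * T x)\<close> are dominated by a multiple of \<open>exp (d * \<bar>T x\<bar>)\<close> as long
  as \<open>\<bar>t\<bar> \<le> d / 2\<close>, so differentiation under the integral sign is dominated convergence.
\<close>

lemma exp_integral_has_derivative:
  fixes h T :: "'a \<Rightarrow> real"
  assumes d: "0 < d" and [measurable]: "h \<in> borel_measurable N" "T \<in> borel_measurable N"
    and dom: "integrable N (\<lambda>x. \<bar>h x\<bar> * exp (d * \<bar>T x\<bar>))"
  shows "((\<lambda>t. LINT x|N. h x * exp (t * T x)) has_real_derivative (LINT x|N. h x * T x)) (at 0)"
proof -
  have int: "integrable N (\<lambda>x. h x * exp (t * T x))" if "\<bar>t\<bar> \<le> d" for t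
  proof (rule Bochner_Integration.integrable_bound[OF dom])
    have "exp (t * y) \<le> exp (d * \<bar>y\<bar>)" for y
    proof -
      have "t * y \<le> \<bar>t\<bar> * \<bar>y\<bar>" using abs_ge_self[of "t * y"] by (simp add: abs_mult)
      also have "\<dots> \<le> d * \<bar>y\<bar>" using that by (intro mult_right_mono) auto
      finally show ?thesis by simp
    qed
    then show "AE x in N. norm (h x * exp (t * T x)) \<le> norm (\<bar>h x\<bar> * exp (d * \<bar>T x\<bar>))"
      by (simp add: abs_mult mult_left_mono)
  qed measurable
  let ?F = "\<lambda>t. LINT x|N. h x * exp (t * T x)"
  show ?thesis
    unfolding has_field_derivative_def[symmetric] DERIV_def tendsto_at_iff_sequentially
  proof (intro allI impI)
    fix X :: "nat \<Rightarrow> real"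
    assume X0: "\<forall>i. X i \<in> UNIV - {0}" and X: "X \<longlonglongrightarrow> 0"
    \<comment> \<open>the difference quotient, replaced by its limit for the finitely many \<open>n\<close> where the bound fails\<close>
    let ?s = "\<lambda>n x. if \<bar>X n\<bar> < d / 2 then h x * ((exp (X n * T x) - 1) / X n) else h x * T x"
    have small: "\<forall>\<^sub>F n in sequentially. \<bar>X n\<bar> < d / 2"
      using tendstoD[OF X, of "d / 2"] d by (simp add: dist_real_def)
    have "(\<lambda>n. LINT x|N. ?s n x) \<longlonglongrightarrow> (LINT x|N. h x * T x)"
    proof (rule integral_dominated_convergence[where w = "\<lambda>x. 2 / d * (\<bar>h x\<bar> * exp (d * \<bar>T x\<bar>))"])
      show "AE x in N. (\<lambda>n. ?s n x) \<longlonglongrightarrow> h x * T x"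
      proof (intro AE_I2)
        fix x
        have "((\<lambda>t. exp (t * T x)) has_real_derivative T x) (at 0)"
          by (auto intro!: derivative_eq_intros)
        then have "((\<lambda>t. (exp (t * T x) - 1) / t) \<longlongrightarrow> T x) (at 0)"
          by (simp add: DERIV_def)
        then have "(\<lambda>n. (exp (X n * T x) - 1) / X n) \<longlonglongrightarrow> T x"
          using X X0 unfolding tendsto_at_iff_sequentially by (auto simp: o_def)
        then have "(\<lambda>n. h x * ((exp (X n * T x) - 1) / X n)) \<longlonglongrightarrow> h x * T x"
          by (rule tendsto_mult_left)
        then show "(\<lambda>n. ?s n x) \<longlonglongrightarrow> h x * T x"
          by (rule Lim_transform_eventually) (use small in eventually_elim, simp)
      qed
      show "AE x in N. norm (?s n x) \<le> 2 / d * (\<bar>h x\<bar> * exp (d * \<bar>T x\<bar>))" for n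
      proof (intro AE_I2)
        fix x
        have q: "\<bar>(exp (X n * T x) - 1) / X n\<bar> \<le> 2 / d * exp (d * \<bar>T x\<bar>)" if "\<bar>X n\<bar> < d / 2"
          using exp_difference_quotient_bound[OF d, of "X n" "T x"] that X0 by auto
        have "\<bar>T x\<bar> \<le> exp (d * \<bar>T x\<bar>) / d" by (rule abs_le_exp_div[OF d])
        also have "\<dots> \<le> 2 / d * exp (d * \<bar>T x\<bar>)" using d by (simp add: field_simps)
        finally have T: "\<bar>T x\<bar> \<le> 2 / d * exp (d * \<bar>T x\<bar>)" .
        have "norm (?s n x) \<le> \<bar>h x\<bar> * (2 / d * exp (d * \<bar>T x\<bar>))"
        proof (cases "\<bar>X n\<bar> < d / 2")
          case True
          have "\<bar>?s n x\<bar> = \<bar>h x\<bar> * \<bar>(exp (X n * T x) - 1) / X n\<bar>"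
            by (simp only: True if_True abs_mult)
          also have "\<dots> \<le> \<bar>h x\<bar> * (2 / d * exp (d * \<bar>T x\<bar>))"
            by (intro mult_left_mono q True) simp
          finally show ?thesis by simp
        next
          case False
          then have "\<bar>?s n x\<bar> = \<bar>h x\<bar> * \<bar>T x\<bar>" by (simp only: if_False abs_mult)
          also have "\<dots> \<le> \<bar>h x\<bar> * (2 / d * exp (d * \<bar>T x\<bar>))"
            by (intro mult_left_mono T) simp
          finally show ?thesis by simp
        qed
        then show "norm (?s n x) \<le> 2 / d * (\<bar>h x\<bar> * exp (d * \<bar>T x\<bar>))" by (simp add: mult_ac)
      qed
    qed (use dom in \<open>auto intro!: integrable_mult_right\<close>)
    moreover have "(LINT x|N. ?s n x) = (?F (0 + X n) - ?F 0) / X n" if "\<bar>X n\<bar> < d / 2" for n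
    proof -
      have "(LINT x|N. ?s n x) = (LINT x|N. (h x * exp (X n * T x) - h x * exp (0 * T x)) / X n)"
        using that by (simp add: right_diff_distrib)
      also have "\<dots> = (?F (X n) - ?F 0) / X n"
        using int[of "X n"] int[of 0] that d by simp
      finally show ?thesis by simp
    qed
    then have "\<forall>\<^sub>F n in sequentially. (LINT x|N. ?s n x) = (?F (0 + X n) - ?F 0) / X n"
      using small by (rule eventually_mono[rotated])
    ultimately show "((\<lambda>h. (?F (0 + h) - ?F 0) / h) \<circ> X) \<longlonglongrightarrow> (LINT x|N. h x * T x)"
      unfolding o_def by (rule Lim_transform_eventually)
  qed
qed

text \<open>
  The operator \<open>deriv\<close> has an unspecified value where no derivative exists, so rules for sums of
  Hessians need existence.  The predicate records it along exactly the two steps of \<open>hessian\<close> at \<open>0\<close>: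
  first in coordinate \<open>j\<close>, at the points where coordinate \<open>i\<close> is \<open>s\<close>, then in \<open>s\<close> at \<open>0\<close>.  The inner
  derivative is taken at coordinate value \<open>s\<close> if \<open>i = j\<close> and \<open>0\<close> otherwise.
\<close>

definition has_mixed_derivative ::
  "((nat \<Rightarrow> real) \<Rightarrow> real) \<Rightarrow> nat \<Rightarrow> nat \<Rightarrow> real \<Rightarrow> bool" where
  "has_mixed_derivative F i j H \<longleftrightarrow>
     (\<exists>e>0. \<exists>D. (\<forall>s. \<bar>s\<bar> < e \<longrightarrow>
        ((\<lambda>t. F ((\<lambda>_. 0)(i := s, j := t))) has_real_derivative D s) (at (((\<lambda>_. 0)(i := s)) j))) \<and>
        (D has_real_derivative H) (at 0))"

lemma hessian_eq_mixed_derivative: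
  assumes "has_mixed_derivative F i j H"
  shows "hessian F (\<lambda>_. 0) i j = H"
proof -
  obtain e D where e: "e > 0"
    and D: "\<And>s. \<bar>s\<bar> < e \<Longrightarrow>
        ((\<lambda>t. F ((\<lambda>_. 0)(i := s, j := t))) has_real_derivative D s) (at (((\<lambda>_. 0)(i := s)) j))"
    and H: "(D has_real_derivative H) (at 0)"
    using assms unfolding has_mixed_derivative_def by blast
  have eq: "partial_deriv j F ((\<lambda>_. 0)(i := s)) = D s" if "\<bar>s\<bar> < e" for s
    unfolding partial_deriv_def by (rule DERIV_imp_deriv[OF D[OF that]])
  have "\<forall>\<^sub>F s in nhds 0. \<bar>s\<bar> < e"
    using e eventually_nhds_metric[of "\<lambda>s. \<bar>s\<bar> < e" "0::real"] by (auto simp: dist_real_def)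
  then have "\<forall>\<^sub>F s in nhds 0. partial_deriv j F ((\<lambda>_. 0)(i := s)) = D s"
    by eventually_elim (rule eq)
  then have "((\<lambda>s. partial_deriv j F ((\<lambda>_. 0)(i := s))) has_real_derivative H) (at 0)"
    using H by (subst DERIV_cong_ev[OF refl _ refl]) auto
  then show ?thesis
    unfolding hessian_def partial_deriv_def[of i] by (intro DERIV_imp_deriv) simp
qed

lemma has_mixed_derivative_diff:
  assumes "has_mixed_derivative F i j A" "has_mixed_derivative G i j B"
  shows "has_mixed_derivative (\<lambda>\<theta>. F \<theta> - G \<theta>) i j (A - B)"
proof -
  obtain e D where D: "e > 0" "\<And>s. \<bar>s\<bar> < e \<Longrightarrow>
        ((\<lambda>t. F ((\<lambda>_. 0)(i := s, j := t))) has_real_derivative D s) (at (((\<lambda>_. 0)(i := s)) j))"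
      "(D has_real_derivative A) (at 0)"
    using assms(1) unfolding has_mixed_derivative_def by blast
  obtain e' D' where D': "e' > 0" "\<And>s. \<bar>s\<bar> < e' \<Longrightarrow>
        ((\<lambda>t. G ((\<lambda>_. 0)(i := s, j := t))) has_real_derivative D' s) (at (((\<lambda>_. 0)(i := s)) j))"
      "(D' has_real_derivative B) (at 0)"
    using assms(2) unfolding has_mixed_derivative_def by blast
  show ?thesis unfolding has_mixed_derivative_def
    by (rule exI[of _ "min e e'"], intro conjI exI[of _ "\<lambda>s. D s - D' s"])
       (use D D' in \<open>auto intro!: DERIV_diff\<close>)
qed

lemma has_mixed_derivative_affine:
  "has_mixed_derivative (\<lambda>\<theta>. c + (\<Sum>k<p. \<theta> k * t k)) i j 0"
  unfolding has_mixed_derivative_def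
proof (intro exI conjI allI impI)
  let ?D = "\<Sum>k<p. (if k = j then 1 else 0) * t k"
  have k: "((\<lambda>x. ((\<lambda>_. 0)(i := s, j := x)) k) has_real_derivative (if k = j then 1 else 0)) (at y)"
    for s y :: real and k by auto
  have "((\<lambda>x. \<Sum>k<p. ((\<lambda>_. 0)(i := s, j := x)) k * t k) has_real_derivative ?D) (at y)"
    for s y :: real
    by (intro DERIV_sum DERIV_cmult_right k)
  from DERIV_add[OF DERIV_const this]
  show "((\<lambda>x. c + (\<Sum>k<p. ((\<lambda>_. 0)(i := s, j := x)) k * t k)) has_real_derivative ?D)
      (at (((\<lambda>_. 0)(i := s)) j))" for s
    by (simp only: add_0_left)
  show "((\<lambda>_. ?D) has_real_derivative 0) (at 0)" by simp
qed (rule zero_less_one)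

text \<open>
  Only parameters near \<open>0\<close> matter.  This is essential for statistics whose family exists only there.
\<close>

lemma has_mixed_derivative_cong:
  assumes F: "has_mixed_derivative F i j H" and d: "d > 0"
    and eq: "\<And>\<theta>. (\<And>k. \<bar>\<theta> k\<bar> < d) \<Longrightarrow> G \<theta> = F \<theta>"
  shows "has_mixed_derivative G i j H"
proof -
  obtain e D where e: "e > 0" and D: "\<And>s. \<bar>s\<bar> < e \<Longrightarrow>
        ((\<lambda>t. F ((\<lambda>_. 0)(i := s, j := t))) has_real_derivative D s) (at (((\<lambda>_. 0)(i := s)) j))"
      and H: "(D has_real_derivative H) (at 0)"
    using F unfolding has_mixed_derivative_def by blast
  have "((\<lambda>t. G ((\<lambda>_. 0)(i := s, j := t))) has_real_derivative D s) (at (((\<lambda>_. 0)(i := s)) j))"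
    if s: "\<bar>s\<bar> < min d e" for s
  proof -
    let ?\<tau> = "((\<lambda>_. 0)(i := s)) j"
    have "\<bar>?\<tau>\<bar> < d" using s d by auto
    then have "\<forall>\<^sub>F t in nhds ?\<tau>. \<bar>t\<bar> < d"
      using eventually_nhds_in_open[of "{- d<..<d}" ?\<tau>] by (auto simp: abs_less_iff minus_less_iff elim: eventually_mono)
    then have "\<forall>\<^sub>F t in nhds ?\<tau>. G ((\<lambda>_. 0)(i := s, j := t)) = F ((\<lambda>_. 0)(i := s, j := t))"
      by eventually_elim (use s d in \<open>auto intro!: eq\<close>)
    then show ?thesis
      using D[of s] s by (subst DERIV_cong_ev[OF refl _ refl]) auto
  qed
  then show ?thesis
    unfolding has_mixed_derivative_def using e d H
    by (intro exI[of _ "min d e"] conjI exI[of _ D]) auto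
qed

text \<open>
  The log-partition function is the case \<open>w = g0\<close>, and the logarithm of the marginal density at \<open>x\<close>
  is, up to the log-partition function, the case \<open>w = (\<lambda>\<mu>. K \<mu> x * g0 \<mu>)\<close>.
\<close>

definition log_mgf :: "'a measure \<Rightarrow> ('a \<Rightarrow> real) \<Rightarrow> nat \<Rightarrow> (nat \<Rightarrow> 'a \<Rightarrow> real) \<Rightarrow> (nat \<Rightarrow> real) \<Rightarrow> real" where
  "log_mgf N w p T \<theta> = ln (LINT x|N. w x * exp (\<Sum>k<p. \<theta> k * T k x))"

text \<open>
  The value is the covariance of \<open>T i\<close> and \<open>T j\<close> under the probability density proportional to \<open>w\<close>.
\<close>

lemma log_mgf_mixed_derivative:
  fixes w :: "'a \<Rightarrow> real"
  assumes d: "0 < d" and i: "i < p" and j: "j < p"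
    and m [measurable]: "w \<in> borel_measurable N" "T i \<in> borel_measurable N" "T j \<in> borel_measurable N"
    and w0: "\<And>x. x \<in> space N \<Longrightarrow> 0 \<le> w x" and wpos: "0 < (LINT x|N. w x)"
    and dom: "integrable N (\<lambda>x. w x * exp (d * \<bar>T i x\<bar> + d * \<bar>T j x\<bar>))"
  shows "has_mixed_derivative (log_mgf N w p T) i j
     (((LINT x|N. w x * T j x * T i x) * (LINT x|N. w x) -
       (LINT x|N. w x * T j x) * (LINT x|N. w x * T i x)) / (LINT x|N. w x)\<^sup>2)"
proof -
  let ?Z = "\<lambda>s. LINT x|N. w x * exp (s * T i x)"
  let ?Y = "\<lambda>s. LINT x|N. w x * exp (s * T i x) * T j x"
  have ex: "exp (d * \<bar>y\<bar>) \<ge> 1" "exp (s * y) \<le> exp (d * \<bar>y\<bar>)" if "\<bar>s\<bar> < d" for s y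
  proof -
    have "s * y \<le> \<bar>s\<bar> * \<bar>y\<bar>" using abs_ge_self[of "s * y"] by (simp add: abs_mult)
    also have "\<dots> \<le> d * \<bar>y\<bar>" using that by (intro mult_right_mono) auto
    finally show "exp (s * y) \<le> exp (d * \<bar>y\<bar>)" by simp
  qed (use d in simp)
  have bound: "integrable N h"
    if [measurable]: "h \<in> borel_measurable N"
      and b: "\<And>x. x \<in> space N \<Longrightarrow> \<bar>h x\<bar> \<le> c * (w x * exp (d * \<bar>T i x\<bar> + d * \<bar>T j x\<bar>))" for h c
  proof (rule Bochner_Integration.integrable_bound[OF integrable_mult_right[OF dom, of c]])
    show "AE x in N. norm (h x) \<le> norm (c * (w x * exp (d * \<bar>T i x\<bar> + d * \<bar>T j x\<bar>)))"
      by (intro AE_I2) (use b in fastforce)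
  qed measurable
  have iZ: "integrable N (\<lambda>x. w x * exp (s * T i x))" if s: "\<bar>s\<bar> < d" for s
  proof (rule bound[where c = 1])
    fix x assume x: "x \<in> space N"
    have "exp (s * T i x) * 1 \<le> exp (d * \<bar>T i x\<bar>) * exp (d * \<bar>T j x\<bar>)"
      by (intro mult_mono ex[OF s]) auto
    then show "\<bar>w x * exp (s * T i x)\<bar> \<le> 1 * (w x * exp (d * \<bar>T i x\<bar> + d * \<bar>T j x\<bar>))"
      using w0[OF x] by (simp add: abs_mult exp_add mult_left_mono)
  qed measurable
  have iZd: "integrable N (\<lambda>x. \<bar>w x\<bar> * exp (d * \<bar>T i x\<bar>))"
  proof (rule bound[where c = 1])
    fix x assume x: "x \<in> space N"
    have "exp (d * \<bar>T i x\<bar>) * 1 \<le> exp (d * \<bar>T i x\<bar>) * exp (d * \<bar>T j x\<bar>)"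
      using d by (intro mult_mono) auto
    then show "\<bar>\<bar>w x\<bar> * exp (d * \<bar>T i x\<bar>)\<bar> \<le> 1 * (w x * exp (d * \<bar>T i x\<bar> + d * \<bar>T j x\<bar>))"
      using w0[OF x] by (simp add: abs_mult exp_add mult_left_mono)
  qed measurable
  have iYd: "integrable N (\<lambda>x. \<bar>w x * T j x\<bar> * exp (d * \<bar>T i x\<bar>))"
  proof (rule bound[where c = "1 / d"])
    fix x assume x: "x \<in> space N"
    have "w x * exp (d * \<bar>T i x\<bar>) * \<bar>T j x\<bar> \<le> w x * exp (d * \<bar>T i x\<bar>) * (exp (d * \<bar>T j x\<bar>) / d)"
      using w0[OF x] by (intro mult_left_mono abs_le_exp_div d) auto
    then show "\<bar>\<bar>w x * T j x\<bar> * exp (d * \<bar>T i x\<bar>)\<bar> \<le> 1 / d * (w x * exp (d * \<bar>T i x\<bar> + d * \<bar>T j x\<bar>))"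
      using w0[OF x] by (simp add: abs_mult exp_add mult_ac)
  qed measurable
  have iD: "integrable N (\<lambda>x. \<bar>w x * exp (s * T i x)\<bar> * exp (d * \<bar>T j x\<bar>))" if s: "\<bar>s\<bar> < d" for s
  proof (rule bound[where c = 1])
    fix x assume x: "x \<in> space N"
    have le: "exp (s * T i x) * exp (d * \<bar>T j x\<bar>) \<le> exp (d * \<bar>T i x\<bar>) * exp (d * \<bar>T j x\<bar>)"
      by (intro mult_mono ex[OF s]) auto
    show "\<bar>\<bar>w x * exp (s * T i x)\<bar> * exp (d * \<bar>T j x\<bar>)\<bar>
        \<le> 1 * (w x * exp (d * \<bar>T i x\<bar> + d * \<bar>T j x\<bar>))"
      using mult_left_mono[OF le w0[OF x]] w0[OF x] by (simp add: abs_mult exp_add mult_ac)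
  qed measurable
  have Zpos: "0 < ?Z s" if s: "\<bar>s\<bar> < d" for s
  proof -
    have nn: "AE x in N. 0 \<le> w x * exp (s * T i x)" using w0 by (intro AE_I2) simp
    have "?Z s \<noteq> 0"
    proof
      assume "?Z s = 0"
      then have "AE x in N. w x * exp (s * T i x) = 0"
        using integral_nonneg_eq_0_iff_AE[OF iZ[OF s] nn] by blast
      then have "AE x in N. w x = 0" by simp
      then have "(LINT x|N. w x) = 0" by (rule integral_eq_zero_AE)
      with wpos show False by simp
    qed
    moreover have "0 \<le> ?Z s" by (rule integral_nonneg_AE[OF nn])
    ultimately show ?thesis by simp
  qed
  \<comment> \<open>if \<open>i = j\<close> the second update overrides the first, and \<open>t - s\<close> compensates the term \<open>s * T i x\<close>\<close>
  have lin: "(\<Sum>k<p. ((\<lambda>_. 0)(i := s, j := t)) k * T k x)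
      = s * T i x + (t - ((\<lambda>_. 0)(i := s)) j) * T j x" for s t :: real and x
  proof -
    have "(\<Sum>k<p. ((\<lambda>_. 0)(i := s, j := t)) k * T k x)
        = (\<Sum>k<p. (if k = i then s * T i x else 0) + (if k = j then (t - ((\<lambda>_. 0)(i := s)) j) * T j x else 0))"
      by (intro sum.cong refl) (auto simp: algebra_simps)
    then show ?thesis using i j by (simp add: sum.distrib sum.delta)
  qed
  have inner: "((\<lambda>t. log_mgf N w p T ((\<lambda>_. 0)(i := s, j := t))) has_real_derivative ?Y s / ?Z s)
      (at (((\<lambda>_. 0)(i := s)) j))" if s: "\<bar>s\<bar> < d" for s
  proof -
    let ?\<tau> = "((\<lambda>_. 0)(i := s)) j"
    let ?G = "\<lambda>t. LINT x|N. w x * exp (s * T i x) * exp (t * T j x)"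
    have G: "(?G has_real_derivative ?Y s) (at (?\<tau> + - ?\<tau>))"
      using exp_integral_has_derivative[OF d _ _ iD[OF s]] by simp
    then have "((\<lambda>t. ?G (t + - ?\<tau>)) has_real_derivative ?Y s) (at ?\<tau>)"
      by (simp only: DERIV_shift)
    then have "((\<lambda>t. ln (?G (t + - ?\<tau>))) has_real_derivative (1 / ?G (?\<tau> + - ?\<tau>)) * ?Y s) (at ?\<tau>)"
      by (intro DERIV_chain2[OF DERIV_ln_divide]) (use Zpos[OF s] in simp)
    then show ?thesis
      unfolding log_mgf_def lin by (simp add: exp_add mult.assoc)
  qed
  have Z': "(?Z has_real_derivative (LINT x|N. w x * T i x)) (at 0)"
    by (rule exp_integral_has_derivative[OF d _ _ iZd]) measurable
  have Y': "(?Y has_real_derivative (LINT x|N. w x * T j x * T i x)) (at 0)"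
    using exp_integral_has_derivative[OF d _ _ iYd] by (simp add: mult_ac)
  have "((\<lambda>s. ?Y s / ?Z s) has_real_derivative
      ((LINT x|N. w x * T j x * T i x) * ?Z 0 - ?Y 0 * (LINT x|N. w x * T i x)) / (?Z 0 * ?Z 0)) (at 0)"
    by (rule DERIV_divide[OF Y' Z']) (use Zpos[of 0] d in simp)
  then show ?thesis
    unfolding has_mixed_derivative_def using d inner
    by (intro exI[of _ d] conjI exI[of _ "\<lambda>s. ?Y s / ?Z s"]) (auto simp: power2_eq_square)
qed

section \<open>Linear systems and square matrices\<close>

text \<open>
  Gaussian elimination: if an equation is not trivial, solve it for one unknown and substitute.
\<close>

lemma underdetermined_system:
  fixes A :: "'i \<Rightarrow> 'j \<Rightarrow> real"
  assumes "finite I" "finite J" "card I < card J"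
  shows "\<exists>x. (\<exists>j\<in>J. x j \<noteq> 0) \<and> (\<forall>i\<in>I. (\<Sum>j\<in>J. A i j * x j) = 0)"
  using assms
proof (induction I arbitrary: J A rule: finite_induct)
  case empty
  then have "J \<noteq> {}" by auto
  then show ?case by (intro exI[of _ "\<lambda>_. 1"]) auto
next
  case (insert i I)
  show ?case
  proof (cases "\<forall>j\<in>J. A i j = 0")
    case True
    obtain x where "\<exists>j\<in>J. x j \<noteq> 0" "\<forall>i\<in>I. (\<Sum>j\<in>J. A i j * x j) = 0"
      using insert.IH[of J A] insert.prems insert.hyps by auto
    then show ?thesis using True by (intro exI[of _ x]) auto
  next
    case False
    then obtain q where q: "q \<in> J" "A i q \<noteq> 0" by blast
    let ?J = "J - {q}"
    have J: "finite ?J" "card I < card ?J"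
      using insert.prems insert.hyps q by (auto simp: card_Diff_singleton)
    obtain x where x: "\<exists>j\<in>?J. x j \<noteq> 0"
      and eq: "\<forall>k\<in>I. (\<Sum>j\<in>?J. (A k j - A k q * A i j / A i q) * x j) = 0"
      using insert.IH[OF J, of "\<lambda>k j. A k j - A k q * A i j / A i q"] by blast
    \<comment> \<open>the remaining unknown is the one for which equation \<open>i\<close> is solved\<close>
    define y where "y = x(q := - (\<Sum>j\<in>?J. A i j * x j) / A i q)"
    have split: "(\<Sum>j\<in>J. A k j * y j) = A k q * y q + (\<Sum>j\<in>?J. A k j * x j)" for k
    proof -
      have "(\<Sum>j\<in>J. A k j * y j) = A k q * y q + (\<Sum>j\<in>?J. A k j * y j)"
        by (rule sum.remove) (use insert.prems q in auto)
      also have "(\<Sum>j\<in>?J. A k j * y j) = (\<Sum>j\<in>?J. A k j * x j)"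
        by (rule sum.cong) (auto simp: y_def)
      finally show ?thesis .
    qed
    have yq: "y q = - (\<Sum>j\<in>?J. A i j * x j) / A i q" by (simp add: y_def)
    have "(\<Sum>j\<in>J. A i j * y j) = 0" unfolding split yq using q(2) by simp
    moreover have "(\<Sum>j\<in>J. A k j * y j) = 0" if "k \<in> I" for k
    proof -
      have "0 = (\<Sum>j\<in>?J. (A k j - A k q * A i j / A i q) * x j)" using eq that by simp
      also have "\<dots> = (\<Sum>j\<in>?J. A k j * x j - A k q / A i q * (A i j * x j))"
        by (intro sum.cong refl) (simp add: left_diff_distrib)
      also have "\<dots> = (\<Sum>j\<in>?J. A k j * x j) - A k q / A i q * (\<Sum>j\<in>?J. A i j * x j)"
        by (simp add: sum_subtractf sum_distrib_left)
      finally show ?thesis unfolding split yq by (simp add: field_simps)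
    qed
    moreover have "\<exists>j\<in>J. y j \<noteq> 0" using x by (auto simp: y_def)
    ultimately show ?thesis by (intro exI[of _ y]) auto
  qed
qed

definition mat_mul :: "nat \<Rightarrow> (nat \<Rightarrow> nat \<Rightarrow> real) \<Rightarrow> (nat \<Rightarrow> nat \<Rightarrow> real) \<Rightarrow> nat \<Rightarrow> nat \<Rightarrow> real" where
  "mat_mul p A B i j = (\<Sum>k<p. A i k * B k j)"

text \<open>
  \<open>B\<close> is a right inverse of \<open>A\<close>; for square matrices it is two-sided, by \<open>inverse_mats_commute\<close>.
\<close>

definition inverse_mats :: "nat \<Rightarrow> (nat \<Rightarrow> nat \<Rightarrow> real) \<Rightarrow> (nat \<Rightarrow> nat \<Rightarrow> real) \<Rightarrow> bool" where
  "inverse_mats p A B \<longleftrightarrow> (\<forall>i<p. \<forall>j<p. mat_mul p A B i j = (if i = j then 1 else 0))"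

lemma mat_mul_assoc: "mat_mul p (mat_mul p A B) C i j = mat_mul p A (mat_mul p B C) i j"
proof -
  have "mat_mul p (mat_mul p A B) C i j = (\<Sum>k<p. \<Sum>m<p. A i m * B m k * C k j)"
    by (simp add: mat_mul_def sum_distrib_right)
  also have "\<dots> = (\<Sum>m<p. \<Sum>k<p. A i m * B m k * C k j)" by (rule sum.swap)
  also have "\<dots> = mat_mul p A (mat_mul p B C) i j"
    by (simp add: mat_mul_def sum_distrib_left mult.assoc)
  finally show ?thesis .
qed

lemma mat_mul_cong:
  "(\<And>k. k < p \<Longrightarrow> A i k = A' i k) \<Longrightarrow> (\<And>k. k < p \<Longrightarrow> B k j = B' k j) \<Longrightarrow>
     mat_mul p A B i j = mat_mul p A' B' i j"
  by (simp add: mat_mul_def)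

lemma inverse_mats_cancel:
  assumes "inverse_mats p A B" "i < p"
  shows "mat_mul p (mat_mul p A B) C i j = C i j"
proof -
  have "mat_mul p (mat_mul p A B) C i j = (\<Sum>k<p. (if i = k then 1 else 0) * C k j)"
    unfolding mat_mul_def[of p "mat_mul p A B"]
    using assms by (intro sum.cong refl) (simp add: inverse_mats_def)
  then show ?thesis using assms(2) by (simp add: if_distrib[of "\<lambda>x. x * _"] cong: if_cong)
qed

lemma inverse_mats_mult:
  assumes AB: "inverse_mats p A B" and CD: "inverse_mats p C D"
  shows "inverse_mats p (mat_mul p C A) (mat_mul p B D)"
  unfolding inverse_mats_def
proof (intro allI impI)
  fix i j assume ij: "i < p" "j < p"
  have "mat_mul p (mat_mul p C A) (mat_mul p B D) i j = mat_mul p C (mat_mul p A (mat_mul p B D)) i j"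
    by (rule mat_mul_assoc)
  also have "\<dots> = mat_mul p C D i j"
    by (rule mat_mul_cong) (simp_all add: mat_mul_assoc[symmetric] inverse_mats_cancel[OF AB])
  finally show "mat_mul p (mat_mul p C A) (mat_mul p B D) i j = (if i = j then 1 else 0)"
    using CD ij by (simp add: inverse_mats_def)
qed

text \<open>
  The \<open>p\<close> columns of \<open>D\<close> together with a unit vector are \<open>p + 1\<close> vectors in dimension \<open>p\<close>, hence
  linearly dependent.  The columns of \<open>D\<close> alone are independent because \<open>C\<close> is a left inverse, so the
  unit vector is a combination of them, and multiplication by \<open>C\<close> identifies the coefficients.
\<close>

lemma inverse_mats_commute:
  assumes CD: "inverse_mats p C D"
  shows "inverse_mats p D C"
  unfolding inverse_mats_def
proof (intro allI impI)
  fix i j assume ij: "i < p" "j < p"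
  \<comment> \<open>column \<open>p\<close> is the unit vector \<open>j\<close>, so the unknowns are indexed by \<open>{..p}\<close>\<close>
  let ?A = "\<lambda>i k. if k = p then (if i = j then 1 else 0) else D i k"
  obtain x where x: "\<exists>k\<in>{..p}. x k \<noteq> 0" and eq: "\<forall>i\<in>{..<p}. (\<Sum>k\<in>{..p}. ?A i k * x k) = 0"
    using underdetermined_system[of "{..<p}" "{..p}" ?A] by auto
  have split: "(\<Sum>k\<in>{..p}. ?A i k * x k) = (\<Sum>k<p. D i k * x k) + (if i = j then x p else 0)" for i
  proof -
    have "(\<Sum>k\<in>{..p}. ?A i k * x k) = (\<Sum>k<p. ?A i k * x k) + ?A i p * x p"
      unfolding lessThan_Suc_atMost[symmetric] by (rule sum.lessThan_Suc)
    then show ?thesis by simp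
  qed
  let ?X = "\<lambda>k (_ :: nat). x k"
  have DX: "mat_mul p D ?X i 0 = - (if i = j then x p else 0)" if "i < p" for i
    using eq that unfolding split by (simp add: mat_mul_def eq_neg_iff_add_eq_0)
  have xl: "x l = - C l j * x p" if l: "l < p" for l
  proof -
    have "x l = mat_mul p (mat_mul p C D) ?X l 0" using inverse_mats_cancel[OF CD l] by simp
    also have "\<dots> = mat_mul p C (\<lambda>i _. - (if i = j then x p else 0)) l 0"
      unfolding mat_mul_assoc by (rule mat_mul_cong) (auto simp: DX)
    also have "\<dots> = (\<Sum>k<p. if k = j then - C l j * x p else 0)"
      unfolding mat_mul_def by (rule sum.cong) auto
    finally show ?thesis using ij(2) by simp
  qed
  have xp: "x p \<noteq> 0"
  proof
    assume "x p = 0"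
    then have "x k = 0" if "k \<le> p" for k using xl[of k] that by (cases "k = p") auto
    then show False using x by auto
  qed
  have "- (if i = j then x p else 0) = (\<Sum>k<p. D i k * (- C k j * x p))"
    using DX[OF ij(1)] xl by (simp add: mat_mul_def)
  also have "\<dots> = - (mat_mul p D C i j * x p)"
    by (simp add: mat_mul_def sum_distrib_right sum_negf mult.assoc)
  finally show "mat_mul p D C i j = (if i = j then 1 else 0)" using xp by (auto split: if_splits)
qed

lemma invertible_onI: "inverse_mats p A B \<Longrightarrow> invertible_on p A"
  using inverse_mats_commute[of p A B] unfolding invertible_on_def inverse_mats_def mat_mul_def
  by (intro exI[of _ B]) blast

section \<open>The noise model and its integral operator\<close>

locale noisy_model =
  fixes a b :: real and \<Omega> :: "real set" and g0 :: "real \<Rightarrow> real" and K :: "real \<Rightarrow> real \<Rightarrow> real"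
  assumes ab: "a < b" and \<Omega>_def: "\<Omega> = {a..b}"
    and g0_cont: "continuous_on \<Omega> g0"
    and g0_lower: "\<exists>c>0. \<forall>\<mu>\<in>\<Omega>. g0 \<mu> \<ge> c"
    and g0_density: "(LINT \<mu>|lborel_on \<Omega>. g0 \<mu>) = 1"
    and K_cont: "continuous_on (\<Omega> \<times> \<Omega>) (\<lambda>(\<mu>, x). K \<mu> x)"
    and K_lower: "\<exists>c>0. \<forall>\<mu>\<in>\<Omega>. \<forall>x\<in>\<Omega>. K \<mu> x \<ge> c"
    and K_density: "\<forall>\<mu>\<in>\<Omega>. (LINT x|lborel_on \<Omega>. K \<mu> x) = 1"
    and P_compact: "compact_operator_L2 \<Omega> (P_op \<Omega> K g0)"
begin

abbreviation M where "M \<equiv> lborel_on \<Omega>"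

lemma space_M [simp]: "space M = \<Omega>"
  by (simp add: space_restrict_space)

lemma emeasure_M: "emeasure M \<Omega> = ennreal (b - a)"
  using ab by (simp add: emeasure_restrict_space \<Omega>_def)

sublocale finite_measure M
  by standard (simp add: emeasure_M)

sublocale pair_sigma_finite M M ..

lemma measurable_continuous_on:
  "continuous_on \<Omega> h \<Longrightarrow> h \<in> borel_measurable M" for h :: "real \<Rightarrow> real"
  using borel_measurable_continuous_on_restrict[of \<Omega> h]
  by (simp add: measurable_def sets_restrict_space space_restrict_space)

lemma integrable_bounded:
  fixes h :: "real \<Rightarrow> real"
  assumes "h \<in> borel_measurable M" and "\<And>x. x \<in> \<Omega> \<Longrightarrow> \<bar>h x\<bar> \<le> C"
  shows "integrable M h"
  by (rule integrable_const_bound[OF _ assms(1), of C]) (use assms(2) in \<open>auto intro!: AE_I2\<close>)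

lemma bounded_mem_L2:
  assumes h: "h \<in> borel_measurable M" and C: "\<And>x. x \<in> \<Omega> \<Longrightarrow> \<bar>h x\<bar> \<le> C"
  shows "h \<in> L2_space \<Omega>"
proof (rule L2_spaceI[OF h integrable_bounded])
  show "\<bar>(h x)\<^sup>2\<bar> \<le> C\<^sup>2" if "x \<in> \<Omega>" for x
    using power_mono[OF C[OF that], of 2] by simp
qed (use h in measurable)

lemma continuous_mem_L2:
  assumes "continuous_on \<Omega> h" shows "h \<in> L2_space \<Omega>"
proof -
  have "compact (h ` \<Omega>)" using compact_continuous_image[OF assms] by (simp add: \<Omega>_def)
  then obtain C where "\<forall>x\<in>h ` \<Omega>. norm x \<le> C"
    using compact_imp_bounded bounded_iff by blast
  then show ?thesis by (intro bounded_mem_L2[where C=C] measurable_continuous_on assms) auto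
qed

lemma L2_integrable: "u \<in> L2_space \<Omega> \<Longrightarrow> integrable M u"
  using L2_product_integrable[of u \<Omega> "\<lambda>_. 1"] continuous_mem_L2[of "\<lambda>_. 1"] by simp

lemma g0_bounds: obtains gmin gmax where "gmin > 0" "\<And>\<mu>. \<mu> \<in> \<Omega> \<Longrightarrow> gmin \<le> g0 \<mu>" "\<And>\<mu>. \<mu> \<in> \<Omega> \<Longrightarrow> g0 \<mu> \<le> gmax"
proof -
  have "compact (g0 ` \<Omega>)" using compact_continuous_image[OF g0_cont] by (simp add: \<Omega>_def)
  then obtain C where "\<forall>x\<in>g0 ` \<Omega>. norm x \<le> C"
    using compact_imp_bounded bounded_iff by blast
  then have "g0 \<mu> \<le> C" if "\<mu> \<in> \<Omega>" for \<mu> using that by force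
  then show ?thesis using g0_lower that by blast
qed

lemma K_bounds: obtains kmin kmax where "kmin > 0"
  "\<And>\<mu> x. \<mu> \<in> \<Omega> \<Longrightarrow> x \<in> \<Omega> \<Longrightarrow> kmin \<le> K \<mu> x" "\<And>\<mu> x. \<mu> \<in> \<Omega> \<Longrightarrow> x \<in> \<Omega> \<Longrightarrow> K \<mu> x \<le> kmax"
proof -
  have "compact ((\<lambda>(\<mu>, x). K \<mu> x) ` (\<Omega> \<times> \<Omega>))"
    using compact_continuous_image[OF K_cont] by (simp add: \<Omega>_def compact_Times)
  then obtain C where C: "\<forall>y\<in>(\<lambda>(\<mu>, x). K \<mu> x) ` (\<Omega> \<times> \<Omega>). norm y \<le> C"
    using compact_imp_bounded bounded_iff by blast
  have "K \<mu> x \<le> C" if "\<mu> \<in> \<Omega>" "x \<in> \<Omega>" for \<mu> x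
    using bspec[OF C, of "K \<mu> x"] that by force
  then show ?thesis using K_lower that by blast
qed

lemma g0_pos: "\<mu> \<in> \<Omega> \<Longrightarrow> 0 < g0 \<mu>"
  using g0_lower by force

lemma K_pos: "\<mu> \<in> \<Omega> \<Longrightarrow> x \<in> \<Omega> \<Longrightarrow> 0 < K \<mu> x"
  using K_lower by force

lemma K_cont_left: "x \<in> \<Omega> \<Longrightarrow> continuous_on \<Omega> (\<lambda>\<mu>. K \<mu> x)"
  using continuous_on_compose2[OF K_cont
      continuous_on_Pair[OF continuous_on_id continuous_on_const, of \<Omega> x]] by auto

lemma K_cont_right: "\<mu> \<in> \<Omega> \<Longrightarrow> continuous_on \<Omega> (\<lambda>x. K \<mu> x)"
  using continuous_on_compose2[OF K_cont
      continuous_on_Pair[OF continuous_on_const continuous_on_id, of \<Omega> \<mu>]] by auto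

text \<open>
  Outside the square \<open>K\<close> is arbitrary; clamping both arguments to the interval extends it to a
  continuous function on the plane.
\<close>

lemma K_measurable: "(\<lambda>(\<mu>, x). K \<mu> x) \<in> borel_measurable (M \<Otimes>\<^sub>M M)"
proof -
  define cl where "cl x = max a (min b x)" for x :: real
  have cl: "cl x \<in> \<Omega>" for x using ab by (auto simp: cl_def \<Omega>_def)
  have cont: "continuous_on UNIV (\<lambda>z :: real \<times> real. (cl (fst z), cl (snd z)))"
    unfolding cl_def by (intro continuous_intros)
  have "continuous_on UNIV (\<lambda>z :: real \<times> real. K (cl (fst z)) (cl (snd z)))"
    using continuous_on_compose2[OF K_cont cont] cl by auto
  then have "(\<lambda>z :: real \<times> real. K (cl (fst z)) (cl (snd z))) \<in> borel_measurable (borel \<Otimes>\<^sub>M borel)"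
    unfolding borel_prod by (rule borel_measurable_continuous_onI)
  moreover have "(\<lambda>z. z) \<in> M \<Otimes>\<^sub>M M \<rightarrow>\<^sub>M (borel \<Otimes>\<^sub>M borel)"
  proof -
    have "(\<lambda>x. x) \<in> M \<rightarrow>\<^sub>M borel" by (intro measurable_restrict_space1) simp
    then have "(\<lambda>z. (fst z, snd z)) \<in> M \<Otimes>\<^sub>M M \<rightarrow>\<^sub>M (borel \<Otimes>\<^sub>M borel)"
      by (intro measurable_Pair measurable_compose[OF measurable_fst]
          measurable_compose[OF measurable_snd])
    then show ?thesis by simp
  qed
  ultimately have "(\<lambda>z. K (cl (fst z)) (cl (snd z))) \<in> borel_measurable (M \<Otimes>\<^sub>M M)"
    by (rule measurable_compose[rotated])
  moreover have "K (cl (fst z)) (cl (snd z)) = (\<lambda>(\<mu>, x). K \<mu> x) z"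
    if "z \<in> space (M \<Otimes>\<^sub>M M)" for z
    using that by (auto simp: space_pair_measure cl_def \<Omega>_def)
  ultimately show ?thesis by (simp cong: measurable_cong)
qed

lemma K_measurable_swap: "(\<lambda>(x, \<mu>). K \<mu> x) \<in> borel_measurable (M \<Otimes>\<^sub>M M)"
  using measurable_pair_swap[OF K_measurable] by (simp add: case_prod_beta)

text \<open>
  The density of \<open>X\<close> when \<open>\<mu>\<close> has the (possibly signed) density \<open>h\<close>.
\<close>

definition push :: "(real \<Rightarrow> real) \<Rightarrow> real \<Rightarrow> real" where
  "push h x = (LINT \<mu>|M. K \<mu> x * h \<mu>)"

lemma push_integrand:
  assumes h: "integrable M h" and x: "x \<in> \<Omega>"
  shows "integrable M (\<lambda>\<mu>. K \<mu> x * h \<mu>)"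
proof -
  obtain kmin kmax where k: "kmin > 0" "\<And>\<mu> x. \<mu> \<in> \<Omega> \<Longrightarrow> x \<in> \<Omega> \<Longrightarrow> kmin \<le> K \<mu> x"
    "\<And>\<mu> x. \<mu> \<in> \<Omega> \<Longrightarrow> x \<in> \<Omega> \<Longrightarrow> K \<mu> x \<le> kmax" by (rule K_bounds) blast
  have [measurable]: "h \<in> borel_measurable M" "(\<lambda>\<mu>. K \<mu> x) \<in> borel_measurable M"
    using h x by (auto intro: measurable_continuous_on K_cont_left)
  show ?thesis
  proof (rule Bochner_Integration.integrable_bound[of _ "\<lambda>\<mu>. kmax * h \<mu>"])
    show "AE \<mu> in M. norm (K \<mu> x * h \<mu>) \<le> norm (kmax * h \<mu>)"
    proof (intro AE_I2)
      fix \<mu> assume "\<mu> \<in> space M"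
      then have "0 < K \<mu> x" "K \<mu> x \<le> kmax" using k(3) K_pos x by auto
      then show "norm (K \<mu> x * h \<mu>) \<le> norm (kmax * h \<mu>)"
        by (simp add: abs_mult mult_right_mono)
    qed
  qed (use h in auto)
qed

lemma push_bounded:
  assumes h: "integrable M h"
  obtains C where "\<And>x. x \<in> \<Omega> \<Longrightarrow> \<bar>push h x\<bar> \<le> C"
proof -
  obtain kmin kmax where k: "kmin > 0" "\<And>\<mu> x. \<mu> \<in> \<Omega> \<Longrightarrow> x \<in> \<Omega> \<Longrightarrow> kmin \<le> K \<mu> x"
    "\<And>\<mu> x. \<mu> \<in> \<Omega> \<Longrightarrow> x \<in> \<Omega> \<Longrightarrow> K \<mu> x \<le> kmax" by (rule K_bounds) blast
  have "\<bar>push h x\<bar> \<le> (LINT \<mu>|M. kmax * \<bar>h \<mu>\<bar>)" if x: "x \<in> \<Omega>" for x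
  proof -
    have "\<bar>push h x\<bar> \<le> (LINT \<mu>|M. \<bar>K \<mu> x * h \<mu>\<bar>)"
      unfolding push_def by (rule integral_abs_bound)
    also have "\<dots> \<le> (LINT \<mu>|M. kmax * \<bar>h \<mu>\<bar>)"
    proof (rule integral_mono)
      fix \<mu> assume "\<mu> \<in> space M"
      then have "0 < K \<mu> x" "K \<mu> x \<le> kmax" using k(3) K_pos x by auto
      then show "\<bar>K \<mu> x * h \<mu>\<bar> \<le> kmax * \<bar>h \<mu>\<bar>" by (simp add: abs_mult mult_right_mono)
    qed (use h push_integrand[OF h x] in auto)
    finally show ?thesis .
  qed
  then show ?thesis by (rule that)
qed

lemma push_measurable:
  assumes "h \<in> borel_measurable M" shows "push h \<in> borel_measurable M"
proof -
  note [measurable] = assms K_measurable_swap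
  have "sigma_finite_measure M" by unfold_locales
  then show ?thesis unfolding push_def
    by (rule sigma_finite_measure.borel_measurable_lebesgue_integral) measurable
qed

text \<open>
  For \<open>\<phi> = (\<lambda>_. 1)\<close> this says that the noise preserves total mass (\<open>push_integral\<close>); for other \<open>\<phi>\<close>
  it moves the integral over \<open>x\<close> inside, which relates the kernel of the operator to its form.
\<close>

lemma push_Fubini:
  assumes h: "integrable M h" and \<phi>: "\<phi> \<in> borel_measurable M" "\<And>x. x \<in> \<Omega> \<Longrightarrow> \<bar>\<phi> x\<bar> \<le> C"
  shows "(LINT x|M. \<phi> x * push h x) = (LINT \<mu>|M. (LINT x|M. K \<mu> x * \<phi> x) * h \<mu>)"
proof -
  obtain kmin kmax where k: "kmin > 0" "\<And>\<mu> x. \<mu> \<in> \<Omega> \<Longrightarrow> x \<in> \<Omega> \<Longrightarrow> kmin \<le> K \<mu> x"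
    "\<And>\<mu> x. \<mu> \<in> \<Omega> \<Longrightarrow> x \<in> \<Omega> \<Longrightarrow> K \<mu> x \<le> kmax" by (rule K_bounds) blast
  note [measurable] = \<phi>(1) K_measurable borel_measurable_integrable[OF h]
  have "integrable (M \<Otimes>\<^sub>M M) (\<lambda>(\<mu>, x). h \<mu>)"
    by (rule Fubini_integrable) (use h in auto)
  then have dom: "integrable (M \<Otimes>\<^sub>M M) (\<lambda>z. (kmax * C) * (\<lambda>(\<mu>, x). h \<mu>) z)"
    by (rule integrable_mult_right)
  have "integrable (M \<Otimes>\<^sub>M M) (\<lambda>(\<mu>, x). K \<mu> x * \<phi> x * h \<mu>)"
  proof (rule Bochner_Integration.integrable_bound[OF dom])
    show "(\<lambda>(\<mu>, x). K \<mu> x * \<phi> x * h \<mu>) \<in> borel_measurable (M \<Otimes>\<^sub>M M)" by measurable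
    show "AE z in M \<Otimes>\<^sub>M M. norm (case z of (\<mu>, x) \<Rightarrow> K \<mu> x * \<phi> x * h \<mu>)
        \<le> norm ((kmax * C) * (case z of (\<mu>, x) \<Rightarrow> h \<mu>))"
    proof (intro AE_I2)
      fix z assume z: "z \<in> space (M \<Otimes>\<^sub>M M)"
      obtain \<mu> x where zz: "z = (\<mu>, x)" by fastforce
      with z have mx: "\<mu> \<in> \<Omega>" "x \<in> \<Omega>" by (auto simp: space_pair_measure)
      have "K \<mu> x * \<bar>\<phi> x\<bar> \<le> kmax * C"
        using k(3)[OF mx] K_pos[OF mx] \<phi>(2)[OF mx(2)] by (intro mult_mono) auto
      moreover have "\<bar>K \<mu> x * \<phi> x\<bar> = K \<mu> x * \<bar>\<phi> x\<bar>" using K_pos[OF mx] by (simp add: abs_mult)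
      ultimately have "\<bar>K \<mu> x * \<phi> x\<bar> \<le> \<bar>kmax * C\<bar>" by linarith
      then show "norm (case z of (\<mu>, x) \<Rightarrow> K \<mu> x * \<phi> x * h \<mu>)
          \<le> norm ((kmax * C) * (case z of (\<mu>, x) \<Rightarrow> h \<mu>))"
        by (simp add: zz abs_mult mult_right_mono)
    qed
  qed
  from Fubini_integral[OF this]
  have "(LINT x|M. LINT \<mu>|M. K \<mu> x * \<phi> x * h \<mu>) = (LINT \<mu>|M. LINT x|M. K \<mu> x * \<phi> x * h \<mu>)" .
  moreover have "(LINT \<mu>|M. K \<mu> x * \<phi> x * h \<mu>) = \<phi> x * push h x" for x
    unfolding push_def integral_mult_right_zero[symmetric] by (simp only: mult_ac)
  ultimately show ?thesis by simp
qed

lemma push_integral: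
  assumes h: "integrable M h" shows "(LINT x|M. push h x) = (LINT \<mu>|M. h \<mu>)"
proof -
  have "(LINT x|M. 1 * push h x) = (LINT \<mu>|M. (LINT x|M. K \<mu> x * 1) * h \<mu>)"
    by (rule push_Fubini[OF h, of _ 1]) auto
  also have "\<dots> = (LINT \<mu>|M. h \<mu>)"
    using K_density by (intro Bochner_Integration.integral_cong) auto
  finally show ?thesis by simp
qed

abbreviation f where "f \<equiv> marginal \<Omega> K g0"

lemma f_push: "f = push g0"
  by (simp add: fun_eq_iff marginal_def push_def)

lemma g0_integrable: "integrable M g0"
  by (intro L2_integrable continuous_mem_L2 g0_cont)

lemma f_lower: obtains c where "c > 0" "\<And>x. x \<in> \<Omega> \<Longrightarrow> c \<le> f x"
proof -
  obtain kmin kmax where k: "kmin > 0" "\<And>\<mu> x. \<mu> \<in> \<Omega> \<Longrightarrow> x \<in> \<Omega> \<Longrightarrow> kmin \<le> K \<mu> x"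
    "\<And>\<mu> x. \<mu> \<in> \<Omega> \<Longrightarrow> x \<in> \<Omega> \<Longrightarrow> K \<mu> x \<le> kmax" by (rule K_bounds) blast
  have "kmin \<le> f x" if x: "x \<in> \<Omega>" for x
  proof -
    have "kmin = (LINT \<mu>|M. kmin * g0 \<mu>)" by (simp add: g0_density)
    also have "\<dots> \<le> f x" unfolding f_push push_def
      by (intro integral_mono push_integrand x integrable_mult_right g0_integrable mult_right_mono)
         (use k(2) x g0_pos in \<open>auto intro: less_imp_le\<close>)
    finally show ?thesis .
  qed
  with k(1) show ?thesis by (rule that)
qed

lemma f_pos: "x \<in> \<Omega> \<Longrightarrow> 0 < f x"
  by (rule f_lower) force

lemma f_measurable: "f \<in> borel_measurable M"
  unfolding f_push by (intro push_measurable borel_measurable_integrable g0_integrable)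

abbreviation root_g where "root_g \<mu> \<equiv> sqrt (g0 \<mu>)"

lemma root_g_cont: "continuous_on \<Omega> root_g"
  by (intro continuous_intros g0_cont)

lemma root_g_mem: "root_g \<in> L2_space \<Omega>"
  by (intro continuous_mem_L2 root_g_cont)

lemma root_g_square: "\<mu> \<in> \<Omega> \<Longrightarrow> root_g \<mu> * root_g \<mu> = g0 \<mu>"
  using g0_pos[of \<mu>] by simp

lemma root_g_mult_integrable: "u \<in> L2_space \<Omega> \<Longrightarrow> integrable M (\<lambda>\<mu>. root_g \<mu> * u \<mu>)"
  by (intro L2_product_integrable root_g_mem)

lemma root_g_unit: "L2_inner \<Omega> root_g root_g = 1"
proof -
  have "L2_inner \<Omega> root_g root_g = (LINT \<mu>|M. g0 \<mu>)"
    unfolding L2_inner_def by (intro Bochner_Integration.integral_cong root_g_square) auto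
  then show ?thesis by (simp add: g0_density)
qed

text \<open>
  For \<open>h = (\<lambda>\<mu>. g0 \<mu> * t \<mu>)\<close> this is the conditional expectation of \<open>t \<mu>\<close> given \<open>X = x\<close>.
\<close>

definition posterior :: "(real \<Rightarrow> real) \<Rightarrow> real \<Rightarrow> real" where
  "posterior h x = inverse (f x) * push h x"

lemma posterior_measurable: "h \<in> borel_measurable M \<Longrightarrow> posterior h \<in> borel_measurable M"
  unfolding posterior_def using f_measurable push_measurable
  by (intro borel_measurable_times borel_measurable_inverse) auto

lemma posterior_bounded:
  assumes h: "integrable M h"
  obtains C where "\<And>x. x \<in> \<Omega> \<Longrightarrow> \<bar>posterior h x\<bar> \<le> C"
proof -
  obtain c where c: "c > 0" "\<And>x. x \<in> \<Omega> \<Longrightarrow> c \<le> f x" by (rule f_lower) blast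
  obtain C where C: "\<And>x. x \<in> \<Omega> \<Longrightarrow> \<bar>push h x\<bar> \<le> C" by (rule push_bounded[OF h]) blast
  have "\<bar>posterior h x\<bar> \<le> inverse c * C" if x: "x \<in> \<Omega>" for x
    unfolding posterior_def abs_mult
    using c(1) c(2)[OF x] C[OF x] by (intro mult_mono) (auto simp: le_imp_inverse_le)
  then show ?thesis by (rule that)
qed

abbreviation P where "P \<equiv> P_op \<Omega> K g0"

text \<open>
  The operator first takes the posterior mean of \<open>u / root_g\<close>, then averages it over \<open>X\<close> given
  \<open>\<mu>\<close> and multiplies by \<open>root_g\<close>.
\<close>

lemma P_eq:
  assumes u: "u \<in> L2_space \<Omega>" and \<mu>: "\<mu> \<in> \<Omega>"
  shows "P u \<mu> = root_g \<mu> * (LINT x|M. K \<mu> x * posterior (\<lambda>\<nu>. root_g \<nu> * u \<nu>) x)"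
proof -
  obtain kmin kmax where k: "kmin > 0" "\<And>\<mu> x. \<mu> \<in> \<Omega> \<Longrightarrow> x \<in> \<Omega> \<Longrightarrow> kmin \<le> K \<mu> x"
    "\<And>\<mu> x. \<mu> \<in> \<Omega> \<Longrightarrow> x \<in> \<Omega> \<Longrightarrow> K \<mu> x \<le> kmax" by (rule K_bounds) blast
  obtain c where c: "c > 0" "\<And>x. x \<in> \<Omega> \<Longrightarrow> c \<le> f x" by (rule f_lower) blast
  let ?\<phi> = "\<lambda>x. root_g \<mu> * K \<mu> x * inverse (f x)"
  have "P u \<mu> = (LINT \<nu>|M. (LINT x|M. K \<nu> x * ?\<phi> x) * (root_g \<nu> * u \<nu>))"
  proof -
    have "P_kernel \<Omega> K g0 \<mu> \<nu> = (LINT x|M. K \<nu> x * ?\<phi> x) * root_g \<nu>" for \<nu>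
      unfolding P_kernel_def integral_mult_left_zero[symmetric] by (simp only: mult_ac)
    then show ?thesis unfolding P_op_def by (simp add: mult.assoc)
  qed
  also have "\<dots> = (LINT x|M. ?\<phi> x * push (\<lambda>\<nu>. root_g \<nu> * u \<nu>) x)"
  proof (rule push_Fubini[symmetric, OF root_g_mult_integrable[OF u], where C = "root_g \<mu> * kmax * inverse c"])
    show "?\<phi> \<in> borel_measurable M"
      using measurable_continuous_on[OF K_cont_right[OF \<mu>]] f_measurable by measurable
    fix x assume x: "x \<in> \<Omega>"
    show "\<bar>?\<phi> x\<bar> \<le> root_g \<mu> * kmax * inverse c"
      unfolding abs_mult
      using c(1) c(2)[OF x] k(3)[OF \<mu> x] K_pos[OF \<mu> x] g0_pos[OF \<mu>] f_pos[OF x]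
      by (intro mult_mono) (auto simp: le_imp_inverse_le)
  qed
  also have "\<dots> = root_g \<mu> * (LINT x|M. K \<mu> x * posterior (\<lambda>\<nu>. root_g \<nu> * u \<nu>) x)"
    unfolding posterior_def by (simp add: mult.assoc)
  finally show ?thesis .
qed

text \<open>
  The factor integrated against \<open>K \<mu> x\<close> does not depend on \<open>\<mu>\<close> and is bounded, so the continuity of
  \<open>K\<close> in \<open>\<mu>\<close> passes to the integral by dominated convergence.
\<close>

lemma P_continuous:
  assumes u: "u \<in> L2_space \<Omega>" shows "continuous_on \<Omega> (P u)"
proof -
  obtain kmin kmax where k: "kmin > 0" "\<And>\<mu> x. \<mu> \<in> \<Omega> \<Longrightarrow> x \<in> \<Omega> \<Longrightarrow> kmin \<le> K \<mu> x"
    "\<And>\<mu> x. \<mu> \<in> \<Omega> \<Longrightarrow> x \<in> \<Omega> \<Longrightarrow> K \<mu> x \<le> kmax" by (rule K_bounds) blast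
  let ?q = "posterior (\<lambda>\<nu>. root_g \<nu> * u \<nu>)"
  note h = root_g_mult_integrable[OF u]
  have q [measurable]: "?q \<in> borel_measurable M"
    by (intro posterior_measurable borel_measurable_integrable h)
  obtain C where "\<And>x. x \<in> \<Omega> \<Longrightarrow> \<bar>?q x\<bar> \<le> C" by (rule posterior_bounded[OF h]) blast
  then have qi: "integrable M ?q" by (rule integrable_bounded[OF q])
  have "continuous_on \<Omega> (\<lambda>\<mu>. LINT x|M. K \<mu> x * ?q x)"
    unfolding continuous_on_sequentially
  proof (intro ballI allI impI)
    fix \<mu> X assume \<mu>: "\<mu> \<in> \<Omega>" and X: "(\<forall>n. X n \<in> \<Omega>) \<and> X \<longlonglongrightarrow> \<mu>"
    show "((\<lambda>\<mu>. LINT x|M. K \<mu> x * ?q x) \<circ> X) \<longlonglongrightarrow> (LINT x|M. K \<mu> x * ?q x)"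
      unfolding o_def
    proof (rule integral_dominated_convergence[where w = "\<lambda>x. kmax * \<bar>?q x\<bar>"])
      have "(\<lambda>n. K (X n) x) \<longlonglongrightarrow> K \<mu> x" if "x \<in> \<Omega>" for x
        using K_cont_left[OF that] \<mu> X unfolding continuous_on_sequentially o_def by blast
      then show "AE x in M. (\<lambda>n. K (X n) x * ?q x) \<longlonglongrightarrow> K \<mu> x * ?q x"
        by (intro AE_I2 tendsto_mult_right) simp
      show "AE x in M. norm (K (X n) x * ?q x) \<le> kmax * \<bar>?q x\<bar>" for n
      proof (intro AE_I2)
        fix x assume "x \<in> space M"
        then have "0 < K (X n) x" "K (X n) x \<le> kmax" using K_pos X k(3) by auto
        then show "norm (K (X n) x * ?q x) \<le> kmax * \<bar>?q x\<bar>" by (simp add: abs_mult mult_right_mono)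
      qed
    qed (use qi X \<mu> measurable_continuous_on[OF K_cont_right] in auto)
  qed
  then have "continuous_on \<Omega> (\<lambda>\<mu>. root_g \<mu> * (LINT x|M. K \<mu> x * ?q x))"
    by (intro continuous_on_mult root_g_cont)
  then show ?thesis using P_eq[OF u] by (simp cong: continuous_on_cong)
qed

lemma P_form:
  assumes u: "u \<in> L2_space \<Omega>" and v: "v \<in> L2_space \<Omega>"
  shows "L2_inner \<Omega> (P u) v =
    (LINT x|M. inverse (f x) * push (\<lambda>\<mu>. root_g \<mu> * u \<mu>) x * push (\<lambda>\<mu>. root_g \<mu> * v \<mu>) x)"
proof -
  let ?q = "posterior (\<lambda>\<nu>. root_g \<nu> * u \<nu>)"
  note h = root_g_mult_integrable[OF u]
  have q: "?q \<in> borel_measurable M"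
    by (intro posterior_measurable borel_measurable_integrable h)
  obtain C where C: "\<And>x. x \<in> \<Omega> \<Longrightarrow> \<bar>?q x\<bar> \<le> C" by (rule posterior_bounded[OF h]) blast
  have "L2_inner \<Omega> (P u) v = (LINT \<mu>|M. (LINT x|M. K \<mu> x * ?q x) * (root_g \<mu> * v \<mu>))"
    unfolding L2_inner_def by (intro Bochner_Integration.integral_cong) (auto simp: P_eq u)
  also have "\<dots> = (LINT x|M. ?q x * push (\<lambda>\<mu>. root_g \<mu> * v \<mu>) x)"
    by (rule push_Fubini[symmetric, OF root_g_mult_integrable[OF v] q C])
  finally show ?thesis by (simp add: posterior_def)
qed

text \<open>
  The inequality of Cauchy and Schwarz for \<open>root_g\<close> and \<open>u\<close> with respect to the weight \<open>K \<mu> x\<close>.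
  Divided by \<open>f x\<close> and integrated over \<open>x\<close> it makes the operator a contraction, as the noise preserves
  the total mass of \<open>u\<^sup>2\<close>.
\<close>

lemma push_Cauchy_Schwarz:
  assumes u: "u \<in> L2_space \<Omega>" and x: "x \<in> \<Omega>"
  shows "(push (\<lambda>\<mu>. root_g \<mu> * u \<mu>) x)\<^sup>2 \<le> f x * push (\<lambda>\<mu>. (u \<mu>)\<^sup>2) x"
proof -
  let ?k = "\<lambda>\<mu>. sqrt (K \<mu> x)"
  have k: "?k \<mu> * ?k \<mu> = K \<mu> x" if "\<mu> \<in> \<Omega>" for \<mu> using K_pos[OF that x] by simp
  have kc: "continuous_on \<Omega> ?k" by (intro continuous_intros K_cont_left x)
  have [measurable]: "u \<in> borel_measurable M" "?k \<in> borel_measurable M"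
    using u kc by (auto simp: L2_measurable measurable_continuous_on)
  have L: "(\<lambda>\<mu>. ?k \<mu> * root_g \<mu>) \<in> L2_space \<Omega>"
    by (intro continuous_mem_L2 continuous_on_mult kc root_g_cont)
  have kk: "(?k \<mu> * w)\<^sup>2 = K \<mu> x * w\<^sup>2" if "\<mu> \<in> \<Omega>" for \<mu> w
    using k[OF that] by (simp add: power2_eq_square mult_ac)
  have u2: "integrable M (\<lambda>\<mu>. (u \<mu>)\<^sup>2)" using u by (simp add: L2_space_def)
  have "integrable M (\<lambda>\<mu>. (?k \<mu> * u \<mu>)\<^sup>2) = integrable M (\<lambda>\<mu>. K \<mu> x * (u \<mu>)\<^sup>2)"
    by (rule Bochner_Integration.integrable_cong[OF refl]) (rule kk, simp)
  with push_integrand[OF u2 x] have "integrable M (\<lambda>\<mu>. (?k \<mu> * u \<mu>)\<^sup>2)" by blast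
  then have R: "(\<lambda>\<mu>. ?k \<mu> * u \<mu>) \<in> L2_space \<Omega>"
    by (rule L2_spaceI[rotated]) (intro borel_measurable_times; fact)
  have krw: "?k \<mu> * v * (?k \<mu> * w) = K \<mu> x * (v * w)" if "\<mu> \<in> \<Omega>" for \<mu> v w
  proof -
    have "?k \<mu> * v * (?k \<mu> * w) = (?k \<mu> * ?k \<mu>) * (v * w)" by (simp only: mult_ac)
    then show ?thesis by (simp only: k[OF that])
  qed
  have ip: "L2_inner \<Omega> (\<lambda>\<mu>. ?k \<mu> * v \<mu>) (\<lambda>\<mu>. ?k \<mu> * w \<mu>) = push (\<lambda>\<mu>. v \<mu> * w \<mu>) x" for v w
    unfolding L2_inner_def push_def by (intro Bochner_Integration.integral_cong refl krw) simp
  have "push (\<lambda>\<mu>. root_g \<mu> * root_g \<mu>) x = f x"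
    unfolding f_push push_def
    by (intro Bochner_Integration.integral_cong refl) (use root_g_square in simp)
  with L2.Cauchy_Schwarz[OF L R] show ?thesis by (simp add: ip power2_eq_square)
qed

sublocale psd_operator \<Omega> P
proof
  show "P u \<in> L2_space \<Omega>" if "u \<in> L2_space \<Omega>" for u
    using P_compact that by (simp add: compact_operator_L2_def)
  show "AE x in M. P (\<lambda>y. r * u y + s * v y) x = r * P u x + s * P v x"
    if "u \<in> L2_space \<Omega>" "v \<in> L2_space \<Omega>" for u v r s
    using P_compact that by (simp add: compact_operator_L2_def)
  show "L2_inner \<Omega> (P u) v = L2_inner \<Omega> u (P v)"
    if u: "u \<in> L2_space \<Omega>" and v: "v \<in> L2_space \<Omega>" for u v
  proof -
    have "P v \<in> L2_space \<Omega>" using P_compact v by (simp add: compact_operator_L2_def)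
    then have "L2_inner \<Omega> u (P v) = L2_inner \<Omega> (P v) u" by (rule L2.sym[OF u])
    then show ?thesis by (simp add: P_form u v mult_ac)
  qed
  fix u assume u: "u \<in> L2_space \<Omega>"
  let ?s = "push (\<lambda>\<mu>. root_g \<mu> * u \<mu>)"
  have form: "L2_inner \<Omega> (P u) u = (LINT x|M. inverse (f x) * (?s x)\<^sup>2)"
    by (simp add: P_form[OF u u] power2_eq_square mult.assoc)
  show "0 \<le> L2_inner \<Omega> (P u) u"
    unfolding form by (intro integral_nonneg_AE AE_I2) (auto simp: f_pos less_imp_le)
  have u2: "integrable M (\<lambda>\<mu>. (u \<mu>)\<^sup>2)" using u by (simp add: L2_space_def)
  have "L2_inner \<Omega> (P u) u \<le> (LINT x|M. push (\<lambda>\<mu>. (u \<mu>)\<^sup>2) x)"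
    unfolding form
  proof (rule integral_mono')
    obtain C where "\<And>x. x \<in> \<Omega> \<Longrightarrow> \<bar>push (\<lambda>\<mu>. (u \<mu>)\<^sup>2) x\<bar> \<le> C"
      by (rule push_bounded[OF u2]) blast
    then show "integrable M (push (\<lambda>\<mu>. (u \<mu>)\<^sup>2))"
      by (rule integrable_bounded[OF push_measurable[OF borel_measurable_integrable[OF u2]]])
    fix x assume "x \<in> space M"
    then have x: "x \<in> \<Omega>" by simp
    show "inverse (f x) * (?s x)\<^sup>2 \<le> push (\<lambda>\<mu>. (u \<mu>)\<^sup>2) x"
      using push_Cauchy_Schwarz[OF u x] f_pos[OF x] by (simp add: field_simps)
    have "0 \<le> f x * push (\<lambda>\<mu>. (u \<mu>)\<^sup>2) x"
      using push_Cauchy_Schwarz[OF u x] by (rule order_trans[rotated]) simp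
    then show "0 \<le> push (\<lambda>\<mu>. (u \<mu>)\<^sup>2) x" using f_pos[OF x] by (simp add: zero_le_mult_iff)
  qed
  also have "\<dots> = L2_inner \<Omega> u u"
    unfolding push_integral[OF u2] by (simp add: L2_inner_def power2_eq_square)
  finally show "L2_inner \<Omega> (P u) u \<le> L2_inner \<Omega> u u" .
qed

lemma P_root_g: "\<mu> \<in> \<Omega> \<Longrightarrow> P root_g \<mu> = root_g \<mu>"
proof -
  assume \<mu>: "\<mu> \<in> \<Omega>"
  have "posterior (\<lambda>\<nu>. root_g \<nu> * root_g \<nu>) x = 1" if x: "x \<in> \<Omega>" for x
  proof -
    have "push (\<lambda>\<nu>. root_g \<nu> * root_g \<nu>) x = f x" unfolding f_push push_def
      by (intro Bochner_Integration.integral_cong) (auto simp: g0_pos less_imp_le)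
    then show ?thesis using f_pos[OF x] by (simp add: posterior_def)
  qed
  then have "(LINT x|M. K \<mu> x * posterior (\<lambda>\<nu>. root_g \<nu> * root_g \<nu>) x) = (LINT x|M. K \<mu> x)"
    by (intro Bochner_Integration.integral_cong) auto
  then show ?thesis using P_eq[OF root_g_mem \<mu>] K_density \<mu> by simp
qed

section \<open>Fisher informations as forms of the score functions\<close>

text \<open>
  The interval has positive length, so that statements holding almost everywhere are satisfied
  somewhere.
\<close>

lemma not_AE_False: "\<not> (AE x in M. False)"
proof
  assume "AE x in M. False"
  then have "emeasure M \<Omega> = 0"
    using AE_iff_null[of M "\<lambda>_. False"] sets.top[of M] by (simp add: null_sets_def)
  then show False using ab by (simp add: emeasure_M)
qed

lemma integral_pos:
  fixes h :: "real \<Rightarrow> real"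
  assumes h: "integrable M h" and pos: "\<And>x. x \<in> \<Omega> \<Longrightarrow> 0 < h x"
  shows "0 < (LINT x|M. h x)"
proof -
  have nn: "AE x in M. 0 \<le> h x" using pos by (intro AE_I2) (auto intro: less_imp_le)
  have "(LINT x|M. h x) \<noteq> 0"
  proof
    assume "(LINT x|M. h x) = 0"
    then have "AE x in M. h x = 0" using integral_nonneg_eq_0_iff_AE[OF h nn] by blast
    then have "AE x in M. False" using AE_space by eventually_elim (use pos in force)
    then show False using not_AE_False by blast
  qed
  moreover have "0 \<le> (LINT x|M. h x)" by (rule integral_nonneg_AE[OF nn])
  ultimately show ?thesis by simp
qed

text \<open>
  The part of admissibility that does not involve the Fisher information.
\<close>

definition regular_statistic :: "nat \<Rightarrow> (nat \<Rightarrow> real \<Rightarrow> real) \<Rightarrow> bool" where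
  "regular_statistic p T \<longleftrightarrow>
     (\<forall>j<p. T j \<in> borel_measurable M) \<and>
     (\<exists>e>0. \<forall>\<eta>. (\<forall>j<p. \<bar>\<eta> j\<bar> < e) \<longrightarrow> \<eta> \<in> natural_parameters \<Omega> g0 p T)"

lemma admissible_iff:
  "admissible \<Omega> g0 p T \<longleftrightarrow> regular_statistic p T \<and> invertible_on p (fisher_mu \<Omega> g0 p T (\<lambda>_. 0))"
  unfolding admissible_def regular_statistic_def by blast

lemma regular_measurable: "regular_statistic p T \<Longrightarrow> j < p \<Longrightarrow> T j \<in> borel_measurable M"
  by (simp add: regular_statistic_def)

lemma g0_measurable: "g0 \<in> borel_measurable M"
  by (rule measurable_continuous_on[OF g0_cont])

text \<open>
  If the family exists in a cube around \<open>0\<close>, exponential moments of \<open>\<bar>T i\<bar> + \<bar>T j\<bar>\<close> are bounded by sums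
  of moments along the coordinate axes.
\<close>

lemma regular_moments:
  assumes T: "regular_statistic p T"
  obtains d where "d > 0" "\<And>i j. i < p \<Longrightarrow> j < p \<Longrightarrow>
    integrable M (\<lambda>\<mu>. g0 \<mu> * exp (d * \<bar>T i \<mu>\<bar> + d * \<bar>T j \<mu>\<bar>))"
proof -
  obtain e where e: "e > 0"
    and nat: "\<And>\<eta>. (\<And>j. j < p \<Longrightarrow> \<bar>\<eta> j\<bar> < e) \<Longrightarrow> \<eta> \<in> natural_parameters \<Omega> g0 p T"
    using T unfolding regular_statistic_def by blast
  have one: "integrable M (\<lambda>\<mu>. g0 \<mu> * exp (s * T j \<mu>))" if "j < p" "\<bar>s\<bar> < e" for j s
  proof -
    have "(\<lambda>_. 0)(j := s) \<in> natural_parameters \<Omega> g0 p T" by (rule nat) (use that e in auto)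
    moreover have "(\<Sum>k<p. ((\<lambda>_. 0)(j := s)) k * T k \<mu>) = s * T j \<mu>" for \<mu>
    proof -
      have "(\<Sum>k<p. ((\<lambda>_. 0)(j := s)) k * T k \<mu>) = (\<Sum>k<p. if k = j then s * T j \<mu> else 0)"
        by (intro sum.cong) auto
      then show ?thesis using that by (simp add: sum.delta)
    qed
    ultimately show ?thesis by (simp add: natural_parameters_def)
  qed
  \<comment> \<open>the exponent \<open>d * (\<bar>y\<bar> + \<bar>z\<bar>)\<close> is at most \<open>2 * d * max \<bar>y\<bar> \<bar>z\<bar>\<close>, and \<open>2 * d\<close> has to stay below \<open>e\<close>\<close>
  define d where "d = e / 4"
  have d: "d > 0" "\<bar>2 * d\<bar> < e" "\<bar>- 2 * d\<bar> < e" using e by (auto simp: d_def)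
  have "integrable M (\<lambda>\<mu>. g0 \<mu> * exp (d * \<bar>T i \<mu>\<bar> + d * \<bar>T j \<mu>\<bar>))" if ij: "i < p" "j < p" for i j
  proof -
    let ?m = "\<lambda>\<mu>. (g0 \<mu> * exp ((2 * d) * T i \<mu>) + g0 \<mu> * exp ((- 2 * d) * T i \<mu>))
      + (g0 \<mu> * exp ((2 * d) * T j \<mu>) + g0 \<mu> * exp ((- 2 * d) * T j \<mu>))"
    note [measurable] = regular_measurable[OF T ij(1)] regular_measurable[OF T ij(2)] g0_measurable
    have "integrable M ?m"
      using ij d by (intro Bochner_Integration.integrable_add one)
    then show ?thesis
    proof (rule Bochner_Integration.integrable_bound)
      show "AE \<mu> in M. norm (g0 \<mu> * exp (d * \<bar>T i \<mu>\<bar> + d * \<bar>T j \<mu>\<bar>)) \<le> norm (?m \<mu>)"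
      proof (intro AE_I2)
        fix \<mu> assume "\<mu> \<in> space M"
        then have g: "0 < g0 \<mu>" by (simp add: g0_pos)
        have sq: "exp ((2 * d) * \<bar>y\<bar>) \<le> exp ((2 * d) * y) + exp ((- 2 * d) * y)" for y
          by (cases "y \<ge> 0") (auto simp: abs_if)
        have "exp (d * \<bar>y\<bar> + d * \<bar>z\<bar>) \<le> exp ((2 * d) * \<bar>y\<bar>) + exp ((2 * d) * \<bar>z\<bar>)" for y z
        proof (cases "\<bar>y\<bar> \<le> \<bar>z\<bar>")
          case True
          then have "d * \<bar>y\<bar> + d * \<bar>z\<bar> \<le> (2 * d) * \<bar>z\<bar>" using d(1) by simp
          then have "exp (d * \<bar>y\<bar> + d * \<bar>z\<bar>) \<le> exp ((2 * d) * \<bar>z\<bar>)" by simp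
          then show ?thesis by (rule order_trans) simp
        next
          case False
          then have "d * \<bar>y\<bar> + d * \<bar>z\<bar> \<le> (2 * d) * \<bar>y\<bar>" using d(1) by simp
          then have "exp (d * \<bar>y\<bar> + d * \<bar>z\<bar>) \<le> exp ((2 * d) * \<bar>y\<bar>)" by simp
          then show ?thesis by (rule order_trans) simp
        qed
        then have "exp (d * \<bar>T i \<mu>\<bar> + d * \<bar>T j \<mu>\<bar>)
            \<le> (exp ((2 * d) * T i \<mu>) + exp ((- 2 * d) * T i \<mu>))
              + (exp ((2 * d) * T j \<mu>) + exp ((- 2 * d) * T j \<mu>))"
          using sq[of "T i \<mu>"] sq[of "T j \<mu>"] by (meson add_mono order_trans)
        from mult_left_mono[OF this less_imp_le[OF g]]
        have "g0 \<mu> * exp (d * \<bar>T i \<mu>\<bar> + d * \<bar>T j \<mu>\<bar>) \<le> ?m \<mu>" by (simp only: distrib_left)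
        moreover have "0 \<le> g0 \<mu> * exp (d * \<bar>T i \<mu>\<bar> + d * \<bar>T j \<mu>\<bar>)" using g by simp
        ultimately show "norm (g0 \<mu> * exp (d * \<bar>T i \<mu>\<bar> + d * \<bar>T j \<mu>\<bar>)) \<le> norm (?m \<mu>)"
          unfolding real_norm_def by linarith
      qed
    qed measurable
  qed
  with d(1) show ?thesis by (rule that)
qed

lemma regular_mem:
  assumes T: "regular_statistic p T" and i: "i < p"
  shows "(\<lambda>\<mu>. root_g \<mu> * T i \<mu>) \<in> L2_space \<Omega>"
proof (rule L2_spaceI)
  note [measurable] = regular_measurable[OF T i] g0_measurable
  show "(\<lambda>\<mu>. root_g \<mu> * T i \<mu>) \<in> borel_measurable M" by measurable
  obtain d where d: "d > 0" and "\<And>i j. i < p \<Longrightarrow> j < p \<Longrightarrow>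
    integrable M (\<lambda>\<mu>. g0 \<mu> * exp (d * \<bar>T i \<mu>\<bar> + d * \<bar>T j \<mu>\<bar>))" by (rule regular_moments[OF T]) blast
  then have "integrable M (\<lambda>\<mu>. (1 / d\<^sup>2) * (g0 \<mu> * exp (d * \<bar>T i \<mu>\<bar> + d * \<bar>T i \<mu>\<bar>)))"
    using i by (intro integrable_mult_right) blast
  then show "integrable M (\<lambda>\<mu>. (root_g \<mu> * T i \<mu>)\<^sup>2)"
  proof (rule Bochner_Integration.integrable_bound)
    show "AE \<mu> in M. norm ((root_g \<mu> * T i \<mu>)\<^sup>2) \<le> norm ((1 / d\<^sup>2) * (g0 \<mu> * exp (d * \<bar>T i \<mu>\<bar> + d * \<bar>T i \<mu>\<bar>)))"
    proof (intro AE_I2)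
      fix \<mu> assume "\<mu> \<in> space M"
      then have g: "0 < g0 \<mu>" by (simp add: g0_pos)
      have "\<bar>T i \<mu>\<bar>\<^sup>2 \<le> (exp (d * \<bar>T i \<mu>\<bar>) / d)\<^sup>2"
        by (intro power_mono abs_le_exp_div d) simp
      then have "g0 \<mu> * (T i \<mu>)\<^sup>2 \<le> g0 \<mu> * (exp (d * \<bar>T i \<mu>\<bar>) / d)\<^sup>2"
        using g by (intro mult_left_mono) auto
      moreover have "(root_g \<mu> * T i \<mu>)\<^sup>2 = g0 \<mu> * (T i \<mu>)\<^sup>2"
        using g by (simp add: power_mult_distrib)
      moreover have "(1 / d\<^sup>2) * (g0 \<mu> * exp (d * \<bar>T i \<mu>\<bar> + d * \<bar>T i \<mu>\<bar>))
          = g0 \<mu> * (exp (d * \<bar>T i \<mu>\<bar>) / d)\<^sup>2"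
        unfolding exp_add power_divide by (simp add: power2_eq_square)
      ultimately show "norm ((root_g \<mu> * T i \<mu>)\<^sup>2) \<le> norm ((1 / d\<^sup>2) * (g0 \<mu> * exp (d * \<bar>T i \<mu>\<bar> + d * \<bar>T i \<mu>\<bar>)))"
        by (metis abs_ge_self order_trans real_norm_def abs_of_nonneg zero_le_power2)
    qed
  qed measurable
qed

lemma regular_integrable:
  assumes T: "regular_statistic p T" and i: "i < p"
  shows "integrable M (\<lambda>\<mu>. g0 \<mu> * T i \<mu>)"
proof -
  have "integrable M (\<lambda>\<mu>. root_g \<mu> * (root_g \<mu> * T i \<mu>)) = integrable M (\<lambda>\<mu>. g0 \<mu> * T i \<mu>)"
    by (intro Bochner_Integration.integrable_cong refl)
       (simp add: mult.assoc[symmetric] abs_of_pos g0_pos)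
  with root_g_mult_integrable[OF regular_mem[OF T i]] show ?thesis by blast
qed

lemma root_g_mult_mult:
  assumes "\<mu> \<in> \<Omega>"
  shows "root_g \<mu> * r * (root_g \<mu> * s) = g0 \<mu> * r * s"
proof -
  have "root_g \<mu> * r * (root_g \<mu> * s) = (root_g \<mu> * root_g \<mu>) * r * s"
    by (simp only: mult_ac)
  then show ?thesis by (simp only: root_g_square[OF assms])
qed

lemma inner_root_g_mult:
  "L2_inner \<Omega> (\<lambda>\<mu>. root_g \<mu> * s \<mu>) (\<lambda>\<mu>. root_g \<mu> * t \<mu>) = (LINT \<mu>|M. g0 \<mu> * s \<mu> * t \<mu>)"
  unfolding L2_inner_def
  by (intro Bochner_Integration.integral_cong refl root_g_mult_mult) simp

lemma mean_eq: "L2_inner \<Omega> root_g (\<lambda>\<mu>. root_g \<mu> * t \<mu>) = (LINT \<mu>|M. g0 \<mu> * t \<mu>)"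
  using inner_root_g_mult[of "\<lambda>_. 1" t] by simp

text \<open>
  The centred statistic times \<open>root_g\<close>: the mean is written as an inner product, which shows that the
  score is the component of \<open>root_g * t\<close> orthogonal to \<open>root_g\<close>.
\<close>

definition score :: "(real \<Rightarrow> real) \<Rightarrow> real \<Rightarrow> real" where
  "score t \<mu> = root_g \<mu> * t \<mu> - L2_inner \<Omega> root_g (\<lambda>\<nu>. root_g \<nu> * t \<nu>) * root_g \<mu>"

lemma score_mem:
  "regular_statistic p T \<Longrightarrow> i < p \<Longrightarrow> score (T i) \<in> L2_space \<Omega>"
  unfolding score_def by (intro L2.diff_mem regular_mem L2.scale_mem root_g_mem)

lemma score_orthogonal:
  assumes T: "regular_statistic p T" and i: "i < p"
  shows "ip root_g (score (T i)) = 0"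
  unfolding score_def
  by (simp add: L2.diff_right regular_mem[OF T i] L2.scale_mem L2.scale_right root_g_mem root_g_unit)

lemma form_root_g: "v \<in> L2_space \<Omega> \<Longrightarrow> B root_g v = ip root_g v"
  by (rule L2_inner_cong_AE) (auto simp: mem root_g_mem P_root_g intro!: AE_I2)

lemma score_inner:
  assumes T: "regular_statistic p T" and i: "i < p" and j: "j < p"
  shows "ip (score (T i)) (score (T j)) =
    (LINT \<mu>|M. g0 \<mu> * T i \<mu> * T j \<mu>) - (LINT \<mu>|M. g0 \<mu> * T i \<mu>) * (LINT \<mu>|M. g0 \<mu> * T j \<mu>)"
proof -
  let ?m = "\<lambda>i. ip root_g (\<lambda>\<nu>. root_g \<nu> * T i \<nu>)"
  note R = regular_mem[OF T]
  have "ip (score (T i)) (score (T j)) = ip (\<lambda>\<mu>. root_g \<mu> * T i \<mu>) (score (T j))"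
    unfolding score_def[of "T i"]
    by (simp add: L2.diff_left R i L2.scale_mem L2.scale_left root_g_mem score_mem[OF T j]
        score_orthogonal[OF T j])
  also have "\<dots> = ip (\<lambda>\<mu>. root_g \<mu> * T i \<mu>) (\<lambda>\<mu>. root_g \<mu> * T j \<mu>) - ?m j * ?m i"
    unfolding score_def
    by (simp add: L2.diff_right R i j L2.scale_mem L2.scale_right root_g_mem
        L2.sym[OF R[OF i] root_g_mem])
  finally show ?thesis by (simp add: inner_root_g_mult mean_eq)
qed

text \<open>
  Since the operator fixes \<open>root_g\<close>, centring has the same effect in the form of the operator as in the
  inner product.
\<close>

lemma score_form:
  assumes T: "regular_statistic p T" and i: "i < p" and j: "j < p"
  shows "B (score (T i)) (score (T j)) =
    (LINT x|M. inverse (f x) * push (\<lambda>\<mu>. g0 \<mu> * T i \<mu>) x * push (\<lambda>\<mu>. g0 \<mu> * T j \<mu>) x)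
      - (LINT \<mu>|M. g0 \<mu> * T i \<mu>) * (LINT \<mu>|M. g0 \<mu> * T j \<mu>)"
proof -
  let ?m = "\<lambda>i. ip root_g (\<lambda>\<nu>. root_g \<nu> * T i \<nu>)"
  note R = regular_mem[OF T]
  have "B (score (T i)) (score (T j)) = B (\<lambda>\<mu>. root_g \<mu> * T i \<mu>) (score (T j))"
    unfolding score_def[of "T i"]
    by (simp add: form.diff_left R i L2.scale_mem form.scale_left root_g_mem score_mem[OF T j]
        form_root_g score_orthogonal[OF T j])
  also have "\<dots> = B (\<lambda>\<mu>. root_g \<mu> * T i \<mu>) (\<lambda>\<mu>. root_g \<mu> * T j \<mu>) - ?m j * ?m i"
    unfolding score_def
    by (simp add: form.diff_right R i j L2.scale_mem form.scale_right root_g_mem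
        form.sym[OF R[OF i] root_g_mem] form_root_g)
  finally have 1: "B (score (T i)) (score (T j)) =
    B (\<lambda>\<mu>. root_g \<mu> * T i \<mu>) (\<lambda>\<mu>. root_g \<mu> * T j \<mu>) - ?m j * ?m i" .
  have push: "push (\<lambda>\<mu>. root_g \<mu> * (root_g \<mu> * t \<mu>)) x = push (\<lambda>\<mu>. g0 \<mu> * t \<mu>) x" for t x
    unfolding push_def
    by (intro Bochner_Integration.integral_cong refl)
       (simp add: mult.assoc[symmetric] abs_of_pos g0_pos)
  show ?thesis unfolding 1 P_form[OF R[OF i] R[OF j]] by (simp add: push mean_eq)
qed

lemma exp_family_0: "\<mu> \<in> \<Omega> \<Longrightarrow> exp_family \<Omega> g0 p T (\<lambda>_. 0) \<mu> = g0 \<mu>"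
  by (simp add: exp_family_def log_partition_def g0_density)

lemma log_partition_mixed_derivative:
  assumes T: "regular_statistic p T" and i: "i < p" and j: "j < p"
  shows "has_mixed_derivative (log_partition \<Omega> g0 p T) i j (ip (score (T i)) (score (T j)))"
proof -
  obtain d where d: "d > 0" "\<And>i j. i < p \<Longrightarrow> j < p \<Longrightarrow>
    integrable M (\<lambda>\<mu>. g0 \<mu> * exp (d * \<bar>T i \<mu>\<bar> + d * \<bar>T j \<mu>\<bar>))" by (rule regular_moments[OF T]) blast
  have "log_partition \<Omega> g0 p T = log_mgf M g0 p T"
    by (simp add: fun_eq_iff log_partition_def log_mgf_def)
  moreover have "has_mixed_derivative (log_mgf M g0 p T) i j
     (((LINT x|M. g0 x * T j x * T i x) * (LINT x|M. g0 x) -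
       (LINT x|M. g0 x * T j x) * (LINT x|M. g0 x * T i x)) / (LINT x|M. g0 x)\<^sup>2)"
    by (rule log_mgf_mixed_derivative[OF d(1) i j])
       (use T i j d(2) in \<open>auto simp: g0_measurable regular_measurable g0_density intro: less_imp_le[OF g0_pos]\<close>)
  ultimately show ?thesis by (simp add: score_inner[OF T i j] g0_density mult_ac)
qed

text \<open>
  The logarithm of the density is affine in the parameter except for the log-partition function, so its
  Hessian is minus a covariance, independent of \<open>\<mu>\<close>.
\<close>

lemma fisher_mu_eq_inner:
  assumes T: "regular_statistic p T" and i: "i < p" and j: "j < p"
  shows "fisher_mu \<Omega> g0 p T (\<lambda>_. 0) i j = ip (score (T i)) (score (T j))"
proof -
  let ?C = "ip (score (T i)) (score (T j))"
  have "hessian (\<lambda>\<theta>. ln (exp_family \<Omega> g0 p T \<theta> \<mu>)) (\<lambda>_. 0) i j = - ?C" if \<mu>: "\<mu> \<in> \<Omega>" for \<mu>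
  proof -
    have "ln (exp_family \<Omega> g0 p T \<theta> \<mu>) =
        (ln (g0 \<mu>) + (\<Sum>k<p. \<theta> k * T k \<mu>)) - log_partition \<Omega> g0 p T \<theta>" for \<theta>
      using g0_pos[OF \<mu>] by (simp add: exp_family_def ln_mult)
    moreover have "has_mixed_derivative (\<lambda>\<theta>. (ln (g0 \<mu>) + (\<Sum>k<p. \<theta> k * T k \<mu>)) - log_partition \<Omega> g0 p T \<theta>) i j (0 - ?C)"
      by (intro has_mixed_derivative_diff has_mixed_derivative_affine log_partition_mixed_derivative T i j)
    ultimately have "has_mixed_derivative (\<lambda>\<theta>. ln (exp_family \<Omega> g0 p T \<theta> \<mu>)) i j (0 - ?C)" by simp
    from hessian_eq_mixed_derivative[OF this] show ?thesis by simp
  qed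
  then have "fisher_mu \<Omega> g0 p T (\<lambda>_. 0) i j = - (LINT \<mu>|M. - ?C * g0 \<mu>)"
    unfolding fisher_mu_def
    by (intro arg_cong[where f = uminus] Bochner_Integration.integral_cong) (auto simp: exp_family_0)
  then show ?thesis by (simp add: g0_density)
qed

lemma marginal_exp_family:
  "marginal \<Omega> K (exp_family \<Omega> g0 p T \<theta>) x =
     (LINT \<mu>|M. K \<mu> x * g0 \<mu> * exp (\<Sum>k<p. \<theta> k * T k \<mu>)) * exp (- log_partition \<Omega> g0 p T \<theta>)"
  unfolding marginal_def exp_family_def integral_mult_left_zero[symmetric]
  by (simp add: exp_diff exp_minus field_simps)

text \<open>
  The Hessian of the log-marginal at \<open>x\<close> is a conditional covariance given \<open>X = x\<close> minus the covariance.
  By the law of total covariance its expectation is minus the covariance of the posterior means.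
\<close>

lemma fisher_X_eq_form:
  assumes T: "regular_statistic p T" and i: "i < p" and j: "j < p"
  shows "fisher_X \<Omega> K g0 p T (\<lambda>_. 0) i j = B (score (T i)) (score (T j))"
proof -
  obtain d where d: "d > 0" "\<And>i j. i < p \<Longrightarrow> j < p \<Longrightarrow>
    integrable M (\<lambda>\<mu>. g0 \<mu> * exp (d * \<bar>T i \<mu>\<bar> + d * \<bar>T j \<mu>\<bar>))" by (rule regular_moments[OF T]) blast
  obtain e where e: "e > 0"
    and nat: "\<And>\<eta>. (\<And>j. j < p \<Longrightarrow> \<bar>\<eta> j\<bar> < e) \<Longrightarrow> \<eta> \<in> natural_parameters \<Omega> g0 p T"
    using T unfolding regular_statistic_def by blast
  let ?C = "ip (score (T i)) (score (T j))"
  let ?h = "\<lambda>\<mu>. g0 \<mu> * T j \<mu> * T i \<mu>"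
  let ?q = "\<lambda>i. push (\<lambda>\<mu>. g0 \<mu> * T i \<mu>)"
  \<comment> \<open>the conditional covariance given \<open>X = x\<close>\<close>
  let ?Cx = "\<lambda>x. (push ?h x * f x - ?q j x * ?q i x) / (f x)\<^sup>2"
  have hi: "integrable M ?h"
  proof -
    have "integrable M (\<lambda>\<mu>. (root_g \<mu> * T j \<mu>) * (root_g \<mu> * T i \<mu>)) = integrable M ?h"
      by (intro Bochner_Integration.integrable_cong refl root_g_mult_mult) simp
    with L2_product_integrable[OF regular_mem[OF T j] regular_mem[OF T i]] show ?thesis by blast
  qed
  have hess: "hessian (\<lambda>\<theta>. ln (marginal \<Omega> K (exp_family \<Omega> g0 p T \<theta>) x)) (\<lambda>_. 0) i j = ?Cx x - ?C"
    if x: "x \<in> \<Omega>" for x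
  proof -
    have kx [measurable]: "(\<lambda>\<mu>. K \<mu> x) \<in> borel_measurable M"
      by (intro measurable_continuous_on K_cont_left x)
    have w: "LINT \<mu>|M. K \<mu> x * g0 \<mu> = f x" "(LINT \<mu>|M. K \<mu> x * g0 \<mu> * t \<mu>) = push (\<lambda>\<mu>. g0 \<mu> * t \<mu>) x"
      "(LINT \<mu>|M. K \<mu> x * g0 \<mu> * t \<mu> * t' \<mu>) = push (\<lambda>\<mu>. g0 \<mu> * t \<mu> * t' \<mu>) x" for t t'
      by (simp_all add: marginal_def push_def mult.assoc)
    have "has_mixed_derivative (log_mgf M (\<lambda>\<mu>. K \<mu> x * g0 \<mu>) p T) i j (?Cx x)"
      unfolding w[symmetric]
    proof (rule log_mgf_mixed_derivative[OF d(1) i j])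
      show "integrable M (\<lambda>\<mu>. K \<mu> x * g0 \<mu> * exp (d * \<bar>T i \<mu>\<bar> + d * \<bar>T j \<mu>\<bar>))"
        using push_integrand[OF d(2)[OF i j] x] by (simp add: mult.assoc)
      show "(\<lambda>\<mu>. K \<mu> x * g0 \<mu>) \<in> borel_measurable M"
        using g0_measurable by measurable
      show "0 \<le> K \<mu> x * g0 \<mu>" if "\<mu> \<in> space M" for \<mu>
        using that x by (simp add: K_pos g0_pos less_imp_le)
      show "0 < (LINT \<mu>|M. K \<mu> x * g0 \<mu>)" using f_pos[OF x] by (simp add: marginal_def)
    qed (use T i j in \<open>auto simp: regular_measurable\<close>)
    then have "has_mixed_derivative (\<lambda>\<theta>. log_mgf M (\<lambda>\<mu>. K \<mu> x * g0 \<mu>) p T \<theta> - log_partition \<Omega> g0 p T \<theta>)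
        i j (?Cx x - ?C)"
      by (intro has_mixed_derivative_diff log_partition_mixed_derivative T i j)
    then have "has_mixed_derivative (\<lambda>\<theta>. ln (marginal \<Omega> K (exp_family \<Omega> g0 p T \<theta>) x)) i j (?Cx x - ?C)"
    proof (rule has_mixed_derivative_cong[OF _ e])
      fix \<theta> :: "nat \<Rightarrow> real" assume "\<And>k. \<bar>\<theta> k\<bar> < e"
      then have "integrable M (\<lambda>\<mu>. g0 \<mu> * exp (\<Sum>k<p. \<theta> k * T k \<mu>))"
        using nat[of \<theta>] by (simp add: natural_parameters_def)
      from push_integrand[OF this x]
      have "0 < (LINT \<mu>|M. K \<mu> x * (g0 \<mu> * exp (\<Sum>k<p. \<theta> k * T k \<mu>)))"
        by (rule integral_pos) (simp add: K_pos g0_pos x)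
      then show "ln (marginal \<Omega> K (exp_family \<Omega> g0 p T \<theta>) x) =
          log_mgf M (\<lambda>\<mu>. K \<mu> x * g0 \<mu>) p T \<theta> - log_partition \<Omega> g0 p T \<theta>"
        unfolding marginal_exp_family log_mgf_def by (subst ln_mult) (simp_all add: mult.assoc)
    qed
    then show ?thesis by (rule hessian_eq_mixed_derivative)
  qed
  have f0: "marginal \<Omega> K (exp_family \<Omega> g0 p T (\<lambda>_. 0)) x = f x" for x
    unfolding marginal_def by (intro Bochner_Integration.integral_cong) (auto simp: exp_family_0)
  let ?r = "\<lambda>x. inverse (f x) * ?q i x * ?q j x"
  have i1: "integrable M (push ?h)"
  proof -
    obtain c where "\<And>x. x \<in> \<Omega> \<Longrightarrow> \<bar>push ?h x\<bar> \<le> c" by (rule push_bounded[OF hi]) blast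
    then show ?thesis
      by (rule integrable_bounded[OF push_measurable[OF borel_measurable_integrable[OF hi]]])
  qed
  have i2: "integrable M ?r"
  proof -
    note ti = regular_integrable[OF T i] and tj = regular_integrable[OF T j]
    obtain c where c: "\<And>x. x \<in> \<Omega> \<Longrightarrow> \<bar>posterior (\<lambda>\<mu>. g0 \<mu> * T i \<mu>) x\<bar> \<le> c"
      by (rule posterior_bounded[OF ti]) blast
    obtain c' where c': "\<And>x. x \<in> \<Omega> \<Longrightarrow> \<bar>?q j x\<bar> \<le> c'" by (rule push_bounded[OF tj]) blast
    have "integrable M (\<lambda>x. posterior (\<lambda>\<mu>. g0 \<mu> * T i \<mu>) x * ?q j x)"
    proof (rule integrable_bounded)
      show "(\<lambda>x. posterior (\<lambda>\<mu>. g0 \<mu> * T i \<mu>) x * ?q j x) \<in> borel_measurable M"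
        by (intro borel_measurable_times posterior_measurable push_measurable
            borel_measurable_integrable ti tj)
      show "\<bar>posterior (\<lambda>\<mu>. g0 \<mu> * T i \<mu>) x * ?q j x\<bar> \<le> c * c'" if x: "x \<in> \<Omega>" for x
        unfolding abs_mult using c[OF x] c'[OF x] by (intro mult_mono) auto
    qed
    then show ?thesis by (simp add: posterior_def)
  qed
  have i3: "integrable M f" "(LINT x|M. f x) = 1"
  proof -
    obtain c where "\<And>x. x \<in> \<Omega> \<Longrightarrow> \<bar>f x\<bar> \<le> c"
      unfolding f_push by (rule push_bounded[OF g0_integrable]) blast
    then show "integrable M f" by (rule integrable_bounded[OF f_measurable])
    show "(LINT x|M. f x) = 1" unfolding f_push by (simp add: push_integral g0_integrable g0_density)
  qed
  have "fisher_X \<Omega> K g0 p T (\<lambda>_. 0) i j = - (LINT x|M. (?Cx x - ?C) * f x)"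
    unfolding fisher_X_def f0
    by (intro arg_cong[where f = uminus] Bochner_Integration.integral_cong) (auto simp: hess)
  also have "(LINT x|M. (?Cx x - ?C) * f x) = (LINT x|M. push ?h x - ?r x - ?C * f x)"
  proof (intro Bochner_Integration.integral_cong refl)
    fix x assume "x \<in> space M"
    then have "f x \<noteq> 0" using f_pos[of x] by simp
    then show "(?Cx x - ?C) * f x = push ?h x - ?r x - ?C * f x"
      by (simp add: field_simps power2_eq_square)
  qed
  also have "\<dots> = (LINT \<mu>|M. ?h \<mu>) - (LINT x|M. ?r x) - ?C"
    using i1 i2 i3 by (simp add: push_integral hi)
  finally show ?thesis
    unfolding score_form[OF T i j] score_inner[OF T i j] by (simp add: mult_ac)
qed

lemma quad_form_fisher:
  assumes T: "regular_statistic p T"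
  defines "U c \<equiv> \<lambda>\<mu>. \<Sum>i<p. c i * score (T i) \<mu>"
  shows "quad_form p (fisher_mu \<Omega> g0 p T (\<lambda>_. 0)) c = ip (U c) (U c)"
    and "quad_form p (fisher_X \<Omega> K g0 p T (\<lambda>_. 0)) c = B (U c) (U c)"
  unfolding U_def quad_form_def
  by (subst L2.sum_sum form.sum_sum;
      auto simp: score_mem[OF T] fisher_mu_eq_inner[OF T] fisher_X_eq_form[OF T] intro!: sum.cong)+

section \<open>Continuous eigenfunctions of the model operator\<close>

text \<open>
  Among the \<open>n + 1\<close> monomials of degree at most \<open>n\<close> some nontrivial combination is orthogonal to \<open>n\<close>
  given functions; a nonzero polynomial vanishes at finitely many points only and has positive norm.
\<close>

lemma exists_continuous_perp:
  assumes z: "\<And>k. k < n \<Longrightarrow> z k \<in> L2_space \<Omega>"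
  shows "\<exists>h\<in>perp \<Omega> z n. continuous_on \<Omega> h \<and> ip h h = 1"
proof -
  have m: "(\<lambda>x. x ^ i) \<in> L2_space \<Omega>" for i
    by (intro continuous_mem_L2 continuous_intros)
  obtain c where c: "\<exists>i\<in>{..n}. c i \<noteq> 0"
    and eq: "\<forall>k\<in>{..<n}. (\<Sum>i\<in>{..n}. ip (z k) (\<lambda>x. x ^ i) * c i) = 0"
    using underdetermined_system[of "{..<n}" "{..n}" "\<lambda>k i. ip (z k) (\<lambda>x. x ^ i)"] by auto
  define h where "h = (\<lambda>x :: real. \<Sum>i\<le>n. c i * x ^ i)"
  have h: "h \<in> L2_space \<Omega>" unfolding h_def by (intro L2.sum_mem m) simp
  have cont: "continuous_on \<Omega> h" unfolding h_def by (intro continuous_intros)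
  have perp: "ip (z k) h = 0" if "k < n" for k
    using eq that unfolding h_def by (simp add: L2.sum_right m z mult.commute)
  have "ip h h \<noteq> 0"
  proof
    assume "ip h h = 0"
    then have "AE x in M. h x = 0" by (rule L2_inner_null_AE[OF h])
    moreover have "finite {x. h x = 0}"
      unfolding h_def using c polyfun_finite_roots[of c n] by auto
    then have "AE x in M. h x \<noteq> 0"
      using finite_imp_null_set_lborel[of "{x. h x = 0}"]
      by (subst AE_restrict_space_iff) (auto simp: \<Omega>_def intro!: AE_I'[of "{x. h x = 0}"])
    ultimately have "AE x in M. False" by eventually_elim simp
    then show False using not_AE_False by blast
  qed
  then have pos: "ip h h > 0" using L2.psd[OF h] by simp
  define t where "t = 1 / sqrt (ip h h)"
  have "t * (t * ip h h) = 1" unfolding t_def using pos by simp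
  then show ?thesis
    by (intro bexI[of _ "\<lambda>x. t * h x"] conjI)
       (auto simp: perp_def L2.scale_mem L2.scale_left L2.scale_right h z perp
         intro!: continuous_intros cont)
qed

lemma spectral_decomposition_P:
  "\<exists>ev \<zeta>. spectral_decomposition \<Omega> P ev \<zeta> \<and> ev 0 = 1 \<and> \<zeta> 0 = root_g \<and> (\<forall>k. continuous_on \<Omega> (\<zeta> k))"
  by (intro spectral_decomposition_exists P_compact P_continuous exists_continuous_perp
      root_g_mem root_g_cont root_g_unit AE_I2) (simp_all add: P_root_g)

section \<open>The relative efficiency coefficient as a least Rayleigh quotient\<close>

definition direction :: "nat \<Rightarrow> (nat \<Rightarrow> real \<Rightarrow> real) \<Rightarrow> (nat \<Rightarrow> real) \<Rightarrow> real \<Rightarrow> real" where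
  "direction p T c \<mu> = (\<Sum>i<p. c i * score (T i) \<mu>)"

lemma direction_mem: "regular_statistic p T \<Longrightarrow> direction p T c \<in> L2_space \<Omega>"
  unfolding direction_def[abs_def] by (intro L2.sum_mem score_mem) auto

text \<open>
  The quadratic forms of the two Fisher informations at \<open>c\<close> are the form of the operator and the inner
  product at the combination of scores with coefficients \<open>c\<close>.
\<close>

lemma rho_eq:
  assumes T: "regular_statistic p T"
  shows "rho \<Omega> K g0 p T (\<lambda>_. 0) =
    Inf {B (direction p T c) (direction p T c) / ip (direction p T c) (direction p T c) | c. \<exists>i<p. c i \<noteq> 0}"
  unfolding rho_def quad_form_fisher[OF T] direction_def[abs_def] ..

lemma rho_le:
  assumes T: "regular_statistic p T" and c: "\<exists>i<p. c i \<noteq> 0"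
  shows "rho \<Omega> K g0 p T (\<lambda>_. 0) \<le> B (direction p T c) (direction p T c) / ip (direction p T c) (direction p T c)"
  unfolding rho_eq[OF T]
proof (rule cInf_lower)
  show "bdd_below {B (direction p T c) (direction p T c) / ip (direction p T c) (direction p T c) | c. \<exists>i<p. c i \<noteq> 0}"
    by (rule bdd_belowI[of _ 0]) (auto intro!: divide_nonneg_nonneg nonneg L2.psd direction_mem T)
qed (use c in blast)

lemma rho_ge:
  assumes T: "regular_statistic p T" and p: "p \<ge> 1"
    and r: "\<And>c. \<exists>i<p. c i \<noteq> 0 \<Longrightarrow>
      r \<le> B (direction p T c) (direction p T c) / ip (direction p T c) (direction p T c)"
  shows "r \<le> rho \<Omega> K g0 p T (\<lambda>_. 0)"
  unfolding rho_eq[OF T]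
proof (rule cInf_greatest)
  let ?R = "\<lambda>c. B (direction p T c) (direction p T c) / ip (direction p T c) (direction p T c)"
  have "?R (\<lambda>_. 1) \<in> {?R c | c. \<exists>i<p. c i \<noteq> 0}"
    by (intro CollectI exI[of _ "\<lambda>_. 1"] conjI refl) (use p in \<open>auto intro: exI[of _ 0]\<close>)
  then show "{?R c | c. \<exists>i<p. c i \<noteq> 0} \<noteq> {}" by (metis empty_iff)
qed (use r in blast)

text \<open>
  A positive semidefinite matrix that is invertible is definite: a null vector of its quadratic form is
  in its kernel.
\<close>

lemma direction_pos:
  assumes T: "admissible \<Omega> g0 p T" and c: "\<exists>i<p. c i \<noteq> 0"
  shows "0 < ip (direction p T c) (direction p T c)"
proof -
  have R: "regular_statistic p T" using T by (simp add: admissible_iff)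
  have "invertible_on p (fisher_mu \<Omega> g0 p T (\<lambda>_. 0))" using T by (simp add: admissible_iff)
  then obtain G where G: "\<And>k i. k < p \<Longrightarrow> i < p \<Longrightarrow>
      (\<Sum>l<p. G k l * fisher_mu \<Omega> g0 p T (\<lambda>_. 0) l i) = (if k = i then 1 else 0)"
    unfolding invertible_on_def by blast
  have "ip (direction p T c) (direction p T c) \<noteq> 0"
  proof
    assume 0: "ip (direction p T c) (direction p T c) = 0"
    have "(\<Sum>i<p. fisher_mu \<Omega> g0 p T (\<lambda>_. 0) l i * c i) = 0" if l: "l < p" for l
    proof -
      have "ip (direction p T c) (score (T l)) = 0"
        by (rule L2.null_left[OF direction_mem[OF R] score_mem[OF R l] 0])
      then have "ip (score (T l)) (direction p T c) = 0"
        using L2.sym[OF direction_mem[OF R] score_mem[OF R l]] by simp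
      then have "(\<Sum>i<p. c i * ip (score (T l)) (score (T i))) = 0"
        unfolding direction_def[abs_def] by (subst (asm) L2.sum_right) (auto simp: score_mem[OF R] l)
      then show ?thesis by (simp add: fisher_mu_eq_inner[OF R l] mult.commute)
    qed
    then have zero: "mat_mul p (fisher_mu \<Omega> g0 p T (\<lambda>_. 0)) (\<lambda>i _. c i) l 0 = 0" if "l < p" for l
      using that by (simp add: mat_mul_def)
    have inv: "inverse_mats p G (fisher_mu \<Omega> g0 p T (\<lambda>_. 0))"
      using G by (simp add: inverse_mats_def mat_mul_def)
    have "c k = 0" if k: "k < p" for k
    proof -
      have "c k = mat_mul p (mat_mul p G (fisher_mu \<Omega> g0 p T (\<lambda>_. 0))) (\<lambda>i _. c i) k 0"
        using inverse_mats_cancel[OF inv k] by simp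
      also have "\<dots> = 0" unfolding mat_mul_assoc unfolding mat_mul_def[of p G] by (simp add: zero)
      finally show ?thesis .
    qed
    then show False using c by blast
  qed
  then show ?thesis using L2.psd[OF direction_mem[OF R]] by (simp add: less_le)
qed

text \<open>
  Scores are orthogonal to \<open>root_g\<close>, hence to \<open>z 0\<close>; the other \<open>p - 1\<close> conditions on \<open>p\<close> coefficients
  have a nontrivial solution.
\<close>

lemma exists_direction_perp:
  assumes T: "regular_statistic p T" and p: "p \<ge> 1"
    and z: "\<And>k. z k \<in> L2_space \<Omega>" and z0: "AE \<mu> in M. z 0 \<mu> = s * root_g \<mu>"
  obtains c where "\<exists>i<p. c i \<noteq> 0" "direction p T c \<in> perp \<Omega> z p"
proof -
  obtain c where c: "\<exists>i\<in>{..<p}. c i \<noteq> 0"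
    and eq: "\<forall>k\<in>{1..<p}. (\<Sum>i\<in>{..<p}. ip (z k) (score (T i)) * c i) = 0"
    using underdetermined_system[of "{1..<p}" "{..<p}" "\<lambda>k i. ip (z k) (score (T i))"] p by auto
  have ipd: "ip v (direction p T c) = (\<Sum>i<p. c i * ip v (score (T i)))" if "v \<in> L2_space \<Omega>" for v
    unfolding direction_def[abs_def] by (rule L2.sum_right) (auto simp: score_mem[OF T] that)
  have "ip (z k) (direction p T c) = 0" if "k < p" for k
  proof (cases "k = 0")
    case True
    have "ip (z 0) (direction p T c) = ip (\<lambda>\<mu>. s * root_g \<mu>) (direction p T c)"
      by (intro L2_inner_cong_AE z L2.scale_mem root_g_mem direction_mem T z0) simp
    also have "\<dots> = 0"
      by (simp add: L2.scale_left root_g_mem direction_mem T ipd score_orthogonal[OF T])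
    finally show ?thesis by (simp add: True)
  next
    case False
    then show ?thesis using eq that by (simp add: ipd z mult.commute)
  qed
  then show ?thesis using that[of c] c by (auto simp: perp_def direction_mem T)
qed

text \<open>
  The scalar \<open>s\<close> leaves the sign of the first eigenfunction free, as a spectral decomposition fixes it
  only up to sign.
\<close>

lemma rho_le_eigenvalue:
  assumes sd: "spectral_decomposition \<Omega> P ev z" and z0: "AE \<mu> in M. z 0 \<mu> = s * root_g \<mu>"
    and T: "admissible \<Omega> g0 p T" and p: "p \<ge> 1"
  shows "rho \<Omega> K g0 p T (\<lambda>_. 0) \<le> ev p"
proof -
  have R: "regular_statistic p T" using T by (simp add: admissible_iff)
  obtain c where c: "\<exists>i<p. c i \<noteq> 0" "direction p T c \<in> perp \<Omega> z p"
    by (rule exists_direction_perp[where z = z, OF R p eigenfunction_mem[OF sd] z0])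
  have "rho \<Omega> K g0 p T (\<lambda>_. 0) \<le> B (direction p T c) (direction p T c) / ip (direction p T c) (direction p T c)"
    by (rule rho_le[OF R c(1)])
  also have "\<dots> \<le> ev p"
    using form_le_on_perp[OF sd c(2)] direction_pos[OF T c(1)] by (simp add: divide_le_eq)
  finally show ?thesis .
qed

context
  fixes ev z s
  assumes sd: "spectral_decomposition \<Omega> P ev z" and z0: "AE \<mu> in M. z 0 \<mu> = s * root_g \<mu>"
begin

lemma eigen_statistic_measurable: "eigen_statistic g0 z j \<in> borel_measurable M"
proof -
  note [measurable] = L2_measurable[OF eigenfunction_mem[OF sd]] g0_measurable
  show ?thesis unfolding eigen_statistic_def[abs_def] by measurable
qed

lemma root_g_eigen_statistic: "\<mu> \<in> \<Omega> \<Longrightarrow> root_g \<mu> * eigen_statistic g0 z j \<mu> = z (Suc j) \<mu>"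
  using g0_pos[of \<mu>] by (simp add: eigen_statistic_def)

text \<open>
  Eigenfunctions with positive eigenvalue agree almost everywhere with a multiple of their continuous
  image under the operator, so they are essentially bounded, and so are the statistics.
\<close>

lemma natural_parameters_eigen_statistic:
  assumes pos: "ev p > 0"
  shows "natural_parameters \<Omega> g0 p (eigen_statistic g0 z) = UNIV"
proof -
  obtain gmin gmax where g: "gmin > 0" "\<And>\<mu>. \<mu> \<in> \<Omega> \<Longrightarrow> gmin \<le> g0 \<mu>" "\<And>\<mu>. \<mu> \<in> \<Omega> \<Longrightarrow> g0 \<mu> \<le> gmax"
    by (rule g0_bounds) blast
  have "\<exists>C. AE \<mu> in M. \<bar>eigen_statistic g0 z j \<mu>\<bar> \<le> C" if j: "j < p" for j
  proof -
    have evj: "ev (Suc j) > 0"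
      using sd pos j decseqD[of ev "Suc j" p] by (simp add: spectral_decomposition_def)
    have "continuous_on \<Omega> (P (z (Suc j)))" by (intro P_continuous eigenfunction_mem[OF sd])
    then have "compact (P (z (Suc j)) ` \<Omega>)" by (intro compact_continuous_image) (simp_all add: \<Omega>_def)
    then obtain C where C: "\<forall>x\<in>P (z (Suc j)) ` \<Omega>. norm x \<le> C"
      using compact_imp_bounded bounded_iff by blast
    have "AE \<mu> in M. \<bar>eigen_statistic g0 z j \<mu>\<bar> \<le> 1 / sqrt gmin * (C / ev (Suc j))"
      using eigenfunction_AE[OF sd, of "Suc j"] AE_space
    proof eventually_elim
      case (elim \<mu>)
      then have \<mu>: "\<mu> \<in> \<Omega>" by simp
      have "ev (Suc j) * \<bar>z (Suc j) \<mu>\<bar> \<le> C"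
        using C \<mu> elim(1) evj by (auto simp: abs_mult)
      then have "\<bar>z (Suc j) \<mu>\<bar> \<le> C / ev (Suc j)" using evj by (simp add: field_simps)
      moreover have "\<bar>1 / root_g \<mu>\<bar> \<le> 1 / sqrt gmin"
        using g(1) g(2)[OF \<mu>] by (auto intro!: divide_left_mono)
      ultimately show ?case
        unfolding eigen_statistic_def abs_mult using g(1) by (intro mult_mono) auto
    qed
    then show ?thesis by blast
  qed
  then obtain C where C: "\<And>j. j < p \<Longrightarrow> AE \<mu> in M. \<bar>eigen_statistic g0 z j \<mu>\<bar> \<le> C j" by metis
  have "integrable M (\<lambda>\<mu>. g0 \<mu> * exp (\<Sum>j<p. \<eta> j * eigen_statistic g0 z j \<mu>))" for \<eta>
  proof (rule integrable_const_bound)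
    have "AE \<mu> in M. \<forall>j\<in>{..<p}. \<bar>eigen_statistic g0 z j \<mu>\<bar> \<le> C j"
      by (rule AE_finite_allI) (use C in auto)
    then show "AE \<mu> in M. norm (g0 \<mu> * exp (\<Sum>j<p. \<eta> j * eigen_statistic g0 z j \<mu>))
        \<le> gmax * exp (\<Sum>j<p. \<bar>\<eta> j\<bar> * C j)"
      using AE_space
    proof eventually_elim
      case (elim \<mu>)
      then have \<mu>: "\<mu> \<in> \<Omega>" by simp
      have "(\<Sum>j<p. \<eta> j * eigen_statistic g0 z j \<mu>) \<le> (\<Sum>j<p. \<bar>\<eta> j\<bar> * C j)"
      proof (rule sum_mono)
        fix j assume j: "j \<in> {..<p}"
        have "\<eta> j * eigen_statistic g0 z j \<mu> \<le> \<bar>\<eta> j\<bar> * \<bar>eigen_statistic g0 z j \<mu>\<bar>"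
          using abs_ge_self[of "\<eta> j * eigen_statistic g0 z j \<mu>"] by (simp add: abs_mult)
        also have "\<dots> \<le> \<bar>\<eta> j\<bar> * C j" using elim j by (intro mult_left_mono) auto
        finally show "\<eta> j * eigen_statistic g0 z j \<mu> \<le> \<bar>\<eta> j\<bar> * C j" .
      qed
      then show ?case
        using g(3)[OF \<mu>] g0_pos[OF \<mu>] by (simp add: abs_mult mult_mono)
    qed
  qed (use eigen_statistic_measurable g0_measurable in measurable)
  then show ?thesis by (auto simp: natural_parameters_def)
qed

context
  fixes p assumes nat: "natural_parameters \<Omega> g0 p (eigen_statistic g0 z) = UNIV"
begin

lemma eigen_statistic_regular: "regular_statistic p (eigen_statistic g0 z)"
  unfolding regular_statistic_def using eigen_statistic_measurable nat zero_less_one by blast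

lemma eigen_score:
  assumes j: "j < p"
  shows "AE \<mu> in M. score (eigen_statistic g0 z j) \<mu> = z (Suc j) \<mu>"
proof -
  note zm = eigenfunction_mem[OF sd] and on = eigenfunctions_orthonormal[OF sd]
  have eq: "AE \<mu> in M. root_g \<mu> * eigen_statistic g0 z j \<mu> = z (Suc j) \<mu>"
    by (intro AE_I2 root_g_eigen_statistic) simp
  have sz: "ip (z 0) v = s * ip root_g v" if "v \<in> L2_space \<Omega>" for v
    using L2_inner_cong_AE[OF zm L2.scale_mem[OF root_g_mem] that that z0]
    by (simp add: L2.scale_left root_g_mem that)
  have "s \<noteq> 0" using sz[OF zm, of 0] on[of 0 0] by auto
  then have "ip root_g (z (Suc j)) = 0" using sz[OF zm, of "Suc j"] on[of 0 "Suc j"] by simp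
  moreover have "ip root_g (\<lambda>\<mu>. root_g \<mu> * eigen_statistic g0 z j \<mu>) = ip root_g (z (Suc j))"
    by (intro L2_inner_cong_AE root_g_mem regular_mem[OF eigen_statistic_regular j] zm eq) simp
  ultimately show ?thesis unfolding score_def using eq by simp
qed

lemma eigen_score_inner:
  assumes i: "i < p" and j: "j < p"
  shows "ip (score (eigen_statistic g0 z i)) (score (eigen_statistic g0 z j)) = (if i = j then 1 else 0)"
    and "B (score (eigen_statistic g0 z i)) (score (eigen_statistic g0 z j)) = (if i = j then ev (Suc i) else 0)"
proof -
  note R = score_mem[OF eigen_statistic_regular] and zm = eigenfunction_mem[OF sd]
    and on = eigenfunctions_orthonormal[OF sd]
  have "ip (score (eigen_statistic g0 z i)) (score (eigen_statistic g0 z j)) = ip (z (Suc i)) (z (Suc j))"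
    by (intro L2_inner_cong_AE R zm eigen_score i j)
  then show "ip (score (eigen_statistic g0 z i)) (score (eigen_statistic g0 z j)) = (if i = j then 1 else 0)"
    by (simp add: on)
  have "B (score (eigen_statistic g0 z i)) (score (eigen_statistic g0 z j)) = B (z (Suc i)) (z (Suc j))"
    by (intro L2_inner_cong_AE mem R zm cong_AE eigen_score i j)
  then show "B (score (eigen_statistic g0 z i)) (score (eigen_statistic g0 z j)) = (if i = j then ev (Suc i) else 0)"
    by (simp add: form_eigenfunction[OF sd zm] on)
qed

lemma eigen_statistic_admissible: "admissible \<Omega> g0 p (eigen_statistic g0 z)"
proof -
  have "inverse_mats p (fisher_mu \<Omega> g0 p (eigen_statistic g0 z) (\<lambda>_. 0)) (\<lambda>i j. if i = j then 1 else 0)"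
    unfolding inverse_mats_def mat_mul_def
    by (auto simp: fisher_mu_eq_inner[OF eigen_statistic_regular] eigen_score_inner(1)
        if_distrib[of "\<lambda>x. _ * x"] cong: if_cong)
  then show ?thesis by (simp add: admissible_iff eigen_statistic_regular invertible_onI)
qed

text \<open>
  The scores of the eigenstatistics are the eigenfunctions \<open>z 1\<close> to \<open>z p\<close>, on whose span the Rayleigh
  quotient is a weighted mean of the eigenvalues \<open>ev 1\<close> to \<open>ev p\<close>.
\<close>

lemma rho_eigen_statistic:
  assumes p: "p \<ge> 1"
  shows "rho \<Omega> K g0 p (eigen_statistic g0 z) (\<lambda>_. 0) = ev p"
proof (rule antisym)
  show "rho \<Omega> K g0 p (eigen_statistic g0 z) (\<lambda>_. 0) \<le> ev p"
    by (rule rho_le_eigenvalue[OF sd z0 eigen_statistic_admissible p])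
  show "ev p \<le> rho \<Omega> K g0 p (eigen_statistic g0 z) (\<lambda>_. 0)"
  proof (rule rho_ge[OF eigen_statistic_regular p])
    fix c :: "nat \<Rightarrow> real" assume c: "\<exists>i<p. c i \<noteq> 0"
    let ?v = "direction p (eigen_statistic g0 z) c"
    have "ip ?v ?v = (\<Sum>i<p. (c i)\<^sup>2)"
      unfolding direction_def[abs_def]
      by (subst L2.sum_sum)
         (auto simp: score_mem[OF eigen_statistic_regular] eigen_score_inner(1) power2_eq_square
           if_distrib[of "\<lambda>x. _ * x"] if_distrib[of "\<lambda>x. x * _"] cong: if_cong)
    moreover have "B ?v ?v = (\<Sum>i<p. ev (Suc i) * (c i)\<^sup>2)"
      unfolding direction_def[abs_def]
      by (subst form.sum_sum)
         (auto simp: score_mem[OF eigen_statistic_regular] eigen_score_inner(2) power2_eq_square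
           if_distrib[of "\<lambda>x. _ * x"] if_distrib[of "\<lambda>x. x * _"] mult_ac cong: if_cong)
    moreover have "ev p * (\<Sum>i<p. (c i)\<^sup>2) \<le> (\<Sum>i<p. ev (Suc i) * (c i)\<^sup>2)"
      unfolding sum_distrib_left
      using sd by (intro sum_mono mult_right_mono) (auto simp: spectral_decomposition_def decseq_def)
    ultimately show "ev p \<le> B ?v ?v / ip ?v ?v"
      using direction_pos[OF eigen_statistic_admissible c] by (simp add: le_divide_eq)
  qed
qed

lemma eigen_statistic_most_favorable:
  assumes p: "p \<ge> 1"
  shows "eigen_statistic g0 z \<in> most_favorable \<Omega> K g0 p"
  using rho_le_eigenvalue[OF sd z0 _ p] eigen_statistic_admissible rho_eigen_statistic[OF p]
  by (auto simp: most_favorable_def is_arg_max_def not_less)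

end

lemma most_favorable_rho_ge:
  assumes S: "S \<in> most_favorable \<Omega> K g0 k" and k: "k \<ge> 1" and pos: "ev k > 0"
  shows "admissible \<Omega> g0 k S" and "ev k \<le> rho \<Omega> K g0 k S (\<lambda>_. 0)"
proof -
  note nat = natural_parameters_eigen_statistic[OF pos]
  show "admissible \<Omega> g0 k S" using S by (simp add: most_favorable_def is_arg_max_def)
  have "\<not> rho \<Omega> K g0 k (eigen_statistic g0 z) (\<lambda>_. 0) > rho \<Omega> K g0 k S (\<lambda>_. 0)"
    using S eigen_statistic_admissible[OF nat] by (auto simp: most_favorable_def is_arg_max_def)
  then show "ev k \<le> rho \<Omega> K g0 k S (\<lambda>_. 0)" by (simp add: rho_eigen_statistic[OF nat k])
qed

text \<open>
  The span of the scores contains a nonzero vector orthogonal to \<open>z 0\<close> to \<open>z (k - 1)\<close>.  Its Rayleigh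
  quotient is at least \<open>ev k\<close>, since the family is as good as that of the eigenstatistics, so the
  equality case applies to it.
\<close>

lemma eigenfunction_is_direction:
  assumes S: "S \<in> most_favorable \<Omega> K g0 k" and k: "k \<ge> 1" and pos: "ev k > 0"
    and gap: "ev (Suc k) < ev k"
  obtains c where "AE \<mu> in M. z k \<mu> = direction k S c \<mu>"
proof -
  note adm = most_favorable_rho_ge(1)[OF S k pos] and ge = most_favorable_rho_ge(2)[OF S k pos]
  have R: "regular_statistic k S" using adm by (simp add: admissible_iff)
  obtain c where c: "\<exists>i<k. c i \<noteq> 0" "direction k S c \<in> perp \<Omega> z k"
    by (rule exists_direction_perp[where z = z, OF R k eigenfunction_mem[OF sd] z0])
  let ?v = "direction k S c"
  have v: "0 < ip ?v ?v" by (rule direction_pos[OF adm c(1)])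
  have "ev k \<le> B ?v ?v / ip ?v ?v" using ge rho_le[OF R c(1)] by (rule order_trans)
  then have "ev k * ip ?v ?v \<le> B ?v ?v" using v by (simp add: le_divide_eq)
  then have eq: "AE \<mu> in M. ?v \<mu> = ip (z k) ?v * z k \<mu>" by (rule form_eq_on_perp[OF sd c(2) gap])
  have nz: "ip (z k) ?v \<noteq> 0"
  proof
    assume "ip (z k) ?v = 0"
    with eq have "AE \<mu> in M. ?v \<mu> = 0" by simp
    then have "ip ?v ?v = ip (\<lambda>_. 0) ?v"
      by (intro L2_inner_cong_AE direction_mem R L2.zero_mem) auto
    then show False using v by (simp add: L2.zero_left direction_mem R)
  qed
  from eq have "AE \<mu> in M. z k \<mu> = direction k S (\<lambda>i. c i / ip (z k) ?v) \<mu>"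
  proof eventually_elim
    case (elim \<mu>)
    have "direction k S (\<lambda>i. c i / ip (z k) ?v) \<mu> = ?v \<mu> / ip (z k) ?v"
      by (simp add: direction_def sum_divide_distrib)
    then show ?case using elim nz by simp
  qed
  then show ?thesis by (rule that)
qed

end

section \<open>Uniqueness for simple spectrum\<close>

lemma score_linear_combination:
  assumes T: "regular_statistic p T"
  shows "score (\<lambda>\<mu>. \<Sum>j<p. c j * T j \<mu>) \<mu> = (\<Sum>j<p. c j * score (T j) \<mu>)"
proof -
  have "(\<lambda>\<nu>. root_g \<nu> * (\<Sum>j<p. c j * T j \<nu>)) = (\<lambda>\<nu>. \<Sum>j<p. c j * (root_g \<nu> * T j \<nu>))"
    by (simp add: fun_eq_iff sum_distrib_left mult_ac)
  then have "ip root_g (\<lambda>\<nu>. root_g \<nu> * (\<Sum>j<p. c j * T j \<nu>))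
      = (\<Sum>j<p. c j * ip root_g (\<lambda>\<nu>. root_g \<nu> * T j \<nu>))"
    by (simp only:) (rule L2.sum_right; auto simp: regular_mem[OF T] root_g_mem)
  then show ?thesis
    by (simp add: score_def right_diff_distrib sum_subtractf sum_distrib_left sum_distrib_right mult_ac)
qed

text \<open>
  Apply \<open>eigenfunction_is_direction\<close> to the \<open>k\<close>-dimensional most favorable subfamily: its scores are
  combinations of the scores of \<open>T\<close>.
\<close>

lemma hereditary_eigenfunction:
  assumes sd: "spectral_decomposition \<Omega> P ev z" and z0: "AE \<mu> in M. z 0 \<mu> = s * root_g \<mu>"
    and T: "T \<in> hereditarily_most_favorable \<Omega> K g0 p"
    and k: "1 \<le> k" "k \<le> p" and pos: "ev k > 0" and gap: "ev (Suc k) < ev k"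
  shows "\<exists>c. AE \<mu> in M. z k \<mu> = direction p T c \<mu>"
proof (cases "k = p")
  case True
  with T have "T \<in> most_favorable \<Omega> K g0 k" by (simp add: hereditarily_most_favorable_def)
  from eigenfunction_is_direction[OF sd z0 this k(1) pos gap] show ?thesis using True by blast
next
  case False
  have "T \<in> most_favorable \<Omega> K g0 p" using T by (simp add: hereditarily_most_favorable_def)
  then have R: "regular_statistic p T"
    by (simp add: most_favorable_def is_arg_max_def admissible_iff)
  have "k \<in> {1..<p}" using False k by simp
  with T have "\<exists>Bm. (\<lambda>i \<mu>. \<Sum>j<p. Bm i j * T j \<mu>) \<in> most_favorable \<Omega> K g0 k"
    unfolding hereditarily_most_favorable_def by blast
  then obtain Bm where "(\<lambda>i \<mu>. \<Sum>j<p. Bm i j * T j \<mu>) \<in> most_favorable \<Omega> K g0 k" ..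
  from eigenfunction_is_direction[OF sd z0 this k(1) pos gap]
  obtain c where c: "AE \<mu> in M. z k \<mu> = direction k (\<lambda>i \<mu>. \<Sum>j<p. Bm i j * T j \<mu>) c \<mu>" by blast
  have "direction k (\<lambda>i \<mu>. \<Sum>j<p. Bm i j * T j \<mu>) c \<mu> = direction p T (\<lambda>j. \<Sum>i<k. c i * Bm i j) \<mu>" for \<mu>
  proof -
    have "direction k (\<lambda>i \<mu>. \<Sum>j<p. Bm i j * T j \<mu>) c \<mu> = (\<Sum>i<k. \<Sum>j<p. c i * Bm i j * score (T j) \<mu>)"
      by (simp add: direction_def score_linear_combination[OF R] sum_distrib_left mult.assoc)
    also have "\<dots> = (\<Sum>j<p. \<Sum>i<k. c i * Bm i j * score (T j) \<mu>)" by (rule sum.swap)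
    finally show ?thesis by (simp add: direction_def sum_distrib_right)
  qed
  with c show ?thesis by auto
qed

text \<open>
  If \<open>p\<close> orthonormal functions are combinations of \<open>p\<close> scores, the matrix of inner products inverts the
  coefficient matrix, and the scores are conversely combinations of these functions.
\<close>

lemma score_basis_change:
  assumes T: "regular_statistic p T" and on: "\<And>j k. ip (z j) (z k) = (if j = k then 1 else 0)"
    and z: "\<And>k. z k \<in> L2_space \<Omega>"
    and C: "\<And>i. i < p \<Longrightarrow> AE \<mu> in M. z (Suc i) \<mu> = direction p T (C i) \<mu>"
  shows "\<exists>D. inverse_mats p C D \<and> inverse_mats p D C \<and>
    (\<forall>i<p. AE \<mu> in M. score (T i) \<mu> = (\<Sum>k<p. D i k * z (Suc k) \<mu>))"
proof -
  define D where "D i k = ip (score (T i)) (z (Suc k))" for i k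
  have CD: "inverse_mats p C D"
    unfolding inverse_mats_def
  proof (intro allI impI)
    fix i j assume ij: "i < p" "j < p"
    have "mat_mul p C D i j = ip (direction p T (C i)) (z (Suc j))"
      unfolding direction_def[abs_def] mat_mul_def D_def
      by (rule L2.sum_left[symmetric]) (auto simp: score_mem[OF T] z)
    also have "\<dots> = ip (z (Suc i)) (z (Suc j))"
      by (rule L2_inner_cong_AE) (use C[OF ij(1)] in \<open>auto simp: direction_mem T z elim: eventually_mono\<close>)
    finally show "mat_mul p C D i j = (if i = j then 1 else 0)" by (simp add: on)
  qed
  note DC = inverse_mats_commute[OF CD]
  have "AE \<mu> in M. score (T i) \<mu> = (\<Sum>k<p. D i k * z (Suc k) \<mu>)" if i: "i < p" for i
  proof -
    have "AE \<mu> in M. \<forall>k\<in>{..<p}. z (Suc k) \<mu> = direction p T (C k) \<mu>"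
      by (rule AE_finite_allI) (use C in auto)
    then show ?thesis
    proof eventually_elim
      case (elim \<mu>)
      have "score (T i) \<mu> = mat_mul p (mat_mul p D C) (\<lambda>j _. score (T j) \<mu>) i 0"
        using inverse_mats_cancel[OF DC i] by simp
      also have "\<dots> = mat_mul p D (mat_mul p C (\<lambda>j _. score (T j) \<mu>)) i 0" by (rule mat_mul_assoc)
      also have "\<dots> = (\<Sum>k<p. D i k * z (Suc k) \<mu>)"
        using elim by (simp add: mat_mul_def direction_def)
      finally show ?case .
    qed
  qed
  with CD DC show ?thesis by blast
qed

text \<open>
  Passing through the common orthonormal basis expresses the scores of \<open>S\<close> by those of \<open>T\<close>; dividing by
  \<open>root_g\<close> gives an affine relation of the statistics, whose constants are the means.  If both Gram
  matrices are the identity, the change of basis is orthogonal.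
\<close>

lemma scaling_rotation_equiv_of_same_span:
  assumes S: "regular_statistic p S" and T: "regular_statistic p T"
    and on: "\<And>j k. ip (z j) (z k) = (if j = k then 1 else 0)" and z: "\<And>k. z k \<in> L2_space \<Omega>"
    and CS: "\<And>i. i < p \<Longrightarrow> AE \<mu> in M. z (Suc i) \<mu> = direction p S (C i) \<mu>"
    and CT: "\<And>i. i < p \<Longrightarrow> AE \<mu> in M. z (Suc i) \<mu> = direction p T (C' i) \<mu>"
  shows "scaling_rotation_equiv \<Omega> g0 p S T"
proof -
  obtain D where D: "inverse_mats p C D" "inverse_mats p D C"
    "\<forall>i<p. AE \<mu> in M. score (S i) \<mu> = (\<Sum>k<p. D i k * z (Suc k) \<mu>)"
    using score_basis_change[where z = z and C = C, OF S on z CS] by blast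
  obtain D' where D': "inverse_mats p C' D'"
    using score_basis_change[where z = z and C = C', OF T on z CT] by blast
  define A where "A = mat_mul p D C'"
  have inv: "invertible_on p A"
    unfolding A_def by (rule invertible_onI[OF inverse_mats_mult[OF D' D(2)]])
  have score: "AE \<mu> in M. score (S i) \<mu> = direction p T (A i) \<mu>" if i: "i < p" for i
  proof -
    have "AE \<mu> in M. \<forall>k\<in>{..<p}. z (Suc k) \<mu> = direction p T (C' k) \<mu>"
      by (rule AE_finite_allI) (use CT in auto)
    with D(3)[rule_format, OF i] show ?thesis
    proof eventually_elim
      case (elim \<mu>)
      have "score (S i) \<mu> = mat_mul p D (mat_mul p C' (\<lambda>j _. score (T j) \<mu>)) i 0"
        using elim by (simp add: mat_mul_def direction_def)
      also have "\<dots> = mat_mul p A (\<lambda>j _. score (T j) \<mu>) i 0"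
        unfolding A_def by (rule mat_mul_assoc[symmetric])
      finally show ?case by (simp add: mat_mul_def direction_def)
    qed
  qed
  let ?m = "\<lambda>t. ip root_g (\<lambda>\<nu>. root_g \<nu> * t \<nu>)"
  have "AE \<mu> in M. S i \<mu> = (\<Sum>j<p. A i j * T j \<mu>) + (?m (S i) - (\<Sum>j<p. A i j * ?m (T j)))"
    if i: "i < p" for i
    using score[OF i] AE_space
  proof eventually_elim
    case (elim \<mu>)
    then have g: "root_g \<mu> \<noteq> 0" using g0_pos[of \<mu>] by simp
    have sc: "score t \<mu> = root_g \<mu> * (t \<mu> - ?m t)" for t by (simp add: score_def algebra_simps)
    have "root_g \<mu> * (S i \<mu> - ?m (S i)) = root_g \<mu> * (\<Sum>j<p. A i j * (T j \<mu> - ?m (T j)))"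
      using elim(1) unfolding direction_def sc by (simp add: sum_distrib_left mult_ac)
    then have "S i \<mu> - ?m (S i) = (\<Sum>j<p. A i j * (T j \<mu> - ?m (T j)))" using g by simp
    then show ?case by (simp add: right_diff_distrib sum_subtractf)
  qed
  moreover have "orthogonal_on p A" if st: "standardized \<Omega> g0 p S" "standardized \<Omega> g0 p T"
    unfolding orthogonal_on_def
  proof (intro allI impI)
    fix i j assume ij: "i < p" "j < p"
    have iS: "ip (score (S i)) (score (S j)) = (if i = j then 1 else 0)"
      using st(1) ij by (simp add: standardized_def fisher_mu_eq_inner[OF S])
    have iT: "ip (score (T k)) (score (T l)) = (if k = l then 1 else 0)" if "k < p" "l < p" for k l
      using st(2) that by (simp add: standardized_def fisher_mu_eq_inner[OF T])
    have "ip (score (S i)) (score (S j)) = ip (direction p T (A i)) (direction p T (A j))"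
      by (intro L2_inner_cong_AE score_mem[OF S] direction_mem T score ij)
    also have "\<dots> = (\<Sum>k<p. A i k * A j k)"
      unfolding direction_def[abs_def]
      by (subst L2.sum_sum)
         (auto simp: score_mem[OF T] iT if_distrib[of "\<lambda>x. _ * x"] if_distrib[of "\<lambda>x. x * _"] cong: if_cong)
    finally show "(\<Sum>k<p. A i k * A j k) = (if i = j then 1 else 0)" by (simp add: iS)
  qed
  ultimately show ?thesis
    unfolding scaling_rotation_equiv_def using inv
    by (intro exI[of _ A] exI[of _ "\<lambda>i. ?m (S i) - (\<Sum>j<p. A i j * ?m (T j))"]) blast
qed

text \<open>
  A decreasing injective sequence of nonnegative numbers is positive and has gaps everywhere.  As all
  eigenvalues are at most \<open>1\<close>, the fixed vector \<open>root_g\<close> attains the maximum of the Rayleigh quotient,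
  and the gap below \<open>ev 0\<close> makes it a multiple of \<open>z 0\<close>.
\<close>

lemma hereditary_unique:
  assumes sd: "spectral_decomposition \<Omega> P ev z" and inj: "inj ev"
    and S: "S \<in> hereditarily_most_favorable \<Omega> K g0 p"
    and T: "T \<in> hereditarily_most_favorable \<Omega> K g0 p"
  shows "scaling_rotation_equiv \<Omega> g0 p S T"
proof -
  note zm = eigenfunction_mem[OF sd] and on = eigenfunctions_orthonormal[OF sd]
  have gap: "ev (Suc k) < ev k" for k
  proof -
    have "ev (Suc k) \<le> ev k" using sd by (simp add: spectral_decomposition_def decseq_SucD)
    moreover have "ev (Suc k) \<noteq> ev k" using inj by (simp add: inj_eq)
    ultimately show ?thesis by simp
  qed
  have pos: "ev k > 0" for k using gap[of k] eigenvalue_nonneg[OF sd, of "Suc k"] by simp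
  define c where "c = ip (z 0) root_g"
  have eq: "AE \<mu> in M. root_g \<mu> = c * z 0 \<mu>"
    unfolding c_def
    by (rule form_eq_on_perp[OF sd _ gap])
       (use eigenvalue_le_1[OF sd, of 0] in \<open>auto simp: perp_def root_g_mem form_root_g root_g_unit\<close>)
  have c0: "c \<noteq> 0"
  proof
    assume "c = 0"
    with eq have "AE \<mu> in M. root_g \<mu> = 0" by simp
    then have "AE \<mu> in M. False" using AE_space by eventually_elim (use g0_pos in force)
    then show False using not_AE_False by blast
  qed
  from eq have z0: "AE \<mu> in M. z 0 \<mu> = (1 / c) * root_g \<mu>"
    by eventually_elim (use c0 in simp)
  have reg: "regular_statistic p R" if "R \<in> hereditarily_most_favorable \<Omega> K g0 p" for R
    using that by (simp add: hereditarily_most_favorable_def most_favorable_def is_arg_max_def admissible_iff)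
  have "\<exists>C. \<forall>i<p. AE \<mu> in M. z (Suc i) \<mu> = direction p R (C i) \<mu>"
    if "R \<in> hereditarily_most_favorable \<Omega> K g0 p" for R
    using hereditary_eigenfunction[OF sd z0 that _ _ pos gap] by (metis Suc_leI le_add1 plus_1_eq_Suc)
  with S T obtain C C' where
    "\<forall>i<p. AE \<mu> in M. z (Suc i) \<mu> = direction p S (C i) \<mu>"
    "\<forall>i<p. AE \<mu> in M. z (Suc i) \<mu> = direction p T (C' i) \<mu>" by meson
  then show ?thesis
    by (intro scaling_rotation_equiv_of_same_span[where z = z, OF reg[OF S] reg[OF T] on zm]) auto
qed

end

theorem theorem3:
  fixes a b :: real
    and \<Omega> :: "real set"
    and g0 :: "real \<Rightarrow> real"
    and K :: "real \<Rightarrow> real \<Rightarrow> real"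
    and p :: nat
  assumes "a < b" and "\<Omega> = {a..b}"
    and "continuous_on \<Omega> g0"
    and "\<exists>c>0. \<forall>\<mu>\<in>\<Omega>. g0 \<mu> \<ge> c"
    and "(LINT \<mu>|lborel_on \<Omega>. g0 \<mu>) = 1"
    and "continuous_on (\<Omega> \<times> \<Omega>) (\<lambda>(\<mu>, x). K \<mu> x)"
    and "\<exists>c>0. \<forall>\<mu>\<in>\<Omega>. \<forall>x\<in>\<Omega>. K \<mu> x \<ge> c"
    and "\<forall>\<mu>\<in>\<Omega>. (LINT x|lborel_on \<Omega>. K \<mu> x) = 1"
    and "compact_operator_L2 \<Omega> (P_op \<Omega> K g0)"
    and "p \<ge> 1"
  shows "(\<exists>ev \<zeta>. spectral_decomposition \<Omega> (P_op \<Omega> K g0) ev \<zeta> \<and>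
            ev 0 = 1 \<and> (\<forall>\<mu>\<in>\<Omega>. \<zeta> 0 \<mu> = sqrt (g0 \<mu>)) \<and> (\<forall>k. continuous_on \<Omega> (\<zeta> k)))
       \<and> (\<forall>ev \<zeta>. spectral_decomposition \<Omega> (P_op \<Omega> K g0) ev \<zeta> \<and>
            (AE \<mu> in lborel_on \<Omega>. \<zeta> 0 \<mu> = sqrt (g0 \<mu>)) \<and>
            (ev p > 0 \<or> natural_parameters \<Omega> g0 p (eigen_statistic g0 \<zeta>) = UNIV) \<longrightarrow>
            natural_parameters \<Omega> g0 p (eigen_statistic g0 \<zeta>) = UNIV \<and>
            eigen_statistic g0 \<zeta> \<in> most_favorable \<Omega> K g0 p \<and>
            rho \<Omega> K g0 p (eigen_statistic g0 \<zeta>) (\<lambda>_. 0) = ev p)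
       \<and> (\<forall>ev \<zeta>. spectral_decomposition \<Omega> (P_op \<Omega> K g0) ev \<zeta> \<and> inj ev \<longrightarrow>
            (\<forall>S\<in>hereditarily_most_favorable \<Omega> K g0 p.
             \<forall>T\<in>hereditarily_most_favorable \<Omega> K g0 p. scaling_rotation_equiv \<Omega> g0 p S T))"
proof -
  interpret noisy_model a b \<Omega> g0 K
    by unfold_locales (fact assms)+
  show ?thesis
  proof (intro conjI)
    show "\<exists>ev \<zeta>. spectral_decomposition \<Omega> P ev \<zeta> \<and>
            ev 0 = 1 \<and> (\<forall>\<mu>\<in>\<Omega>. \<zeta> 0 \<mu> = sqrt (g0 \<mu>)) \<and> (\<forall>k. continuous_on \<Omega> (\<zeta> k))"
      using spectral_decomposition_P by metis
  next
    show "\<forall>ev \<zeta>. spectral_decomposition \<Omega> P ev \<zeta> \<and>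
            (AE \<mu> in lborel_on \<Omega>. \<zeta> 0 \<mu> = sqrt (g0 \<mu>)) \<and>
            (ev p > 0 \<or> natural_parameters \<Omega> g0 p (eigen_statistic g0 \<zeta>) = UNIV) \<longrightarrow>
            natural_parameters \<Omega> g0 p (eigen_statistic g0 \<zeta>) = UNIV \<and>
            eigen_statistic g0 \<zeta> \<in> most_favorable \<Omega> K g0 p \<and>
            rho \<Omega> K g0 p (eigen_statistic g0 \<zeta>) (\<lambda>_. 0) = ev p"
    proof (intro allI impI, elim conjE)
      fix ev \<zeta>
      assume sd: "spectral_decomposition \<Omega> P ev \<zeta>"
        and top: "AE \<mu> in lborel_on \<Omega>. \<zeta> 0 \<mu> = sqrt (g0 \<mu>)"
        and "ev p > 0 \<or> natural_parameters \<Omega> g0 p (eigen_statistic g0 \<zeta>) = UNIV"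
      then have z0: "AE \<mu> in lborel_on \<Omega>. \<zeta> 0 \<mu> = 1 * sqrt (g0 \<mu>)"
        and nat: "natural_parameters \<Omega> g0 p (eigen_statistic g0 \<zeta>) = UNIV"
        using natural_parameters_eigen_statistic[OF sd, of 1 p] by auto
      show "natural_parameters \<Omega> g0 p (eigen_statistic g0 \<zeta>) = UNIV \<and>
            eigen_statistic g0 \<zeta> \<in> most_favorable \<Omega> K g0 p \<and>
            rho \<Omega> K g0 p (eigen_statistic g0 \<zeta>) (\<lambda>_. 0) = ev p"
        using nat eigen_statistic_most_favorable[OF sd z0 nat] rho_eigen_statistic[OF sd z0 nat]
          assms(10) by blast
    qed
  qed (use hereditary_unique in blast)
qed

end
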